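(* Let $d>0$ and let $V_0:\mathbb{R}\to\mathbb{R}$ be an even, $d$-periodic $C^1$-function. For $t\in[0,d]$ let $L=-\partial_x^2+V(x)$ with $V(x)=V_0(x-t)$ for $x<0$ and $V(x)=V_0(x+t)$ for $x\ge0$. Consider the first finite gap $G_1=(s_2,s_3)$. (a) Suppose $V_0$ is strictly increasing on $[0,\frac d2]$. Then $G_1=(\nu_2,\mu_1)$, and the second Neumann eigenfunction on $[0,d]$ is strictly monotone on $[0,d]$. For the first Dirichlet eigenfunction $u$ on $[0,d]$ one has the alternative: (a1) $u$ is strictly monotone on $[0,\frac d2]$. Then there is exactly one dislocation eigenvalue in $G_1$ for $t\in(0,d)\setminus\{\frac d2\}$ and none for $t=\frac d2$. (a2) $u$ changes monotonicity on $[0,\frac d2]$ exactly once, at an extremal point $d_0\in(0,\frac d2)$. Then the number of dislocation eigenvalues in $G_1$ is: $1$ for $t\in(0,d_0)$; $0$ for $t\in[d_0,\frac d2]$; $2$ for $t\in(\frac d2,d-d_0)$; $1$ for $t\in[d-d_0,d)$; $0$ for $t=d$. (b) Suppose $V_0$ is strictly decreasing on $[0,\frac d2]$. Then $G_1=(\mu_1,\nu_2)$, and the first Dirichlet eigenfunction on $[0,d]$ is strictly monotone on $[0,\frac d2]$. For the second Neumann eigenfunction $u$ on $[0,d]$ one has the alternative: (b1) $u$ is strictly monotone on $[0,\frac d2]$. Then there is exactly one dislocation eigenvalue in $G_1$ for $t\in(0,d)\setminus\{\frac d2\}$ and none for $t=\frac d2$. (b2) $u$ changes monotonicity on $[0,\frac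 d2]$ exactly once, at an extremal point $d_0\in(0,\frac d2)$. Then the number of dislocation eigenvalues in $G_1$ is: $2$ for $t\in(0,d_0)$; $1$ for $t\in[d_0,\frac d2)$; $0$ for $t=\frac d2$; $1$ for $t\in(\frac d2,d-d_0)$; $0$ for $t\in[d-d_0,d]$.
   Context: The operator $L$ (the symmetric dislocation problem with parameter $t$) acts in $L^2(\mathbb{R})$ with domain $H^2(\mathbb{R})$; its eigenvalues are called dislocation eigenvalues. For $k\ge1$, $\mu_k$ and $\nu_k$ denote the $k$-th Dirichlet ($u(0)=u(d)=0$) and $k$-th Neumann ($u'(0)=u'(d)=0$) eigenvalue of $-\partial_x^2+V_0$ on $[0,d]$, in increasing order. The operator $L_0=-\partial_x^2+V_0$ on $\mathbb{R}$ has spectrum $\sigma(L_0)=\bigcup_{n\ge1}[s_{2n-1},s_{2n}]$ with $s_{2n-1}<s_{2n}\le s_{2n+1}$; the $s_j$ are the band edges, i.e. $s_1$ is the lowest $d$-periodic eigenvalue, $s_2\le s_3$ are the two lowest $d$-antiperiodic eigenvalues, and so on alternately. $G_1=(s_2,s_3)$. *)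

theory Defs
  imports "HOL-Analysis.Analysis" "HOL-Library.Function_Algebras"
begin

type_synonym boundary_condition =
  "real \<Rightarrow> (real \<Rightarrow> real) \<Rightarrow> (real \<Rightarrow> real) \<Rightarrow> bool"

definition dirichlet_bc :: boundary_condition where
  "dirichlet_bc d u u' \<longleftrightarrow> u 0 = 0 \<and> u d = 0"

definition neumann_bc :: boundary_condition where
  "neumann_bc d u u' \<longleftrightarrow> u' 0 = 0 \<and> u' d = 0"

definition periodic_bc :: boundary_condition where
  "periodic_bc d u u' \<longleftrightarrow> u d = u 0 \<and> u' d = u' 0"

definition antiperiodic_bc :: boundary_condition where
  "antiperiodic_bc d u u' \<longleftrightarrow> u d = - u 0 \<and> u' d = - u' 0"

text \<open>
  Functions on \<open>[0,d]\<close> are represented by their extension by zero. Derivatives are one-sided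
  at the end points, so this convention does not interfere with the boundary conditions.
\<close>

definition eigenspace ::
  "boundary_condition \<Rightarrow> real \<Rightarrow> (real \<Rightarrow> real) \<Rightarrow> real \<Rightarrow> (real \<Rightarrow> real) set"
  where
  "eigenspace bc d q l =
    {u. (\<forall>x. x \<notin> {0..d} \<longrightarrow> u x = 0) \<and>
        (\<exists>u' u''. (\<forall>x\<in>{0..d}. (u has_real_derivative u' x) (at x within {0..d}) \<and>
                             (u' has_real_derivative u'' x) (at x within {0..d}) \<and>
                             - u'' x + q x * u x = l * u x) \<and>
                 bc d u u')}"

definition multiplicity_of ::
  "boundary_condition \<Rightarrow> real \<Rightarrow> (real \<Rightarrow> real) \<Rightarrow> real \<Rightarrow> nat" where
  "multiplicity_of bc d q l =
    vector_space.dim (\<lambda>(c::real) (f::real \<Rightarrow> real) x. c * f x) (eigenspace bc d q l)"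

text \<open>
  Eigenvalues are indexed from \<open>k = 1\<close> and repeated according to multiplicity; the sum is the
  number of eigenvalues not exceeding \<open>l\<close>.
\<close>

definition kth_eigenvalue ::
  "boundary_condition \<Rightarrow> real \<Rightarrow> (real \<Rightarrow> real) \<Rightarrow> nat \<Rightarrow> real" where
  "kth_eigenvalue bc d q k =
    (LEAST l. k \<le> (\<Sum>m | m \<le> l \<and> eigenspace bc d q m \<noteq> {\<lambda>x. 0}. multiplicity_of bc d q m))"

abbreviation dirichlet_eigenvalue :: "real \<Rightarrow> (real \<Rightarrow> real) \<Rightarrow> nat \<Rightarrow> real" where
  "dirichlet_eigenvalue d \<equiv> kth_eigenvalue dirichlet_bc d"

abbreviation neumann_eigenvalue :: "real \<Rightarrow> (real \<Rightarrow> real) \<Rightarrow> nat \<Rightarrow> real" where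
  "neumann_eigenvalue d \<equiv> kth_eigenvalue neumann_bc d"

definition dirichlet_eigenfunction :: "real \<Rightarrow> (real \<Rightarrow> real) \<Rightarrow> nat \<Rightarrow> (real \<Rightarrow> real) \<Rightarrow> bool" where
  "dirichlet_eigenfunction d q k u \<longleftrightarrow>
    u \<in> eigenspace dirichlet_bc d q (dirichlet_eigenvalue d q k) \<and> u \<noteq> (\<lambda>x. 0)"

definition neumann_eigenfunction :: "real \<Rightarrow> (real \<Rightarrow> real) \<Rightarrow> nat \<Rightarrow> (real \<Rightarrow> real) \<Rightarrow> bool" where
  "neumann_eigenfunction d q k u \<longleftrightarrow>
    u \<in> eigenspace neumann_bc d q (neumann_eigenvalue d q k) \<and> u \<noteq> (\<lambda>x. 0)"

text \<open>
  The band edges \<open>s\<^sub>j\<close>, \<open>j \<ge> 1\<close>. The periodic eigenvalues are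
  \<open>s\<^sub>1, s\<^sub>4, s\<^sub>5, s\<^sub>8, s\<^sub>9, \<dots>\<close> and the antiperiodic ones \<open>s\<^sub>2, s\<^sub>3, s\<^sub>6, s\<^sub>7, \<dots>\<close>; in both
  lists \<open>s\<^sub>j\<close> has position \<open>(j + 1) div 2\<close>.
\<close>

definition band_edge :: "real \<Rightarrow> (real \<Rightarrow> real) \<Rightarrow> nat \<Rightarrow> real" where
  "band_edge d q j =
    kth_eigenvalue (if j mod 4 \<in> {2, 3} then antiperiodic_bc else periodic_bc) d q
      ((j + 1) div 2)"

definition gap :: "real \<Rightarrow> (real \<Rightarrow> real) \<Rightarrow> nat \<Rightarrow> real set" where
  "gap d q n = {band_edge d q (2 * n) <..< band_edge d q (2 * n + 1)}"

definition square_integrable :: "(real \<Rightarrow> complex) \<Rightarrow> bool" where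
  "square_integrable f \<longleftrightarrow>
    f \<in> borel_measurable lborel \<and> integrable lborel (\<lambda>x. (norm (f x))\<^sup>2)"

text \<open>
  Real-valued \<open>C\<^sup>1\<^sub>c\<close> test functions give the same weak derivatives of locally integrable functions
  as complex-valued \<open>C\<^sup>\<infinity>\<^sub>c\<close> ones, by linearity and mollification.
\<close>

definition test_function :: "(real \<Rightarrow> real) \<Rightarrow> bool" where
  "test_function \<phi> \<longleftrightarrow> \<phi> C1_differentiable_on UNIV \<and> compact (closure {x. \<phi> x \<noteq> 0})"

definition weak_derivative :: "(real \<Rightarrow> complex) \<Rightarrow> (real \<Rightarrow> complex) \<Rightarrow> bool" where
  "weak_derivative f g \<longleftrightarrow>
    (\<forall>\<phi>. test_function \<phi> \<longrightarrow>
      (LINT x|lborel. deriv \<phi> x *\<^sub>R f x) = - (LINT x|lborel. \<phi> x *\<^sub>R g x))"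

definition H2_with_derivatives ::
  "(real \<Rightarrow> complex) \<Rightarrow> (real \<Rightarrow> complex) \<Rightarrow> (real \<Rightarrow> complex) \<Rightarrow> bool" where
  "H2_with_derivatives u u' u'' \<longleftrightarrow>
    square_integrable u \<and> square_integrable u' \<and> square_integrable u'' \<and>
    weak_derivative u u' \<and> weak_derivative u' u''"

definition schroedinger_eigenvalue :: "(real \<Rightarrow> real) \<Rightarrow> real \<Rightarrow> bool" where
  "schroedinger_eigenvalue V E \<longleftrightarrow>
    (\<exists>u u' u''. H2_with_derivatives u u' u'' \<and> \<not> (AE x in lborel. u x = 0) \<and>
      (AE x in lborel. - u'' x + of_real (V x) * u x = of_real E * u x))"

definition dislocation_potential :: "(real \<Rightarrow> real) \<Rightarrow> real \<Rightarrow> real \<Rightarrow> real" where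
  "dislocation_potential V\<^sub>0 t x = (if x < 0 then V\<^sub>0 (x - t) else V\<^sub>0 (x + t))"

text \<open>Finiteness is stated explicitly because \<^const>\<open>card\<close> is zero on infinite sets.\<close>

definition num_dislocation_eigenvalues :: "(real \<Rightarrow> real) \<Rightarrow> real \<Rightarrow> real set \<Rightarrow> nat \<Rightarrow> bool" where
  "num_dislocation_eigenvalues V\<^sub>0 t G n \<longleftrightarrow>
    (let S = {E \<in> G. schroedinger_eigenvalue (dislocation_potential V\<^sub>0 t) E}
     in finite S \<and> card S = n)"

definition strictly_monotone_on :: "real set \<Rightarrow> (real \<Rightarrow> real) \<Rightarrow> bool" where
  "strictly_monotone_on A f \<longleftrightarrow> strict_mono_on A f \<or> strict_antimono_on A f"

definition changes_monotonicity_once :: "real \<Rightarrow> real \<Rightarrow> (real \<Rightarrow> real) \<Rightarrow> real \<Rightarrow> bool" where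
  "changes_monotonicity_once a b f c \<longleftrightarrow> c \<in> {a<..<b} \<and>
    (strict_mono_on {a..c} f \<and> strict_antimono_on {c..b} f \<or>
     strict_antimono_on {a..c} f \<and> strict_mono_on {c..b} f)"

end

theory Submission
  imports Defs
begin

text \<open>
  Let \<open>h = d/2\<close> and write \<open>c\<close>, \<open>s\<close> for the solutions of \<open>- u'' + V u = E u\<close> with
  \<open>c 0 = 1, c' 0 = 0\<close> and \<open>s 0 = 0, s' 0 = 1\<close>.

  The potential is even about \<open>0\<close> and about \<open>h\<close>, so each of the boundary value problems on
  \<open>[0,d]\<close> splits into problems on \<open>[0,h]\<close> with a Dirichlet or a Neumann condition at each end.
  The antiperiodic problem becomes the pair of mixed problems. Let \<open>a\<close> be the lowest eigenvalue for
  Neumann at \<open>0\<close> and Dirichlet at \<open>h\<close>, and \<open>b\<close> the lowest one for the opposite choice. Then \<open>a\<close> is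
  the second Neumann eigenvalue, \<open>b\<close> is the first Dirichlet eigenvalue, and the first gap lies between
  them (\<open>neumann_2\<close>, \<open>dirichlet_1\<close>, \<open>gap_1\<close>). If \<open>V\<close> increases on \<open>[0,h]\<close>, minus the derivative of
  the ground state for \<open>a\<close> is positive, satisfies the boundary conditions of the problem for \<open>b\<close>, and
  solves its equation up to a forcing term of one sign. Pairing it with the ground state for \<open>b\<close> gives
  \<open>a < b\<close> (\<open>a_less_b\<close>).

  For \<open>E\<close> in the gap, \<open>psi E\<close> is a solution that decays at \<open>+\<infinity>\<close>, with Floquet multiplier in
  \<open>(-1,0)\<close>. A square integrable solution on a half line has constant Wronskian with the bounded
  function \<open>psi E\<close>, and the constant must vanish. So an eigenfunction of the dislocation problem is a
  multiple of \<open>psi E (x + t)\<close> on the right and of its mirror image on the left, and the two pieces fit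
  together if and only if \<open>psi E t = 0\<close> or \<open>psi' E t = 0\<close> (\<open>eigenvalue_imp_boundary\<close>,
  \<open>boundary_imp_eigenvalue\<close>). It remains to count these \<open>E\<close> for given \<open>t\<close>.

  On \<open>[0,h]\<close> the function \<open>psi E\<close> is a positive combination of \<open>c\<close> and \<open>s\<close>, and on \<open>[h,d]\<close> it is,
  up to a factor, the mirror image of \<open>chi E\<close>, the same combination with opposite sign at \<open>s\<close>. When \<open>E\<close> runs through
  the gap, the direction of \<open>(psi, psi')\<close> at a given point, and that of \<open>(chi, chi')\<close> once \<open>chi\<close> is
  not positive there, turns strictly monotonically, from the direction of the ground state for \<open>a\<close> to that of the ground state for \<open>b\<close>
  (\<open>psi_wronskian_pos\<close>, \<open>chi_comparison\<close>). Hence at a given point each of \<open>psi'\<close>, \<open>chi\<close>, \<open>chi'\<close> vanishes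
  for at most one \<open>E\<close>, and the values at the edges decide whether it does; only the sign of the derivative
  \<open>s'\<close> of the ground state for \<open>b\<close> matters (\<open>states_left\<close>, \<open>states_right\<close>). Because \<open>V\<close>
  increases, this derivative is either positive on \<open>[0,h)\<close> or changes sign once (\<open>s'_b_shape\<close>), which
  is the alternative in the theorem.

  A decreasing potential becomes increasing under translation by \<open>h\<close>. The translation exchanges
  \<open>a\<close> and \<open>b\<close> and changes the dislocation parameter by \<open>h\<close>, so part (b) follows from part (a).
\<close>

section \<open>Linear second-order equations\<close>

definition solves :: "(real \<Rightarrow> real) \<Rightarrow> (real \<Rightarrow> real) \<Rightarrow> (real \<Rightarrow> real) \<Rightarrow> bool" where
  "solves q u u' \<longleftrightarrow> (\<forall>x. (u has_real_derivative u' x) (at x) \<and>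
                          (u' has_real_derivative q x * u x) (at x))"

text \<open>
  The oriented integral gives an antiderivative on the whole line that vanishes at \<open>0\<close>, to either
  side of which the Picard iteration can then proceed at once.
\<close>
definition antideriv :: "(real \<Rightarrow> real) \<Rightarrow> real \<Rightarrow> real" where
  "antideriv f x = (LBINT y=ereal 0..ereal x. f y)"

lemma antideriv_0 [simp]: "antideriv f 0 = 0"
  by (simp add: antideriv_def)

lemma DERIV_antideriv:
  assumes "continuous_on UNIV f"
  shows "(antideriv f has_real_derivative f x) (at x)"
proof -
  define a b where "a = min 0 x - 1" and "b = max 0 x + 1"
  have "(antideriv f has_vector_derivative (f x)) (at x within {a..b})"
    unfolding antideriv_def[abs_def]
    by (rule interval_integral_FTC2)
       (use assms in \<open>auto simp: a_def b_def intro: continuous_on_subset\<close>)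
  moreover have "x \<in> interior {a..b}"
    by (auto simp: a_def b_def)
  ultimately have "(antideriv f has_vector_derivative (f x)) (at x)"
    using at_within_interior[of x "{a..b}"] by metis
  then show ?thesis
    by (simp add: has_real_derivative_iff_has_vector_derivative)
qed

lemma bound_by_monomial:
  fixes G g :: "real \<Rightarrow> real"
  assumes "G 0 = 0" and D: "\<And>y. (G has_real_derivative g y) (at y)"
    and le: "\<And>y. \<bar>y\<bar> \<le> R \<Longrightarrow> \<bar>g y\<bar> \<le> c * \<bar>y\<bar> ^ n" and "\<bar>x\<bar> \<le> R"
  shows "\<bar>G x\<bar> \<le> c * \<bar>x\<bar> ^ Suc n / Suc n"
proof -
  have pos: "G x \<le> c * x ^ Suc n / Suc n"
    if "x \<ge> 0" "x \<le> R" "G 0 = 0" "\<And>y. (G has_real_derivative g y) (at y)"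
       "\<And>y. \<bar>y\<bar> \<le> R \<Longrightarrow> \<bar>g y\<bar> \<le> c * \<bar>y\<bar> ^ n" for G g x
  proof -
    define H where "H y = c * y ^ Suc n / Suc n - G y" for y
    have "((\<lambda>y. c * y ^ Suc n / Suc n) has_real_derivative c * y ^ n) (at y)" for y
      by (auto intro!: derivative_eq_intros simp del: power_Suc)
    then have "(H has_real_derivative c * y ^ n - g y) (at y)" for y
      unfolding H_def by (intro DERIV_diff that(4))
    moreover have "c * y ^ n - g y \<ge> 0" if "0 \<le> y" "y \<le> x" for y
      using \<open>\<And>y. \<bar>y\<bar> \<le> R \<Longrightarrow> \<bar>g y\<bar> \<le> c * \<bar>y\<bar> ^ n\<close>[of y] that \<open>x \<le> R\<close> by auto
    ultimately have "H 0 \<le> H x"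
      using DERIV_nonneg_imp_nondecreasing[of 0 x H] \<open>0 \<le> x\<close> by blast
    then show ?thesis using \<open>G 0 = 0\<close> by (simp add: H_def)
  qed
  show ?thesis
  proof (cases "x \<ge> 0")
    case True
    have "- G x \<le> c * x ^ Suc n / Suc n"
      by (rule pos[OF _ _ _ DERIV_minus[OF D]]) (use assms True in simp_all)
    moreover have "G x \<le> c * x ^ Suc n / Suc n"
      by (rule pos[OF _ _ assms(1) D le]) (use assms True in simp_all)
    ultimately show ?thesis using True by (simp add: abs_le_iff)
  next
    case False
    have D': "((\<lambda>x. G (- x)) has_real_derivative - g (- y)) (at y)" for y
      using DERIV_chain'[OF DERIV_minus[OF DERIV_ident] D, of y] by simp
    have D'': "((\<lambda>x. - G (- x)) has_real_derivative g (- y)) (at y)" for y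
      using DERIV_minus[OF D'[of y]] by simp
    have le': "\<bar>g (- y)\<bar> \<le> c * \<bar>y\<bar> ^ n" "\<bar>- g (- y)\<bar> \<le> c * \<bar>y\<bar> ^ n" if "\<bar>y\<bar> \<le> R" for y
      using le[of "- y"] that by simp_all
    have "G (- (- x)) \<le> c * (-x) ^ Suc n / Suc n"
      by (rule pos[OF _ _ _ D' le'(2)]) (use assms False in simp_all)
    moreover have "- G (- (- x)) \<le> c * (-x) ^ Suc n / Suc n"
      by (rule pos[OF _ _ _ D'' le'(1)]) (use assms False in simp_all)
    ultimately show ?thesis using False by (simp add: abs_le_iff del: power_Suc)
  qed
qed

primrec picard :: "(real \<Rightarrow> real) \<Rightarrow> real \<Rightarrow> real \<Rightarrow> nat \<Rightarrow> real \<Rightarrow> real" where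
  "picard q \<alpha> \<beta> 0 = (\<lambda>x. \<alpha> + \<beta> * x)"
| "picard q \<alpha> \<beta> (Suc n) = antideriv (antideriv (\<lambda>x. q x * picard q \<alpha> \<beta> n x))"

lemma continuous_antideriv:
  "continuous_on UNIV f \<Longrightarrow> continuous_on UNIV (antideriv f)"
  by (rule continuous_at_imp_continuous_on, rule ballI, rule DERIV_isCont, rule DERIV_antideriv)

lemma continuous_picard:
  "continuous_on UNIV q \<Longrightarrow> continuous_on UNIV (picard q \<alpha> \<beta> n)"
proof (induction n)
  case 0
  show ?case by (simp add: continuous_intros)
next
  case (Suc n)
  then have "continuous_on UNIV (\<lambda>x. q x * picard q \<alpha> \<beta> n x)"
    by (intro continuous_on_mult)
  then show ?case by (simp add: continuous_antideriv)
qed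

text \<open>
  The second integration alone provides the factor \<open>|x| / (n + 1)\<close>; the first one is estimated
  crudely by \<open>R\<close>. The factorial that results suffices for convergence.
\<close>
lemma picard_bound:
  assumes q: "continuous_on UNIV q" and Q: "\<And>y. \<bar>y\<bar> \<le> R \<Longrightarrow> \<bar>q y\<bar> \<le> Q"
    and "\<bar>x\<bar> \<le> R"
  shows "\<bar>picard q \<alpha> \<beta> n x\<bar> \<le> (\<bar>\<alpha>\<bar> + \<bar>\<beta>\<bar> * R) * (Q * R) ^ n * \<bar>x\<bar> ^ n / fact n"
    and "\<bar>antideriv (\<lambda>x. q x * picard q \<alpha> \<beta> n x) x\<bar> \<le>
           Q * R * (\<bar>\<alpha>\<bar> + \<bar>\<beta>\<bar> * R) * (Q * R) ^ n * \<bar>x\<bar> ^ n / fact n"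
proof -
  define K where "K = \<bar>\<alpha>\<bar> + \<bar>\<beta>\<bar> * R"
  have "R \<ge> 0" using \<open>\<bar>x\<bar> \<le> R\<close> by linarith
  have "Q \<ge> 0" using Q[of 0] \<open>R \<ge> 0\<close> by auto
  have "K \<ge> 0" by (simp add: K_def \<open>R \<ge> 0\<close>)
  have cont: "continuous_on UNIV (\<lambda>x. q x * picard q \<alpha> \<beta> n x)" for n
    by (intro continuous_intros q continuous_picard)
  have step: "\<bar>antideriv (\<lambda>x. q x * picard q \<alpha> \<beta> n x) y\<bar> \<le> Q * R * K * (Q * R) ^ n * \<bar>y\<bar> ^ n / fact n"
    if IH: "\<And>y. \<bar>y\<bar> \<le> R \<Longrightarrow> \<bar>picard q \<alpha> \<beta> n y\<bar> \<le> K * (Q * R) ^ n * \<bar>y\<bar> ^ n / fact n"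
      and "\<bar>y\<bar> \<le> R" for n y
  proof -
    define C where "C = Q * K * (Q * R) ^ n / fact n"
    have "C \<ge> 0" using \<open>Q \<ge> 0\<close> \<open>K \<ge> 0\<close> \<open>R \<ge> 0\<close> by (simp add: C_def)
    have "\<bar>q z * picard q \<alpha> \<beta> n z\<bar> \<le> C * \<bar>z\<bar> ^ n" if "\<bar>z\<bar> \<le> R" for z
      using mult_mono[OF Q[OF that] IH[OF that]] \<open>Q \<ge> 0\<close>
      by (simp add: abs_mult C_def mult_ac)
    then have "\<bar>antideriv (\<lambda>x. q x * picard q \<alpha> \<beta> n x) y\<bar> \<le> C * \<bar>y\<bar> ^ Suc n / Suc n"
      using bound_by_monomial[OF _ DERIV_antideriv[OF cont] _ \<open>\<bar>y\<bar> \<le> R\<close>] by simp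
    also have "\<dots> \<le> C * \<bar>y\<bar> ^ Suc n"
      using \<open>C \<ge> 0\<close> divide_left_mono[of 1 "real (Suc n)" "C * \<bar>y\<bar> ^ Suc n"] by simp
    also have "\<dots> \<le> C * (R * \<bar>y\<bar> ^ n)"
      using \<open>C \<ge> 0\<close> \<open>\<bar>y\<bar> \<le> R\<close> by (auto intro!: mult_left_mono mult_right_mono)
    finally show ?thesis by (simp add: C_def mult_ac)
  qed
  have main: "\<bar>picard q \<alpha> \<beta> n y\<bar> \<le> K * (Q * R) ^ n * \<bar>y\<bar> ^ n / fact n" if "\<bar>y\<bar> \<le> R" for n y
    using that
  proof (induction n arbitrary: y)
    case 0
    then have "\<bar>\<beta>\<bar> * \<bar>y\<bar> \<le> \<bar>\<beta>\<bar> * R" by (intro mult_left_mono) auto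
    then show ?case
      using abs_triangle_ineq[of \<alpha> "\<beta> * y"] by (simp add: K_def abs_mult)
  next
    case (Suc n)
    have "\<bar>antideriv (\<lambda>x. q x * picard q \<alpha> \<beta> n x) z\<bar> \<le>
            (Q * R * K * (Q * R) ^ n / fact n) * \<bar>z\<bar> ^ n" if "\<bar>z\<bar> \<le> R" for z
      using step[OF Suc.IH that] by simp
    then have "\<bar>picard q \<alpha> \<beta> (Suc n) y\<bar> \<le> (Q * R * K * (Q * R) ^ n / fact n) * \<bar>y\<bar> ^ Suc n / Suc n"
      unfolding picard.simps
      by (intro bound_by_monomial[OF _ DERIV_antideriv[OF continuous_antideriv[OF cont]] _ Suc.prems])
         simp_all
    then show ?case by (simp add: mult_ac)
  qed
  show "\<bar>picard q \<alpha> \<beta> n x\<bar> \<le> (\<bar>\<alpha>\<bar> + \<bar>\<beta>\<bar> * R) * (Q * R) ^ n * \<bar>x\<bar> ^ n / fact n"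
    using main[OF \<open>\<bar>x\<bar> \<le> R\<close>] by (simp add: K_def)
  show "\<bar>antideriv (\<lambda>x. q x * picard q \<alpha> \<beta> n x) x\<bar> \<le>
           Q * R * (\<bar>\<alpha>\<bar> + \<bar>\<beta>\<bar> * R) * (Q * R) ^ n * \<bar>x\<bar> ^ n / fact n"
    using step[OF main \<open>\<bar>x\<bar> \<le> R\<close>] by (simp add: K_def)
qed

text \<open>
  The Picard series and its first two formal derivatives converge uniformly on compact sets by the
  Weierstrass test, so the series may be differentiated twice term by term.
\<close>
lemma solution_exists:
  assumes q: "continuous_on UNIV q"
  shows "\<exists>u u'. solves q u u' \<and> u 0 = \<alpha> \<and> u' 0 = \<beta>"
proof -
  let ?p = "picard q \<alpha> \<beta>"
  define p' where "p' n = (case n of 0 \<Rightarrow> (\<lambda>x. \<beta>) | Suc n \<Rightarrow> antideriv (\<lambda>x. q x * ?p n x))" for n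
  define p'' where "p'' n = (case n of 0 \<Rightarrow> (\<lambda>x. 0) | Suc n \<Rightarrow> (\<lambda>x. q x * ?p n x))" for n
  have cont: "continuous_on UNIV (\<lambda>x. q x * ?p n x)" for n
    by (intro continuous_intros q continuous_picard)
  have Dp: "(?p n has_real_derivative p' n x) (at x)" for n x
  proof (cases n)
    case 0
    have "((\<lambda>x. \<alpha> + \<beta> * x) has_real_derivative \<beta>) (at x)"
      by (auto intro!: derivative_eq_intros)
    then show ?thesis by (simp add: 0 p'_def)
  next
    case (Suc m)
    then show ?thesis
      using DERIV_antideriv[OF continuous_antideriv[OF cont]] by (simp add: p'_def)
  qed
  have Dp': "(p' n has_real_derivative p'' n x) (at x)" for n x
    using DERIV_antideriv[OF cont] by (cases n) (simp_all add: p'_def p''_def)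
  define u u' where "u x = (\<Sum>n. ?p n x)" and "u' x = (\<Sum>n. p' n x)" for x
  have main: "(u has_real_derivative u' x) (at x) \<and> (u' has_real_derivative q x * u x) (at x)" for x
  proof -
    define R where "R = \<bar>x\<bar> + 1"
    define S where "S = {-R..R}"
    have S: "convex S" "0 \<in> S" "x \<in> interior S" and SR: "\<And>y. y \<in> S \<Longrightarrow> \<bar>y\<bar> \<le> R"
      by (auto simp: S_def R_def)
    obtain Q where Q: "\<And>y. \<bar>y\<bar> \<le> R \<Longrightarrow> \<bar>q y\<bar> \<le> Q"
    proof -
      have "bounded (q ` S)"
        by (intro compact_imp_bounded compact_continuous_image continuous_on_subset[OF q])
           (auto simp: S_def)
      then obtain Q where "\<forall>y\<in>S. \<bar>q y\<bar> \<le> Q" by (auto simp: bounded_iff)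
      then show ?thesis using that[of Q] by (simp add: S_def abs_le_iff)
    qed
    have "R \<ge> 0" "Q \<ge> 0" using Q[of 0] by (auto simp: R_def)
    define K where "K = \<bar>\<alpha>\<bar> + \<bar>\<beta>\<bar> * R"
    have "K \<ge> 0" by (simp add: K_def \<open>R \<ge> 0\<close>)
    define e where "e n = K * (Q * R * R) ^ n / fact n" for n
    have sum_e: "summable e"
      using summable_mult[OF summable_exp[of "Q * R * R"], of K]
      by (simp add: e_def[abs_def] divide_inverse mult_ac)
    have b0: "\<bar>?p n y\<bar> \<le> e n" if "y \<in> S" for n y
    proof -
      have "\<bar>?p n y\<bar> \<le> (K * (Q * R) ^ n / fact n) * \<bar>y\<bar> ^ n"
        using picard_bound(1)[OF q Q SR[OF that]] by (simp add: K_def)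
      also have "\<dots> \<le> (K * (Q * R) ^ n / fact n) * R ^ n"
        using SR[OF that] \<open>K \<ge> 0\<close> \<open>Q \<ge> 0\<close> \<open>R \<ge> 0\<close> by (intro mult_left_mono power_mono) auto
      finally show ?thesis by (simp add: e_def power_mult_distrib)
    qed
    have b1: "\<bar>p' (Suc n) y\<bar> \<le> Q * R * e n" if "y \<in> S" for n y
    proof -
      have "\<bar>p' (Suc n) y\<bar> \<le> (Q * R * K * (Q * R) ^ n / fact n) * \<bar>y\<bar> ^ n"
        using picard_bound(2)[OF q Q SR[OF that]] by (simp add: K_def p'_def)
      also have "\<dots> \<le> (Q * R * K * (Q * R) ^ n / fact n) * R ^ n"
        using SR[OF that] \<open>K \<ge> 0\<close> \<open>Q \<ge> 0\<close> \<open>R \<ge> 0\<close> by (intro mult_left_mono power_mono) auto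
      finally show ?thesis by (simp add: e_def power_mult_distrib)
    qed
    have b2: "\<bar>p'' (Suc n) y\<bar> \<le> Q * e n" if "y \<in> S" for n y
      using mult_mono[OF Q[OF SR[OF that]] b0[OF that]] \<open>Q \<ge> 0\<close> by (simp add: p''_def abs_mult)
    have u1: "uniformly_convergent_on S (\<lambda>n x. \<Sum>i<n. p' i x)"
    proof (rule Weierstrass_m_test'[where M="\<lambda>n. case n of 0 \<Rightarrow> \<bar>\<beta>\<bar> | Suc n \<Rightarrow> Q * R * e n"])
      show "norm (p' n y) \<le> (case n of 0 \<Rightarrow> \<bar>\<beta>\<bar> | Suc n \<Rightarrow> Q * R * e n)" if "y \<in> S" for n y
        using b1[OF that] by (cases n) (auto simp: p'_def)
      show "summable (\<lambda>n. case n of 0 \<Rightarrow> \<bar>\<beta>\<bar> | Suc n \<Rightarrow> Q * R * e n)"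
        by (subst summable_Suc_iff[symmetric]) (simp add: summable_mult sum_e)
    qed
    have u2: "uniformly_convergent_on S (\<lambda>n x. \<Sum>i<n. p'' i x)"
    proof (rule Weierstrass_m_test'[where M="\<lambda>n. case n of 0 \<Rightarrow> 0 | Suc n \<Rightarrow> Q * e n"])
      show "norm (p'' n y) \<le> (case n of 0 \<Rightarrow> 0 | Suc n \<Rightarrow> Q * e n)" if "y \<in> S" for n y
        using b2[OF that] by (cases n) (auto simp: p''_def)
      show "summable (\<lambda>n. case n of 0 \<Rightarrow> 0 | Suc n \<Rightarrow> Q * e n)"
        by (subst summable_Suc_iff[symmetric]) (simp add: summable_mult sum_e)
    qed
    have sp: "summable (\<lambda>n. ?p n y)" if "y \<in> S" for y
      using summable_comparison_test'[OF sum_e, of 0 "\<lambda>n. ?p n y"] b0[OF that] by simp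
    have sp': "summable (\<lambda>n. p' n 0)"
      by (subst summable_Suc_iff[symmetric]) (simp add: p'_def)
    have "(u has_real_derivative u' x) (at x)"
      unfolding u_def[abs_def] u'_def
      by (rule has_field_derivative_series'(2)[where f="?p" and f'=p', OF S(1) _ u1 S(2) sp[OF S(2)] S(3)])
         (rule has_field_derivative_at_within[OF Dp])
    moreover have "(u' has_real_derivative (\<Sum>n. p'' n x)) (at x)"
      unfolding u'_def[abs_def]
      by (rule has_field_derivative_series'(2)[where f=p' and f'=p'', OF S(1) _ u2 S(2) sp' S(3)])
         (rule has_field_derivative_at_within[OF Dp'])
    moreover have "(\<Sum>n. p'' n x) = q x * u x"
    proof -
      have "x \<in> S" using S(3) interior_subset by blast
      have "(\<lambda>n. p'' (Suc n) x) sums (q x * u x)"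
        using sums_mult[OF summable_sums[OF sp[OF \<open>x \<in> S\<close>]], of "q x"] by (simp add: p''_def u_def)
      then have "(\<lambda>n. p'' n x) sums (q x * u x + p'' 0 x)" by (rule sums_Suc)
      then have "(\<lambda>n. p'' n x) sums (q x * u x)" by (simp add: p''_def)
      then show ?thesis by (rule sums_unique[symmetric])
    qed
    ultimately show ?thesis by simp
  qed
  have u0: "u 0 = \<alpha>"
  proof -
    have "(\<lambda>n. ?p n 0) = (\<lambda>n. if n = 0 then \<alpha> else 0)"
    proof
      show "?p n 0 = (if n = 0 then \<alpha> else 0)" for n by (cases n) auto
    qed
    then show ?thesis using sums_unique[OF sums_single[of 0 "\<lambda>_. \<alpha>"]] by (simp add: u_def)
  qed
  have u'0: "u' 0 = \<beta>"
  proof -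
    have "(\<lambda>n. p' n 0) = (\<lambda>n. if n = 0 then \<beta> else 0)"
    proof
      show "p' n 0 = (if n = 0 then \<beta> else 0)" for n by (cases n) (auto simp: p'_def)
    qed
    then show ?thesis using sums_unique[OF sums_single[of 0 "\<lambda>_. \<beta>"]] by (simp add: u'_def)
  qed
  show ?thesis using main u0 u'0 by (auto simp: solves_def)
qed

lemma wronskian_DERIV:
  assumes "solves p u u'" "solves q v v'"
  shows "((\<lambda>x. u x * v' x - u' x * v x) has_real_derivative (q x - p x) * u x * v x) (at x)"
proof -
  have "((\<lambda>x. u x * v' x - u' x * v x) has_real_derivative
      (u' x * v' x + (q x * v x) * u x) - ((p x * u x) * v x + v' x * u' x)) (at x)"
    using assms by (intro DERIV_diff DERIV_mult) (simp_all add: solves_def)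
  then show ?thesis by (simp add: algebra_simps)
qed

lemma wronskian_const:
  assumes "solves q u u'" "solves q v v'"
  shows "u x * v' x - u' x * v x = u y * v' y - u' y * v y"
  using wronskian_DERIV[OF assms] by (intro DERIV_isconst_all[of "\<lambda>x. u x * v' x - u' x * v x"]) simp

lemma solves_lin:
  assumes "solves q u u'" "solves q v v'"
  shows "solves q (\<lambda>x. a * u x + b * v x) (\<lambda>x. a * u' x + b * v' x)"
proof -
  have "((\<lambda>x. a * u x + b * v x) has_real_derivative a * u' x + b * v' x) (at x)"
    "((\<lambda>x. a * u' x + b * v' x) has_real_derivative a * (q x * u x) + b * (q x * v x)) (at x)" for x
    using assms by (auto intro!: DERIV_add DERIV_cmult simp: solves_def)
  then show ?thesis by (simp add: solves_def algebra_simps)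
qed

lemma solves_shift:
  assumes "solves q u u'"
  shows "solves (\<lambda>x. q (x + a)) (\<lambda>x. u (x + a)) (\<lambda>x. u' (x + a))"
  using assms by (simp add: solves_def DERIV_shift[symmetric])

lemma solves_reflect:
  assumes "solves q u u'"
  shows "solves (\<lambda>x. q (a - x)) (\<lambda>x. u (a - x)) (\<lambda>x. - u' (a - x))"
proof -
  have D: "((\<lambda>x. a - x) has_real_derivative - 1) (at x)" for x
    by (auto intro!: derivative_eq_intros)
  have "((\<lambda>x. u (a - x)) has_real_derivative - u' (a - x)) (at x)"
       "((\<lambda>x. - u' (a - x)) has_real_derivative q (a - x) * u (a - x)) (at x)" for x
    using assms DERIV_chain'[OF D, of u "u' (a - x)"]
      DERIV_minus[OF DERIV_chain'[OF D, of u' "q (a - x) * u (a - x)"]]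
    by (simp_all add: solves_def)
  then show ?thesis by (simp add: solves_def)
qed

lemma solves_continuous:
  assumes "solves q u u'"
  shows "continuous_on S u" "continuous_on S u'" "isCont u x" "isCont u' x"
  using assms unfolding solves_def
  by (blast intro: DERIV_isCont continuous_at_imp_continuous_on)+

definition ivp :: "(real \<Rightarrow> real) \<Rightarrow> real \<Rightarrow> real \<Rightarrow> (real \<Rightarrow> real) \<times> (real \<Rightarrow> real)" where
  "ivp q \<alpha> \<beta> = (SOME (u, u'). solves q u u' \<and> u 0 = \<alpha> \<and> u' 0 = \<beta>)"

lemma ivp:
  assumes "continuous_on UNIV q"
  shows "solves q (fst (ivp q \<alpha> \<beta>)) (snd (ivp q \<alpha> \<beta>))" "fst (ivp q \<alpha> \<beta>) 0 = \<alpha>" "snd (ivp q \<alpha> \<beta>) 0 = \<beta>"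
proof -
  obtain u u' where "solves q u u' \<and> u 0 = \<alpha> \<and> u' 0 = \<beta>"
    using solution_exists[OF assms, of \<alpha> \<beta>] by blast
  then have "case (u, u') of (u, u') \<Rightarrow> solves q u u' \<and> u 0 = \<alpha> \<and> u' 0 = \<beta>" by simp
  then have "case ivp q \<alpha> \<beta> of (u, u') \<Rightarrow> solves q u u' \<and> u 0 = \<alpha> \<and> u' 0 = \<beta>"
    unfolding ivp_def by (rule someI)
  then show "solves q (fst (ivp q \<alpha> \<beta>)) (snd (ivp q \<alpha> \<beta>))" "fst (ivp q \<alpha> \<beta>) 0 = \<alpha>" "snd (ivp q \<alpha> \<beta>) 0 = \<beta>"
    by (simp_all add: case_prod_beta)
qed

text \<open>
  Gronwall's argument for \<open>F = w\<^sup>2 + w'\<^sup>2\<close>, where \<open>w\<close> is the difference of the solutions for \<open>E\<close> and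
  \<open>E0\<close>: it satisfies the equation for \<open>E\<close> with the inhomogeneity \<open>(E0 - E) u\<close>, which is bounded in
  terms of the one fixed solution for \<open>E0\<close>.
\<close>
lemma energy_lipschitz:
  fixes V :: "real \<Rightarrow> real" and u u' :: "real \<Rightarrow> real \<Rightarrow> real"
  assumes V: "continuous_on UNIV V" and "0 \<le> R"
    and u: "\<And>E. solves (\<lambda>x. V x - E) (u E) (u' E)" "\<And>E. u E 0 = \<alpha>" "\<And>E. u' E 0 = \<beta>"
  shows "\<exists>C>0. \<forall>E x. \<bar>E - E0\<bar> \<le> 1 \<longrightarrow> x \<in> {0..R} \<longrightarrow>
           \<bar>u E x - u E0 x\<bar> \<le> C * \<bar>E - E0\<bar> \<and> \<bar>u' E x - u' E0 x\<bar> \<le> C * \<bar>E - E0\<bar>"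
proof -
  have "bounded (V ` {0..R})" "bounded (u E0 ` {0..R})"
    using continuous_on_subset[OF V] solves_continuous(1)[OF u(1)]
    by (intro compact_imp_bounded compact_continuous_image; simp)+
  then obtain Q M where Q: "\<And>x. x \<in> {0..R} \<Longrightarrow> \<bar>V x\<bar> \<le> Q" and M: "\<And>x. x \<in> {0..R} \<Longrightarrow> \<bar>u E0 x\<bar> \<le> M"
    unfolding bounded_iff by fastforce
  define K where "K = 3 + Q + \<bar>E0\<bar>"
  \<comment> \<open>The summand \<open>1\<close> makes \<open>C\<close> positive also if the solution for \<open>E0\<close> vanishes.\<close>
  define C where "C = sqrt (M\<^sup>2 * R * exp (K * R)) + 1"
  have "M\<^sup>2 * R * exp (K * R) \<ge> 0" using \<open>0 \<le> R\<close> by simp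
  have "C > 0" unfolding C_def by (meson \<open>0 \<le> M\<^sup>2 * R * exp (K * R)\<close> add_nonneg_pos real_sqrt_ge_zero zero_less_one)
  have C2: "M\<^sup>2 * R * exp (K * R) \<le> C\<^sup>2"
  proof -
    have "(sqrt (M\<^sup>2 * R * exp (K * R)))\<^sup>2 \<le> C\<^sup>2"
      unfolding C_def by (rule power_mono) (use \<open>M\<^sup>2 * R * exp (K * R) \<ge> 0\<close> in auto)
    then show ?thesis using \<open>M\<^sup>2 * R * exp (K * R) \<ge> 0\<close> by simp
  qed
  have "\<bar>u E x - u E0 x\<bar> \<le> C * \<bar>E - E0\<bar> \<and> \<bar>u' E x - u' E0 x\<bar> \<le> C * \<bar>E - E0\<bar>"
    if E: "\<bar>E - E0\<bar> \<le> 1" and x: "x \<in> {0..R}" for E x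
  proof -
    define \<delta> where "\<delta> = E - E0"
    define w w' where "w y = u E y - u E0 y" and "w' y = u' E y - u' E0 y" for y
    define F where "F y = (w y)\<^sup>2 + (w' y)\<^sup>2" for y
    define G where "G y = exp (- K * y) * F y - \<delta>\<^sup>2 * M\<^sup>2 * y" for y
    have Dw: "(w has_real_derivative w' y) (at y)" for y
      unfolding w_def[abs_def] w'_def using u(1) by (intro DERIV_diff) (auto simp: solves_def)
    have Dw': "(w' has_real_derivative (V y - E) * w y - \<delta> * u E0 y) (at y)" for y
    proof -
      have "(w' has_real_derivative (V y - E) * u E y - (V y - E0) * u E0 y) (at y)"
        unfolding w'_def[abs_def] using u(1) by (intro DERIV_diff) (auto simp: solves_def)
      then show ?thesis by (simp add: w_def \<delta>_def algebra_simps)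
    qed
    define F' where "F' y = 2 * w y * w' y + 2 * w' y * ((V y - E) * w y - \<delta> * u E0 y)" for y
    have DF: "(F has_real_derivative F' y) (at y)" for y
      unfolding F_def[abs_def] F'_def
      by (rule derivative_eq_intros Dw Dw' refl)+ (simp add: algebra_simps)
    have DG: "(G has_real_derivative exp (- K * y) * (F' y - K * F y) - \<delta>\<^sup>2 * M\<^sup>2) (at y)" for y
      unfolding G_def[abs_def]
      by (rule derivative_eq_intros DF refl)+ (simp add: algebra_simps)
    have neg: "exp (- K * y) * (F' y - K * F y) - \<delta>\<^sup>2 * M\<^sup>2 \<le> 0" if y: "y \<in> {0..R}" for y
    proof -
      have K0: "K \<ge> 0" using Q[OF y] by (simp add: K_def)
      have "2 * w y * w' y \<le> F y" using sum_squares_bound[of "w y" "w' y"] by (simp add: F_def)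
      moreover have "2 * w' y * ((V y - E) * w y) \<le> (Q + \<bar>E0\<bar> + 1) * F y"
      proof -
        have "2 * w' y * ((V y - E) * w y) \<le> \<bar>2 * w' y * ((V y - E) * w y)\<bar>"
          by (rule abs_ge_self)
        also have "\<dots> = \<bar>V y - E\<bar> * (2 * \<bar>w y\<bar> * \<bar>w' y\<bar>)"
          unfolding abs_mult by simp
        also have "\<dots> \<le> (Q + \<bar>E0\<bar> + 1) * (2 * \<bar>w y\<bar> * \<bar>w' y\<bar>)"
          using Q[OF y] E by (intro mult_right_mono) auto
        also have "\<dots> \<le> (Q + \<bar>E0\<bar> + 1) * F y"
          using Q[OF y] sum_squares_bound[of "\<bar>w y\<bar>" "\<bar>w' y\<bar>"] by (intro mult_left_mono) (auto simp: F_def)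
        finally show ?thesis .
      qed
      moreover have "- 2 * w' y * \<delta> * u E0 y \<le> F y + \<delta>\<^sup>2 * M\<^sup>2"
      proof -
        have "- 2 * w' y * \<delta> * u E0 y \<le> (w' y)\<^sup>2 + (\<delta> * u E0 y)\<^sup>2"
          using sum_squares_bound[of "- w' y" "\<delta> * u E0 y"] by (simp add: mult_ac)
        moreover have "(u E0 y)\<^sup>2 \<le> M\<^sup>2"
          using M[OF y] by (metis abs_ge_zero power2_abs power_mono)
        then have "\<delta>\<^sup>2 * (u E0 y)\<^sup>2 \<le> \<delta>\<^sup>2 * M\<^sup>2" by (intro mult_left_mono) auto
        ultimately show ?thesis unfolding F_def power_mult_distrib
          by (smt (verit) zero_le_power2)
      qed
      ultimately have "F' y - K * F y \<le> \<delta>\<^sup>2 * M\<^sup>2"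
        by (simp add: F'_def K_def algebra_simps)
      then have "exp (- K * y) * (F' y - K * F y) \<le> exp (- K * y) * (\<delta>\<^sup>2 * M\<^sup>2)"
        by (intro mult_left_mono) auto
      also have "\<dots> \<le> 1 * (\<delta>\<^sup>2 * M\<^sup>2)"
        using K0 y by (intro mult_right_mono) auto
      finally show ?thesis by simp
    qed
    have "G x \<le> G 0"
      by (rule DERIV_nonpos_imp_nonincreasing) (use x DG neg in \<open>force+\<close>)
    also have "G 0 = 0" by (simp add: G_def F_def w_def w'_def u)
    finally have "exp (- K * x) * F x \<le> \<delta>\<^sup>2 * M\<^sup>2 * x" by (simp add: G_def)
    then have "exp (K * x) * (exp (- K * x) * F x) \<le> exp (K * x) * (\<delta>\<^sup>2 * M\<^sup>2 * x)"
      by (intro mult_left_mono) auto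
    then have "F x \<le> exp (K * x) * (\<delta>\<^sup>2 * M\<^sup>2 * x)"
      by (simp add: mult.assoc[symmetric] exp_add[symmetric])
    also have "\<dots> \<le> exp (K * R) * (\<delta>\<^sup>2 * M\<^sup>2 * R)"
      using x Q[OF x] by (intro mult_mono mult_left_mono) (auto simp: K_def intro!: mult_left_mono)
    also have "\<dots> \<le> C\<^sup>2 * \<delta>\<^sup>2"
      using mult_right_mono[OF C2, of "\<delta>\<^sup>2"] by (simp add: mult_ac)
    finally have "F x \<le> (C * \<bar>\<delta>\<bar>)\<^sup>2" by (simp add: power_mult_distrib)
    then have "(w x)\<^sup>2 \<le> (C * \<bar>\<delta>\<bar>)\<^sup>2" "(w' x)\<^sup>2 \<le> (C * \<bar>\<delta>\<bar>)\<^sup>2"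
      unfolding F_def by (smt (verit) zero_le_power2)+
    then have "\<bar>w x\<bar> \<le> C * \<bar>\<delta>\<bar>" "\<bar>w' x\<bar> \<le> C * \<bar>\<delta>\<bar>"
      using \<open>C > 0\<close> by (metis abs_ge_zero abs_le_square_iff abs_of_nonneg mult_nonneg_nonneg less_imp_le)+
    then show ?thesis by (simp add: w_def w'_def \<delta>_def)
  qed
  then show ?thesis using \<open>C > 0\<close> by blast
qed

lemma first_zero:
  fixes f :: "real \<Rightarrow> real"
  assumes "continuous_on {0..y} f" "f 0 > 0" "f y \<le> 0" "0 \<le> y"
  obtains z where "0 < z" "z \<le> y" "f z = 0" "\<And>x. 0 \<le> x \<Longrightarrow> x < z \<Longrightarrow> f x > 0"
proof -
  define Z where "Z = {x \<in> {0..y}. f x = 0}"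
  have "closed Z" unfolding Z_def using continuous_closed_preimage_constant[OF assms(1)] by simp
  moreover have "Z \<noteq> {}" using IVT2'[of f y 0 0] assms unfolding Z_def by force
  moreover have "bdd_below Z" unfolding Z_def by (rule bdd_belowI[of _ 0]) auto
  ultimately have "Inf Z \<in> Z" using closed_contains_Inf by blast
  show ?thesis
  proof (rule that[of "Inf Z"])
    have "f (Inf Z) = 0" "0 \<le> Inf Z" using \<open>Inf Z \<in> Z\<close> by (auto simp: Z_def)
    then show "f (Inf Z) = 0" "0 < Inf Z" using \<open>f 0 > 0\<close> by (auto simp: less_le)
    show "Inf Z \<le> y" using \<open>Inf Z \<in> Z\<close> by (simp add: Z_def)
    fix x assume x: "0 \<le> x" "x < Inf Z"
    show "f x > 0"
    proof (rule ccontr)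
      assume "\<not> f x > 0"
      then obtain t where "t \<ge> 0" "t \<le> x" "f t = 0"
        using IVT2'[of f x 0 0] assms x \<open>Inf Z \<le> y\<close> continuous_on_subset[OF assms(1), of "{0..x}"] by fastforce
      then have "t \<in> Z" using x \<open>Inf Z \<le> y\<close> by (simp add: Z_def)
      then have "Inf Z \<le> t" using \<open>bdd_below Z\<close> by (rule cInf_lower)
      then show False using \<open>t \<le> x\<close> x by simp
    qed
  qed
qed

text \<open>
  Sturm comparison in the form used throughout: the Wronskian of solutions for energies \<open>E < F\<close> has
  derivative \<open>(E - F) u v\<close>.
\<close>
lemma wronskian_decreasing:
  assumes "solves (\<lambda>x. V x - E) u u'" "solves (\<lambda>x. V x - F) v v'" "E < F" "x < y"
    and pos: "\<And>t. x < t \<Longrightarrow> t < y \<Longrightarrow> u t * v t > 0"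
  shows "u y * v' y - u' y * v y < u x * v' x - u' x * v x"
proof (rule DERIV_neg_imp_decreasing_open[OF \<open>x < y\<close>])
  fix t assume "x < t" "t < y"
  have "((\<lambda>x. u x * v' x - u' x * v x) has_real_derivative ((V t - F) - (V t - E)) * u t * v t) (at t)"
    by (rule wronskian_DERIV[OF assms(1,2)])
  moreover have "((V t - F) - (V t - E)) * u t * v t = - ((F - E) * (u t * v t))" by (simp add: algebra_simps)
  moreover have "- ((F - E) * (u t * v t)) < 0" using pos[OF \<open>x < t\<close> \<open>t < y\<close>] \<open>E < F\<close> by simp
  ultimately show "\<exists>y. ((\<lambda>x. u x * v' x - u' x * v x) has_real_derivative y) (at t) \<and> y < 0"
    by metis
next
  show "continuous_on {x..y} (\<lambda>x. u x * v' x - u' x * v x)"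
    by (intro continuous_intros solves_continuous[OF assms(1)] solves_continuous[OF assms(2)])
qed

lemma deriv_nonpos_at_first_zero:
  fixes f :: "real \<Rightarrow> real"
  assumes "(f has_real_derivative D) (at z)" "f z = 0" "x < z" "\<And>t. x < t \<Longrightarrow> t < z \<Longrightarrow> f t \<ge> 0"
  shows "D \<le> 0"
proof (rule ccontr)
  assume "\<not> D \<le> 0"
  then obtain d where "d > 0" and d: "\<And>h. h > 0 \<Longrightarrow> h < d \<Longrightarrow> f (z - h) < f z"
    using DERIV_pos_inc_left[OF assms(1)] by auto
  define h where "h = min d (z - x) / 2"
  have "h > 0" "h < d" "h < z - x" using \<open>d > 0\<close> \<open>x < z\<close> by (auto simp: h_def)
  then show False using d[of h] assms(2) assms(4)[of "z - h"] by auto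
qed

section \<open>Ground states and Sturm comparison\<close>

definition theta :: "(real \<Rightarrow> real) \<Rightarrow> real \<Rightarrow> real \<Rightarrow> real" where
  "theta V E = fst (ivp (\<lambda>x. V x - E) 1 0)"
definition theta' :: "(real \<Rightarrow> real) \<Rightarrow> real \<Rightarrow> real \<Rightarrow> real" where
  "theta' V E = snd (ivp (\<lambda>x. V x - E) 1 0)"
definition phi :: "(real \<Rightarrow> real) \<Rightarrow> real \<Rightarrow> real \<Rightarrow> real" where
  "phi V E = fst (ivp (\<lambda>x. V x - E) 0 1)"
definition phi' :: "(real \<Rightarrow> real) \<Rightarrow> real \<Rightarrow> real \<Rightarrow> real" where
  "phi' V E = snd (ivp (\<lambda>x. V x - E) 0 1)"

text \<open>
  The lowest eigenvalue of the problem with \<open>u' = 0\<close> at \<open>0\<close> and \<open>u = 0\<close> at \<open>h\<close>. As the energy grows,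
  this is where the solution \<open>theta\<close> first fails to be positive on \<open>[0,h]\<close>.
\<close>
definition ground :: "(real \<Rightarrow> real) \<Rightarrow> real \<Rightarrow> real" where
  "ground V h = Sup {E. \<forall>x\<in>{0..h}. theta V E x > 0}"

locale potential =
  fixes V :: "real \<Rightarrow> real"
  assumes cont_V: "continuous_on UNIV V"
begin

abbreviation "c \<equiv> theta V"
abbreviation "c' \<equiv> theta' V"
abbreviation "s \<equiv> phi V"
abbreviation "s' \<equiv> phi' V"

lemma solves_c: "solves (\<lambda>x. V x - E) (c E) (c' E)"
  and solves_s: "solves (\<lambda>x. V x - E) (s E) (s' E)"
  and initial [simp]: "c E 0 = 1" "c' E 0 = 0" "s E 0 = 0" "s' E 0 = 1"
  using ivp[of "\<lambda>x. V x - E"] cont_V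
  by (simp_all add: theta_def theta'_def phi_def phi'_def continuous_on_diff)

lemma DERIV_c: "(c E has_real_derivative c' E x) (at x)" "(c' E has_real_derivative (V x - E) * c E x) (at x)"
  and DERIV_s: "(s E has_real_derivative s' E x) (at x)" "(s' E has_real_derivative (V x - E) * s E x) (at x)"
  using solves_c solves_s by (auto simp: solves_def)

lemma cont_x: "continuous_on X (c E)" "continuous_on X (c' E)" "continuous_on X (s E)" "continuous_on X (s' E)"
  by (rule solves_continuous[OF solves_c] solves_continuous[OF solves_s])+

lemma wronskian_cs: "c E x * s' E x - c' E x * s E x = 1"
  using wronskian_const[OF solves_c solves_s, of E x 0] by simp

text \<open>
  Uniqueness for the initial value problem comes from the constant Wronskians with \<open>c\<close> and \<open>s\<close>.
  One-sided derivatives on a convex set are enough, as is needed on \<open>[0,d]\<close> and to one side of the dislocation.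
\<close>
lemma expand_on:
  assumes "convex X" "0 \<in> X" "x \<in> X"
    and D: "\<And>x. x \<in> X \<Longrightarrow> (u has_real_derivative u' x) (at x within X)"
    and D': "\<And>x. x \<in> X \<Longrightarrow> (u' has_real_derivative (V x - E) * u x) (at x within X)"
  shows "u x = u 0 * c E x + u' 0 * s E x" "u' x = u 0 * c' E x + u' 0 * s' E x"
proof -
  have const: "f x = f 0" if "\<And>x. x \<in> X \<Longrightarrow> (f has_real_derivative 0) (at x within X)" for f :: "real \<Rightarrow> real"
    using has_field_derivative_zero_constant[OF \<open>convex X\<close> that] assms(2,3) by metis
  have "((\<lambda>x. u x * s' E x - u' x * s E x) has_real_derivative 0) (at x within X)" if "x \<in> X" for x
    by (rule derivative_eq_intros D D' that DERIV_s[THEN has_field_derivative_at_within] refl)+ (simp add: algebra_simps)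
  from const[OF this] have 1: "u x * s' E x - u' x * s E x = u 0" by simp
  have "((\<lambda>x. c E x * u' x - c' E x * u x) has_real_derivative 0) (at x within X)" if "x \<in> X" for x
    by (rule derivative_eq_intros D D' that DERIV_c[THEN has_field_derivative_at_within] refl)+ (simp add: algebra_simps)
  from const[OF this] have 2: "c E x * u' x - c' E x * u x = u' 0" by simp
  have "u x = u x * (c E x * s' E x - c' E x * s E x)" by (simp add: wronskian_cs)
  also have "\<dots> = (u x * s' E x - u' x * s E x) * c E x + (c E x * u' x - c' E x * u x) * s E x"
    by (simp add: algebra_simps)
  finally show "u x = u 0 * c E x + u' 0 * s E x" by (simp add: 1 2)
  have "u' x = u' x * (c E x * s' E x - c' E x * s E x)" by (simp add: wronskian_cs)
  also have "\<dots> = (u x * s' E x - u' x * s E x) * c' E x + (c E x * u' x - c' E x * u x) * s' E x"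
    by (simp add: algebra_simps)
  finally show "u' x = u 0 * c' E x + u' 0 * s' E x" by (simp add: 1 2)
qed

lemma expand:
  assumes "solves (\<lambda>x. V x - E) u u'"
  shows "u x = u 0 * c E x + u' 0 * s E x" "u' x = u 0 * c' E x + u' 0 * s' E x"
  by (rule expand_on[of UNIV]; use assms in \<open>simp add: solves_def\<close>)+

lemma
  assumes "0 \<le> R"
  shows lipschitz_c: "\<exists>C>0. \<forall>E x. \<bar>E - E0\<bar> \<le> 1 \<longrightarrow> x \<in> {0..R} \<longrightarrow>
           \<bar>c E x - c E0 x\<bar> \<le> C * \<bar>E - E0\<bar> \<and> \<bar>c' E x - c' E0 x\<bar> \<le> C * \<bar>E - E0\<bar>"
    and lipschitz_s: "\<exists>C>0. \<forall>E x. \<bar>E - E0\<bar> \<le> 1 \<longrightarrow> x \<in> {0..R} \<longrightarrow>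
           \<bar>s E x - s E0 x\<bar> \<le> C * \<bar>E - E0\<bar> \<and> \<bar>s' E x - s' E0 x\<bar> \<le> C * \<bar>E - E0\<bar>"
proof -
  show "\<exists>C>0. \<forall>E x. \<bar>E - E0\<bar> \<le> 1 \<longrightarrow> x \<in> {0..R} \<longrightarrow>
           \<bar>c E x - c E0 x\<bar> \<le> C * \<bar>E - E0\<bar> \<and> \<bar>c' E x - c' E0 x\<bar> \<le> C * \<bar>E - E0\<bar>"
    by (rule energy_lipschitz[OF cont_V assms solves_c, of 1 0]) simp_all
  show "\<exists>C>0. \<forall>E x. \<bar>E - E0\<bar> \<le> 1 \<longrightarrow> x \<in> {0..R} \<longrightarrow>
           \<bar>s E x - s E0 x\<bar> \<le> C * \<bar>E - E0\<bar> \<and> \<bar>s' E x - s' E0 x\<bar> \<le> C * \<bar>E - E0\<bar>"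
    by (rule energy_lipschitz[OF cont_V assms solves_s, of 0 1]) simp_all
qed

lemma isCont_of_lipschitz:
  fixes f :: "real \<Rightarrow> real"
  assumes "C > 0" "\<And>E. \<bar>E - E0\<bar> \<le> 1 \<Longrightarrow> \<bar>f E - f E0\<bar> \<le> C * \<bar>E - E0\<bar>"
  shows "isCont f E0"
proof -
  have "((\<lambda>E. C * \<bar>E - E0\<bar>) \<longlongrightarrow> C * \<bar>E0 - E0\<bar>) (at E0)"
    by (intro tendsto_intros)
  then have lim: "((\<lambda>E. C * \<bar>E - E0\<bar>) \<longlongrightarrow> 0) (at E0)" by simp
  have "\<forall>\<^sub>F E in at E0. norm (f E - f E0) \<le> C * \<bar>E - E0\<bar>"
    unfolding eventually_at by (rule exI[of _ 1]) (use assms(2) in \<open>auto simp: dist_real_def\<close>)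
  from Lim_null_comparison[OF this lim] show ?thesis
    unfolding isCont_def by (rule LIM_zero_cancel)
qed

lemma cont_E:
  assumes "0 \<le> x"
  shows "continuous_on X (\<lambda>E. c E x)" "continuous_on X (\<lambda>E. c' E x)"
    "continuous_on X (\<lambda>E. s E x)" "continuous_on X (\<lambda>E. s' E x)"
proof -
  have "isCont (\<lambda>E. c E x) E0 \<and> isCont (\<lambda>E. c' E x) E0 \<and> isCont (\<lambda>E. s E x) E0 \<and> isCont (\<lambda>E. s' E x) E0" for E0
  proof -
    obtain C where C: "C > 0" "\<And>E. \<bar>E - E0\<bar> \<le> 1 \<Longrightarrow>
        \<bar>c E x - c E0 x\<bar> \<le> C * \<bar>E - E0\<bar> \<and> \<bar>c' E x - c' E0 x\<bar> \<le> C * \<bar>E - E0\<bar>"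
      using lipschitz_c[OF assms, of E0] assms by auto
    obtain D where D: "D > 0" "\<And>E. \<bar>E - E0\<bar> \<le> 1 \<Longrightarrow>
        \<bar>s E x - s E0 x\<bar> \<le> D * \<bar>E - E0\<bar> \<and> \<bar>s' E x - s' E0 x\<bar> \<le> D * \<bar>E - E0\<bar>"
      using lipschitz_s[OF assms, of E0] assms by auto
    show ?thesis
      using isCont_of_lipschitz[OF C(1), of E0 "\<lambda>E. c E x"] isCont_of_lipschitz[OF C(1), of E0 "\<lambda>E. c' E x"]
        isCont_of_lipschitz[OF D(1), of E0 "\<lambda>E. s E x"] isCont_of_lipschitz[OF D(1), of E0 "\<lambda>E. s' E x"] C(2) D(2)
      by simp
  qed
  then show "continuous_on X (\<lambda>E. c E x)" "continuous_on X (\<lambda>E. c' E x)"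
    "continuous_on X (\<lambda>E. s E x)" "continuous_on X (\<lambda>E. s' E x)"
    by (simp_all add: continuous_at_imp_continuous_on)
qed

lemma c_zero_deriv:
  assumes "c E z = 0" "0 < z" "\<And>x. 0 \<le> x \<Longrightarrow> x < z \<Longrightarrow> c E x > 0"
  shows "c' E z < 0"
proof -
  have "c' E z \<le> 0"
    by (rule deriv_nonpos_at_first_zero[OF DERIV_c(1) assms(1,2)]) (use assms(3) in \<open>simp add: less_imp_le\<close>)
  moreover have "c' E z \<noteq> 0" using wronskian_cs[of E z] assms(1) by auto
  ultimately show ?thesis by simp
qed

text \<open>
  Below the potential, \<open>c c'\<close> has derivative \<open>c'\<^sup>2 + (V - E) c\<^sup>2 > 0\<close>.
\<close>
lemma low_energy_positive:
  assumes "\<And>x. x \<in> {0..h} \<Longrightarrow> V x > E" "x \<in> {0..h}"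
  shows "c E x > 0" and "0 < x \<Longrightarrow> c' E x > 0"
proof -
  have D: "((\<lambda>x. c E x * c' E x) has_real_derivative (c' E x)\<^sup>2 + (V x - E) * (c E x)\<^sup>2) (at x)" for x
    by (rule derivative_eq_intros DERIV_c refl)+ (simp add: power2_eq_square algebra_simps)
  have pos: "(c' E x)\<^sup>2 + (V x - E) * (c E x)\<^sup>2 > 0" if "x \<in> {0..h}" for x
  proof (cases "c E x = 0")
    case True
    then have "c' E x \<noteq> 0" using wronskian_cs[of E x] by auto
    then show ?thesis using True by simp
  next
    case False
    then show ?thesis using assms(1)[OF that] by (simp add: add_nonneg_pos)
  qed
  have cc: "c E x * c' E x > 0" if "0 < x" "x \<le> h" for x
  proof -
    have "c E 0 * c' E 0 < c E x * c' E x"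
      by (rule DERIV_pos_imp_increasing[OF \<open>0 < x\<close>, where f="\<lambda>x. c E x * c' E x"])
         (use D pos that in \<open>meson atLeastAtMost_iff order_trans\<close>)
    then show ?thesis by simp
  qed
  have c_pos: "c E x > 0" if "x \<in> {0..h}" for x
  proof (rule ccontr)
    assume "\<not> c E x > 0"
    obtain z where "0 < z" "z \<le> x" "c E z = 0"
      by (rule first_zero[where f="c E" and y=x, OF cont_x(1)]) (use \<open>\<not> c E x > 0\<close> \<open>x \<in> {0..h}\<close> in auto)
    then show False using cc[of z] that by simp
  qed
  then show "c E x > 0" using assms(2) .
  assume "0 < x"
  then show "c' E x > 0" using cc[of x] c_pos[of x] assms(2) by (simp add: zero_less_mult_iff)
qed

text \<open>
  Comparison with \<open>cos (k x)\<close>, whose first positive zero is \<open>h\<close> for \<open>k = \<pi> / (2 h)\<close>.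
\<close>
lemma high_energy_zero:
  assumes "0 < h" "\<And>x. x \<in> {0..h} \<Longrightarrow> V x + (pi / (2 * h))\<^sup>2 \<le> E"
  shows "\<exists>x\<in>{0..h}. c E x \<le> 0"
proof (rule ccontr)
  assume "\<not> ?thesis"
  then have pos: "c E x > 0" if "x \<in> {0..h}" for x using that by force
  define k where "k = pi / (2 * h)"
  have "k > 0" using assms(1) by (simp add: k_def)
  define F where "F x = cos (k * x) * c' E x + k * sin (k * x) * c E x" for x
  have D: "(F has_real_derivative (k\<^sup>2 + V x - E) * cos (k * x) * c E x) (at x)" for x
    unfolding F_def[abs_def]
    by (rule derivative_eq_intros DERIV_c refl)+ (simp add: power2_eq_square algebra_simps)
  have "F h \<le> F 0"
  proof (rule DERIV_nonpos_imp_nonincreasing[of 0 h F])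
    fix x assume x: "0 \<le> x" "x \<le> h"
    then have "k * x \<le> k * h" "0 \<le> k * x" using \<open>k > 0\<close> by (auto intro: mult_left_mono)
    moreover have "k * h = pi / 2" using assms(1) by (simp add: k_def)
    ultimately have "cos (k * x) \<ge> 0" by (intro cos_ge_zero) auto
    then have "cos (k * x) * c E x \<ge> 0" using pos[of x] x by (intro mult_nonneg_nonneg) auto
    moreover have "k\<^sup>2 + V x - E \<le> 0" using assms(2)[of x] x by (simp add: k_def)
    ultimately have "(k\<^sup>2 + V x - E) * cos (k * x) * c E x \<le> 0"
      by (metis mult.assoc mult_nonpos_nonneg)
    then show "\<exists>y. (F has_real_derivative y) (at x) \<and> y \<le> 0" using D by blast
  qed (use assms in auto)
  moreover have "F 0 = 0" by (simp add: F_def)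
  moreover have "k * h = pi / 2" using assms(1) by (simp add: k_def)
  then have "F h = k * c E h" unfolding F_def by (simp only: cos_pi_half sin_pi_half mult_zero_left mult_1_right add_0)
  ultimately show False using pos[of h] \<open>k > 0\<close> assms(1) by (simp add: mult_le_0_iff)
qed

lemma V_bounded: obtains m M where "\<And>x. x \<in> {0..h} \<Longrightarrow> m \<le> V x \<and> V x \<le> M"
proof -
  have "bounded (V ` {0..h})"
    by (intro compact_imp_bounded compact_continuous_image continuous_on_subset[OF cont_V]) auto
  then obtain B where "\<forall>x\<in>{0..h}. \<bar>V x\<bar> \<le> B" by (auto simp: bounded_iff)
  then show ?thesis by (intro that[of "-B" B]) (use abs_le_iff in fastforce)
qed

lemma low_energy: obtains E where "\<And>x. x \<in> {0..h} \<Longrightarrow> c E x > 0" "0 < h \<Longrightarrow> c' E h > 0"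
proof -
  obtain m M where mM: "\<And>x. x \<in> {0..h} \<Longrightarrow> m \<le> V x \<and> V x \<le> M" using V_bounded by blast
  have "V x > m - 1" if "x \<in> {0..h}" for x using mM[OF that] by simp
  from low_energy_positive[of h "m - 1", OF this] show ?thesis by (intro that[of "m - 1"]) auto
qed

lemma positive_open:
  assumes "0 < h" "\<And>x. x \<in> {0..h} \<Longrightarrow> c E x > 0"
  shows "\<exists>F>E. \<forall>x\<in>{0..h}. c F x > 0"
proof -
  obtain x0 where x0: "x0 \<in> {0..h}" "\<And>x. x \<in> {0..h} \<Longrightarrow> c E x0 \<le> c E x"
    using continuous_attains_inf[OF _ _ cont_x(1), of "{0..h}" E] assms(1) by auto
  obtain C where C: "C > 0" "\<And>F x. \<bar>F - E\<bar> \<le> 1 \<Longrightarrow> x \<in> {0..h} \<Longrightarrow> \<bar>c F x - c E x\<bar> \<le> C * \<bar>F - E\<bar>"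
    using lipschitz_c[of h E] assms(1) by auto
  define \<delta> where "\<delta> = min 1 (c E x0 / (2 * C))"
  have \<delta>: "0 < \<delta>" "\<delta> \<le> 1" using assms(2)[OF x0(1)] C(1) by (auto simp: \<delta>_def)
  have "C * \<delta> \<le> C * (c E x0 / (2 * C))" using C(1) by (intro mult_left_mono) (auto simp: \<delta>_def)
  then have C\<delta>: "C * \<delta> < c E x0" using C(1) assms(2)[OF x0(1)] by simp
  have "c (E + \<delta>) x > 0" if "x \<in> {0..h}" for x
    using C(2)[of "E + \<delta>" x] \<delta> C\<delta> x0(2)[OF that] that by auto
  then show ?thesis using \<delta> by (intro exI[of _ "E + \<delta>"]) auto
qed

text \<open>
  Positivity on \<open>[0,h]\<close> is an open condition in the energy, so it fails at the supremum, where
  nonnegativity persists. An interior zero would be a minimum, hence a double zero, which a nontrivial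
  solution cannot have. Thus the zero sits at \<open>h\<close>.
\<close>
theorem ground_state:
  assumes "0 < h"
  shows "c (ground V h) h = 0" "\<And>x. 0 \<le> x \<Longrightarrow> x < h \<Longrightarrow> c (ground V h) x > 0"
    and "c' (ground V h) h < 0"
proof -
  define Q where "Q = {E. \<forall>x\<in>{0..h}. c E x > 0}"
  define e where "e = ground V h"
  have e: "e = Sup Q" by (simp add: e_def ground_def Q_def)
  obtain E0 where "\<And>x. x \<in> {0..h} \<Longrightarrow> c E0 x > 0" using low_energy[of h] by metis
  then have "E0 \<in> Q" by (simp add: Q_def)
  then have "Q \<noteq> {}" by blast
  obtain m M where mM: "\<And>x. x \<in> {0..h} \<Longrightarrow> m \<le> V x \<and> V x \<le> M" using V_bounded by blast
  have "bdd_above Q"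
  proof (rule bdd_aboveI[of _ "M + (pi / (2 * h))\<^sup>2"], rule ccontr)
    fix E assume "E \<in> Q" "\<not> E \<le> M + (pi / (2 * h))\<^sup>2"
    then have "\<exists>x\<in>{0..h}. c E x \<le> 0" using mM by (intro high_energy_zero[OF assms]) fastforce
    then show False using \<open>E \<in> Q\<close> by (force simp: Q_def)
  qed
  have notin: "e \<notin> Q"
  proof
    assume "e \<in> Q"
    then obtain F where "F > e" "F \<in> Q" using positive_open[OF assms, of e] by (auto simp: Q_def)
    then show False using cSup_upper[OF \<open>F \<in> Q\<close> \<open>bdd_above Q\<close>] e by simp
  qed
  have nonneg: "c e x \<ge> 0" if "x \<in> {0..h}" for x
  proof (rule ccontr)
    assume "\<not> c e x \<ge> 0"
    obtain C where C0: "C > 0"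
        "\<And>F x. \<bar>F - e\<bar> \<le> 1 \<Longrightarrow> x \<in> {0..h} \<Longrightarrow> \<bar>c F x - c e x\<bar> \<le> C * \<bar>F - e\<bar>"
      using lipschitz_c[of h e] assms by auto
    note C = C0(1) C0(2)[OF _ \<open>x \<in> {0..h}\<close>]
    define \<delta> where "\<delta> = min 1 (- c e x / C)"
    have "\<delta> > 0" using \<open>\<not> c e x \<ge> 0\<close> C(1) by (simp add: \<delta>_def divide_neg_pos)
    then obtain F where F: "F \<in> Q" "e - \<delta> < F" using less_cSup_iff[OF \<open>Q \<noteq> {}\<close> \<open>bdd_above Q\<close>, of "e - \<delta>"] e by auto
    have "F \<le> e" using cSup_upper[OF F(1) \<open>bdd_above Q\<close>] e by simp
    have "\<bar>F - e\<bar> < \<delta>" "\<bar>F - e\<bar> \<le> 1" using F(2) \<open>F \<le> e\<close> by (auto simp: \<delta>_def)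
    have "C * \<bar>F - e\<bar> < C * (- c e x / C)"
      using \<open>\<bar>F - e\<bar> < \<delta>\<close> C(1) by (intro mult_strict_left_mono) (auto simp: \<delta>_def)
    then have "c F x < 0" using C(2)[OF \<open>\<bar>F - e\<bar> \<le> 1\<close>] C(1) by auto
    then show False using F(1) that by (force simp: Q_def)
  qed
  have interior: "c e x > 0" if "0 \<le> x" "x < h" for x
  proof (rule ccontr)
    assume "\<not> c e x > 0"
    then have "c e x = 0" using nonneg[of x] that by auto
    then have "0 < x" using that by (auto simp: less_le)
    have "c' e x = 0"
    proof (rule DERIV_local_min[OF DERIV_c(1)])
      show "0 < min x (h - x)" using \<open>0 < x\<close> that by simp
      show "\<forall>y. \<bar>x - y\<bar> < min x (h - x) \<longrightarrow> c e x \<le> c e y"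
      proof (intro allI impI)
        fix y assume "\<bar>x - y\<bar> < min x (h - x)"
        then have "y \<in> {0..h}" by auto
        from nonneg[OF this] show "c e x \<le> c e y" using \<open>c e x = 0\<close> by simp
      qed
    qed
    then show False using wronskian_cs[of e x] \<open>c e x = 0\<close> by simp
  qed
  then show "c (ground V h) x > 0" if "0 \<le> x" "x < h" for x using that by (simp add: e_def)
  have "\<not> c e h > 0" using notin interior unfolding Q_def by (force simp: le_less)
  then have "c e h = 0" using nonneg[of h] assms by simp
  then show "c (ground V h) h = 0" by (simp add: e_def)
  show "c' (ground V h) h < 0"
    using c_zero_deriv[OF \<open>c e h = 0\<close> assms interior] by (simp add: e_def)
qed

lemma below_ground:
  assumes "0 < h" "E < ground V h" "x \<in> {0..h}"
  shows "c E x > 0"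
proof (rule ccontr)
  let ?e = "ground V h"
  assume "\<not> c E x > 0"
  then obtain z where z: "0 < z" "z \<le> x" "c E z = 0" "\<And>x. 0 \<le> x \<Longrightarrow> x < z \<Longrightarrow> c E x > 0"
    using first_zero[OF cont_x(1), of E x] assms(3) by auto
  have "c E z * c' ?e z - c' E z * c ?e z < c E 0 * c' ?e 0 - c' E 0 * c ?e 0"
    by (rule wronskian_decreasing[OF solves_c solves_c assms(2) \<open>0 < z\<close>])
       (use z ground_state(2)[OF assms(1)] assms(3) in auto)
  moreover have "c ?e z \<ge> 0" using ground_state(1,2)[OF assms(1)] z assms(3) by (cases "z = h") (auto simp: less_imp_le)
  moreover have "c' E z < 0" using c_zero_deriv[OF z(3,1,4)] .
  moreover have "c' E z * c ?e z \<le> 0"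
    using \<open>c ?e z \<ge> 0\<close> \<open>c' E z < 0\<close> by (simp add: mult_nonpos_nonneg)
  ultimately show False using z(3) by simp
qed

lemma above_ground:
  assumes "0 < h" "ground V h < E"
  shows "\<exists>z. 0 < z \<and> z < h \<and> c E z = 0"
proof (rule ccontr)
  let ?e = "ground V h"
  assume no: "\<not> ?thesis"
  have pos: "c E x > 0" if "0 \<le> x" "x < h" for x
  proof (rule ccontr)
    assume "\<not> c E x > 0"
    obtain z where "0 < z" "z \<le> x" "c E z = 0"
      by (rule first_zero[where f="c E" and y=x, OF cont_x(1)]) (use \<open>\<not> c E x > 0\<close> \<open>0 \<le> x\<close> in auto)
    then show False using no that by auto
  qed
  have "c ?e h * c' E h - c' ?e h * c E h < c ?e 0 * c' E 0 - c' ?e 0 * c E 0"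
    by (rule wronskian_decreasing[OF solves_c solves_c assms(2,1)])
       (use pos ground_state(2)[OF assms(1)] in auto)
  moreover have "c E h \<ge> 0"
  proof (rule ccontr)
    assume "\<not> c E h \<ge> 0"
    obtain z where "0 < z" "z \<le> h" "c E z = 0"
      by (rule first_zero[where f="c E" and y=h, OF cont_x(1)]) (use \<open>\<not> c E h \<ge> 0\<close> assms in auto)
    then show False using no \<open>\<not> c E h \<ge> 0\<close> by (cases "z = h") auto
  qed
  moreover have "c' ?e h < 0" by (rule ground_state(3)[OF assms(1)])
  moreover from calculation(2,3) have "c' ?e h * c E h \<le> 0"
    by (simp add: mult_nonpos_nonneg)
  ultimately show False using ground_state(1)[OF assms(1)] by simp
qed

end

section \<open>Even periodic potentials\<close>

text \<open>
  Translation by half a period exchanges the roles of the two symmetry points \<open>0\<close> and \<open>d/2\<close>. An even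
  periodic potential keeps its symmetries and is reflected on \<open>[0,d/2]\<close>.
\<close>
definition half_shift :: "real \<Rightarrow> (real \<Rightarrow> real) \<Rightarrow> real \<Rightarrow> real" where
  "half_shift d V x = V (x + d / 2)"

locale even_periodic = potential V for V :: "real \<Rightarrow> real" +
  fixes d :: real
  assumes d_pos: "0 < d" and even_V: "V (- x) = V x" and periodic_V: "V (x + d) = V x"
begin

abbreviation "h \<equiv> d / 2"
abbreviation "W \<equiv> half_shift d V"
abbreviation "a \<equiv> ground V h"
abbreviation "b \<equiv> ground W h"

lemma h_pos: "0 < h" using d_pos by simp

lemma V_mirror: "V (d - x) = V x"
  using periodic_V[of "- x"] even_V[of x] by (simp add: add.commute)

lemma half_shift: "even_periodic W d"
proof
  show "continuous_on UNIV W"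
    unfolding half_shift_def[abs_def]
    by (rule continuous_on_compose2[OF cont_V]) (auto intro!: continuous_intros)
  show "W (- x) = W x" for x
    using V_mirror[of "x + d / 2"] by (simp add: half_shift_def)
  show "W (x + d) = W x" for x
    using periodic_V[of "x + d / 2"] by (simp add: half_shift_def add_ac)
qed (rule d_pos)

lemma half_shift_twice: "half_shift d W = V"
proof
  fix x
  have "x + d / 2 + d / 2 = x + d" by simp
  then show "half_shift d W x = V x" unfolding half_shift_def by (simp only: periodic_V)
qed

lemma c_even: "c E (- x) = c E x" "c' E (- x) = - c' E x"
  and s_odd: "s E (- x) = - s E x" "s' E (- x) = s' E x"
proof -
  have "solves (\<lambda>x. V x - E) (\<lambda>x. c E (0 - x)) (\<lambda>x. - c' E (0 - x))"
    using solves_reflect[OF solves_c, of 0 E] by (simp add: even_V)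
  from expand[OF this, of x] show "c E (- x) = c E x" "c' E (- x) = - c' E x" by simp_all
  have "solves (\<lambda>x. V x - E) (\<lambda>x. s E (0 - x)) (\<lambda>x. - s' E (0 - x))"
    using solves_reflect[OF solves_s, of 0 E] by (simp add: even_V)
  from expand[OF this, of x] show "s E (- x) = - s E x" "s' E (- x) = s' E x" by simp_all
qed

lemma mirror_c: "c E (d - x) = c E d * c E x - c' E d * s E x"
    "c' E (d - x) = - (c E d * c' E x - c' E d * s' E x)"
  and mirror_s: "s E (d - x) = s E d * c E x - s' E d * s E x"
    "s' E (d - x) = - (s E d * c' E x - s' E d * s' E x)"
proof -
  have "solves (\<lambda>x. V x - E) (\<lambda>x. c E (d - x)) (\<lambda>x. - c' E (d - x))"
    using solves_reflect[OF solves_c, of d E] by (simp add: V_mirror)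
  from expand[OF this, of x] show "c E (d - x) = c E d * c E x - c' E d * s E x"
    "c' E (d - x) = - (c E d * c' E x - c' E d * s' E x)" by simp_all
  have "solves (\<lambda>x. V x - E) (\<lambda>x. s E (d - x)) (\<lambda>x. - s' E (d - x))"
    using solves_reflect[OF solves_s, of d E] by (simp add: V_mirror)
  from expand[OF this, of x] show "s E (d - x) = s E d * c E x - s' E d * s E x"
    "s' E (d - x) = - (s E d * c' E x - s' E d * s' E x)" by simp_all
qed

text \<open>
  The half-period formulas: evaluating \<open>mirror_c\<close> and \<open>mirror_s\<close> at the centre \<open>x = d - x = h\<close> and
  solving the resulting linear equations, whose determinant is the Wronskian.
\<close>
lemma at_period:
  "c E d = 2 * c E h * s' E h - 1" "c' E d = 2 * c E h * c' E h"
  "s E d = 2 * s E h * s' E h" "s' E d = 2 * c E h * s' E h - 1"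
proof -
  define C C' S S' where "C = c E h" "C' = c' E h" "S = s E h" "S' = s' E h"
  have w: "C * S' - C' * S = 1" using wronskian_cs[of E h] by (simp add: C_C'_S_S'_def)
  have dh: "d - h = h" by simp
  have 1: "C = c E d * C - c' E d * S" and 2: "C' = - (c E d * C' - c' E d * S')"
    and 3: "S = s E d * C - s' E d * S" and 4: "S' = - (s E d * C' - s' E d * S')"
    using mirror_c[of E h] mirror_s[of E h] unfolding dh C_C'_S_S'_def by simp_all
  have "c E d * (C * S' - C' * S) = C * S' + C' * S" using 1 2 by algebra
  moreover have "c' E d * (C * S' - C' * S) = 2 * C * C'" using 1 2 by algebra
  moreover have "s E d * (C * S' - C' * S) = 2 * S * S'" using 3 4 by algebra
  moreover have "s' E d * (C * S' - C' * S) = C * S' + C' * S" using 3 4 by algebra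
  ultimately show "c E d = 2 * c E h * s' E h - 1" "c' E d = 2 * c E h * c' E h"
    "s E d = 2 * s E h * s' E h" "s' E d = 2 * c E h * s' E h - 1"
    using w unfolding C_C'_S_S'_def[symmetric] by (simp_all add: algebra_simps)
qed

text \<open>
  Reversing \<open>[0,h]\<close> turns the transfer matrix into its inverse up to signs, so translation by \<open>h\<close>
  merely swaps \<open>c\<close> and \<open>s'\<close> at \<open>h\<close>.
\<close>
lemma shift_at_half:
  "theta W E h = s' E h" "theta' W E h = c' E h" "phi W E h = s E h" "phi' W E h = c E h"
  and shift_expand: "theta W E (h - x) = s' E h * c E x - c' E h * s E x"
proof -
  interpret W: even_periodic W d by (rule half_shift)
  have WV: "W (h - x) = V x" for x
    using V_mirror[of x] by (simp add: half_shift_def)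
  have hh: "h - h = 0" by simp
  have "solves (\<lambda>x. V x - E) (\<lambda>x. theta W E (h - x)) (\<lambda>x. - theta' W E (h - x))"
    using solves_reflect[OF W.solves_c, of h E] by (simp only: WV)
  note c = expand[OF this]
  have "solves (\<lambda>x. V x - E) (\<lambda>x. phi W E (h - x)) (\<lambda>x. - phi' W E (h - x))"
    using solves_reflect[OF W.solves_s, of h E] by (simp only: WV)
  note s = expand[OF this]
  have 1: "1 = theta W E h * c E h - theta' W E h * s E h" "0 = theta W E h * c' E h - theta' W E h * s' E h"
    using c[of h] unfolding hh by simp_all
  have 2: "0 = phi W E h * c E h - phi' W E h * s E h" "- 1 = phi W E h * c' E h - phi' W E h * s' E h"
    using s[of h] unfolding hh by simp_all
  have w: "c E h * s' E h - c' E h * s E h = 1" by (rule wronskian_cs)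
  show *: "theta W E h = s' E h" "theta' W E h = c' E h" using 1 w by algebra+
  show "phi W E h = s E h" "phi' W E h = c E h" using 2 w by algebra+
  show "theta W E (h - x) = s' E h * c E x - c' E h * s E x"
    using c(1)[of x] by (simp add: *)
qed

text \<open>
  Reflected to \<open>[0,h]\<close>, the ground state of the translated potential is a multiple of \<open>s\<close> for \<open>V\<close>. In
  this way every fact about \<open>a\<close> yields one about \<open>b\<close>.
\<close>
lemma at_b: "s' b h = 0" "c' b h < 0" "theta W b (h - x) = - c' b h * s b x"
proof -
  interpret W: even_periodic W d by (rule half_shift)
  show "s' b h = 0" "c' b h < 0"
    using W.ground_state(1,3)[OF h_pos] by (simp_all add: shift_at_half)
  then show "theta W b (h - x) = - c' b h * s b x" by (simp add: shift_expand)
qed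

lemma s'_pos: assumes "E < b" shows "s' E h > 0"
proof -
  interpret W: even_periodic W d by (rule half_shift)
  show ?thesis using W.below_ground[OF h_pos assms, of h] h_pos by (simp add: shift_at_half)
qed

text \<open>
  Up to \<open>b\<close> the reflected solution \<open>k\<close> of the translated potential is positive, and \<open>s / k\<close> increases
  because its derivative is a positive Wronskian divided by \<open>k\<^sup>2\<close>.
\<close>
lemma s_pos: assumes "E \<le> b" "0 < x" "x \<le> h" shows "s E x > 0"
proof (cases "E = b")
  case True
  interpret W: even_periodic W d by (rule half_shift)
  have "theta W b (h - x) > 0" using W.ground_state(2)[OF h_pos, of "h - x"] assms by simp
  then show ?thesis using at_b(2,3) True by (simp add: mult_less_0_iff)
next
  case False
  then have "E < b" using assms by simp
  interpret W: even_periodic W d by (rule half_shift)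
  define k where "k x = theta W E (h - x)" for x
  define k' where "k' x = s' E h * c' E x - c' E h * s' E x" for x
  have k_pos: "k y > 0" if "0 \<le> y" "y \<le> h" for y
    unfolding k_def using W.below_ground[OF h_pos \<open>E < b\<close>, of "h - y"] that by simp
  have kx: "k y = s' E h * c E y - c' E h * s E y" for y by (simp add: k_def shift_expand)
  have Dk: "(k has_real_derivative k' y) (at y)" for y
    unfolding k'_def kx[abs_def] by (intro DERIV_diff DERIV_cmult DERIV_c DERIV_s)
  have "s E 0 / k 0 < s E x / k x"
  proof (rule DERIV_pos_imp_increasing[OF \<open>0 < x\<close>])
    fix y assume y: "0 \<le> y" "y \<le> x"
    then have ky: "k y > 0" using k_pos assms by simp
    have "((\<lambda>y. s E y / k y) has_real_derivative (s' E y * k y - s E y * k' y) / (k y * k y)) (at y)"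
      by (rule DERIV_divide[OF DERIV_s(1) Dk]) (use ky in simp)
    moreover have "s' E y * k y - s E y * k' y = s' E h * (c E y * s' E y - c' E y * s E y)"
      by (simp add: kx k'_def algebra_simps)
    ultimately have "((\<lambda>y. s E y / k y) has_real_derivative s' E h / (k y * k y)) (at y)"
      by (simp add: wronskian_cs)
    then show "\<exists>l. ((\<lambda>y. s E y / k y) has_real_derivative l) (at y) \<and> 0 < l"
      using s'_pos[OF \<open>E < b\<close>] ky by (intro exI[of _ "s' E h / (k y * k y)"]) simp
  qed
  then show ?thesis using k_pos[of x] assms by (simp add: zero_less_divide_iff)
qed

lemma c_over_s_decreasing:
  assumes "E \<le> b" "0 < x" "x < y" "y \<le> h"
  shows "c E y / s E y < c E x / s E x"
proof (rule DERIV_neg_imp_decreasing[OF \<open>x < y\<close>])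
  fix t assume t: "x \<le> t" "t \<le> y"
  then have st: "s E t > 0" using s_pos assms by simp
  have "((\<lambda>t. c E t / s E t) has_real_derivative (c' E t * s E t - c E t * s' E t) / (s E t * s E t)) (at t)"
    by (rule DERIV_divide[OF DERIV_c(1) DERIV_s(1)]) (use st in simp)
  moreover have "c' E t * s E t - c E t * s' E t = - 1" using wronskian_cs[of E t] by simp
  ultimately show "\<exists>l. ((\<lambda>t. c E t / s E t) has_real_derivative l) (at t) \<and> l < 0"
    using st by (intro exI conjI) (auto simp: divide_neg_pos)
qed

lemma c_neg: assumes "a < E" "E \<le> b" shows "c E h < 0" "c' E h < 0"
proof -
  obtain z where z: "0 < z" "z < h" "c E z = 0" using above_ground[OF h_pos assms(1)] by blast
  have "c E h / s E h < 0" using c_over_s_decreasing[OF assms(2) z(1,2)] z(3) by simp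
  moreover have sh: "s E h > 0" using s_pos[OF assms(2), of h] h_pos by simp
  ultimately show ch: "c E h < 0" by (simp add: divide_less_0_iff)
  have "s' E h \<ge> 0" using s'_pos[of E] at_b(1) assms(2) by (cases "E = b") auto
  then have "c E h * s' E h \<le> 0" using ch by (simp add: mult_nonpos_nonneg)
  then have "c' E h * s E h < 0" using wronskian_cs[of E h] by linarith
  then show "c' E h < 0" using sh by (simp add: mult_less_0_iff)
qed

lemma s'_neg: assumes "b < E" "E \<le> a" shows "s' E h < 0"
proof -
  interpret W: even_periodic W d by (rule half_shift)
  show ?thesis using W.c_neg(1)[of E] assms by (simp add: half_shift_twice shift_at_half)
qed

lemma c_zero_iff: assumes "E \<le> max a b" shows "c E h = 0 \<longleftrightarrow> E = a"
  using below_ground[OF h_pos, of E h] c_neg[of E] ground_state(1)[OF h_pos] assms h_pos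
  by (cases E a rule: linorder_cases) (auto simp: le_max_iff_disj)

lemma s'_zero_iff: assumes "E \<le> max a b" shows "s' E h = 0 \<longleftrightarrow> E = b"
  using s'_pos[of E] s'_neg[of E] at_b(1) assms
  by (cases E b rule: linorder_cases) (auto simp: le_max_iff_disj)

text \<open>
  The first Neumann eigenvalue. It exists by the intermediate value theorem, since \<open>c' h\<close> is positive
  for very low energies and negative at \<open>a\<close>; two such energies up to \<open>a\<close> would belong to positive
  eigenfunctions, which contradicts Sturm comparison.
\<close>
lemma neumann_ground: obtains e where "e < a" "\<And>E. E \<le> a \<Longrightarrow> c' E h = 0 \<longleftrightarrow> E = e"
proof -
  obtain E0 where E0: "\<And>x. x \<in> {0..h} \<Longrightarrow> c E0 x > 0" "0 < h \<Longrightarrow> c' E0 h > 0"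
    using low_energy[of h] by metis
  have "E0 < a"
  proof (rule ccontr)
    assume "\<not> E0 < a"
    then consider "E0 = a" | "a < E0" by linarith
    then show False
    proof cases
      case 1
      then show ?thesis using E0(1)[of h] ground_state(1)[OF h_pos] h_pos by simp
    next
      case 2
      then obtain z where "0 < z" "z < h" "c E0 z = 0" using above_ground[OF h_pos] by blast
      then show ?thesis using E0(1)[of z] by simp
    qed
  qed
  have "\<exists>e. E0 \<le> e \<and> e \<le> a \<and> c' e h = 0"
    using E0(2) h_pos ground_state(3)[OF h_pos] \<open>E0 < a\<close> cont_E(2)[of h "{E0..a}"]
    by (intro IVT2'[of "\<lambda>E. c' E h"]) auto
  then obtain e where e: "e \<le> a" "c' e h = 0" by blast
  have "e \<noteq> a" using e(2) ground_state(3)[OF h_pos] by auto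
  have unique: "\<not> E < F" if "E \<le> a" "F \<le> a" "c' E h = 0" "c' F h = 0" for E F
  proof
    assume "E < F"
    have pos: "c G x > 0" if "0 < x" "x < h" "G \<le> a" for G x
      using below_ground[OF h_pos, of G x] ground_state(2)[OF h_pos, of x] that by (cases "G = a") auto
    have "c E h * c' F h - c' E h * c F h < c E 0 * c' F 0 - c' E 0 * c F 0"
      by (rule wronskian_decreasing[OF solves_c solves_c \<open>E < F\<close> h_pos])
         (use pos that in auto)
    then show False using that by simp
  qed
  show ?thesis
  proof (rule that)
    show "e < a" using e \<open>e \<noteq> a\<close> by simp
    show "c' E h = 0 \<longleftrightarrow> E = e" if "E \<le> a" for E
      using unique[of E e] unique[of e E] e that by (metis linorder_neqE)
  qed
qed

end

section \<open>Counting eigenvalues on one period\<close>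

lemma vector_space_functions: "vector_space (\<lambda>(k::real) (f::real \<Rightarrow> real) x. k * f x)"
  by unfold_locales (auto simp: fun_eq_iff algebra_simps)

lemma multiplicity_line:
  assumes "eigenspace bc d q l = range (\<lambda>(k::real) x. k * v x)" "v \<noteq> (\<lambda>x. 0)"
  shows "multiplicity_of bc d q l = 1" "eigenspace bc d q l \<noteq> {\<lambda>x. 0}"
proof -
  interpret F: vector_space "\<lambda>(k::real) (f::real \<Rightarrow> real) x. k * f x" by (rule vector_space_functions)
  have v0: "v \<noteq> 0" using assms(2) by (simp add: fun_eq_iff)
  have "eigenspace bc d q l = F.span {v}" by (simp add: assms(1) F.span_singleton)
  then have "F.dim (eigenspace bc d q l) = F.dim {v}" by simp
  also have "\<dots> = 1" using F.dim_eq_card_independent[of "{v}"] F.independent_insert[of v "{}"] v0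
    by (simp add: F.independent_empty)
  finally show "multiplicity_of bc d q l = 1" by (simp add: multiplicity_of_def)
  have "v \<in> eigenspace bc d q l" unfolding assms(1) by (rule range_eqI[of _ _ 1]) simp
  then show "eigenspace bc d q l \<noteq> {\<lambda>x. 0}" using assms(2) by auto
qed

lemma first_eigenvalue:
  assumes "multiplicity_of bc d q e = 1" "eigenspace bc d q e \<noteq> {\<lambda>x. 0}"
    and "\<And>m. m < e \<Longrightarrow> eigenspace bc d q m = {\<lambda>x. 0}"
  shows "kth_eigenvalue bc d q 1 = e"
  unfolding kth_eigenvalue_def
proof (rule Least_equality)
  have "{m. m \<le> e \<and> eigenspace bc d q m \<noteq> {\<lambda>x. 0}} = {e}"
    using assms(2,3) by (auto simp: le_less)
  then show "1 \<le> (\<Sum>m | m \<le> e \<and> eigenspace bc d q m \<noteq> {\<lambda>x. 0}. multiplicity_of bc d q m)"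
    by (simp add: assms(1))
next
  fix l assume l: "1 \<le> (\<Sum>m | m \<le> l \<and> eigenspace bc d q m \<noteq> {\<lambda>x. 0}. multiplicity_of bc d q m)"
  show "e \<le> l"
  proof (rule ccontr)
    assume "\<not> e \<le> l"
    then have none: "{m. m \<le> l \<and> eigenspace bc d q m \<noteq> {\<lambda>x. 0}} = {}" using assms(3) by force
    show False using l unfolding none by simp
  qed
qed

lemma second_eigenvalue:
  assumes "e1 < e2" "multiplicity_of bc d q e1 = 1" "eigenspace bc d q e1 \<noteq> {\<lambda>x. 0}"
    and "multiplicity_of bc d q e2 = 1" "eigenspace bc d q e2 \<noteq> {\<lambda>x. 0}"
    and "\<And>m. m \<le> e2 \<Longrightarrow> m \<noteq> e1 \<Longrightarrow> m \<noteq> e2 \<Longrightarrow> eigenspace bc d q m = {\<lambda>x. 0}"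
  shows "kth_eigenvalue bc d q 2 = e2"
  unfolding kth_eigenvalue_def
proof (rule Least_equality)
  have "{m. m \<le> e2 \<and> eigenspace bc d q m \<noteq> {\<lambda>x. 0}} = {e1, e2}"
    using assms by (auto intro: less_imp_le)
  then show "2 \<le> (\<Sum>m | m \<le> e2 \<and> eigenspace bc d q m \<noteq> {\<lambda>x. 0}. multiplicity_of bc d q m)"
    using assms(1,2,4) by simp
next
  fix l assume l: "2 \<le> (\<Sum>m | m \<le> l \<and> eigenspace bc d q m \<noteq> {\<lambda>x. 0}. multiplicity_of bc d q m)"
  show "e2 \<le> l"
  proof (rule ccontr)
    assume "\<not> e2 \<le> l"
    then have "{m. m \<le> l \<and> eigenspace bc d q m \<noteq> {\<lambda>x. 0}} \<subseteq> {e1}" using assms(6) by force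
    then have "(\<Sum>m | m \<le> l \<and> eigenspace bc d q m \<noteq> {\<lambda>x. 0}. multiplicity_of bc d q m) \<le> (\<Sum>m\<in>{e1}. multiplicity_of bc d q m)"
      by (intro sum_mono2) auto
    then show False using l assms(2) by simp
  qed
qed

context even_periodic
begin

text \<open>
  The extension by zero of a solution on \<open>[0,d]\<close>, which is how elements of an eigenspace are
  represented.
\<close>
definition ext :: "real \<Rightarrow> real \<Rightarrow> real \<Rightarrow> real \<Rightarrow> real" where
  "ext E \<alpha> \<beta> x = (if x \<in> {0..d} then \<alpha> * c E x + \<beta> * s E x else 0)"

text \<open>
  An eigenspace is cut out of the two-dimensional solution space by its boundary conditions. The
  hypothesis says that these involve the values at the end points only.
\<close>
lemma eigenspace_eq:
  assumes bc: "\<And>u u' v v'. \<lbrakk>u 0 = v 0; u d = v d; u' 0 = v' 0; u' d = v' d\<rbrakk> \<Longrightarrow> bc d u u' = bc d v v'"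
  shows "eigenspace bc d V E = {ext E \<alpha> \<beta> | \<alpha> \<beta>.
           bc d (\<lambda>x. \<alpha> * c E x + \<beta> * s E x) (\<lambda>x. \<alpha> * c' E x + \<beta> * s' E x)}"
proof (intro equalityI subsetI)
  fix u assume "u \<in> eigenspace bc d V E"
  then obtain u' u'' where zero: "\<And>x. x \<notin> {0..d} \<Longrightarrow> u x = 0" and "bc d u u'"
    and D: "\<And>x. x \<in> {0..d} \<Longrightarrow> (u has_real_derivative u' x) (at x within {0..d})"
    and D'': "\<And>x. x \<in> {0..d} \<Longrightarrow> (u' has_real_derivative u'' x) (at x within {0..d})"
    and eq: "\<And>x. x \<in> {0..d} \<Longrightarrow> - u'' x + V x * u x = E * u x"
    unfolding eigenspace_def by blast
  have D': "(u' has_real_derivative (V x - E) * u x) (at x within {0..d})" if "x \<in> {0..d}" for x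
  proof -
    have "u'' x = (V x - E) * u x" using eq[OF that] by (simp add: algebra_simps)
    then show ?thesis using D''[OF that] by simp
  qed
  have 0: "0 \<in> {0..d}" using d_pos by simp
  have exp: "u x = u 0 * c E x + u' 0 * s E x" "u' x = u 0 * c' E x + u' 0 * s' E x" if "x \<in> {0..d}" for x
    using expand_on[OF convex_closed_interval 0 that D D'] by blast+
  have "u = ext E (u 0) (u' 0)"
  proof
    fix x
    show "u x = ext E (u 0) (u' 0) x"
      using exp(1)[of x] zero[of x] by (cases "x \<in> {0..d}") (simp_all add: ext_def)
  qed
  moreover have "bc d u u' = bc d (\<lambda>x. u 0 * c E x + u' 0 * s E x) (\<lambda>x. u 0 * c' E x + u' 0 * s' E x)"
    by (rule bc) (use exp[of 0] exp[of d] d_pos in simp_all)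
  ultimately show "u \<in> {ext E \<alpha> \<beta> | \<alpha> \<beta>.
           bc d (\<lambda>x. \<alpha> * c E x + \<beta> * s E x) (\<lambda>x. \<alpha> * c' E x + \<beta> * s' E x)}"
    using \<open>bc d u u'\<close> by blast
next
  fix u assume "u \<in> {ext E \<alpha> \<beta> | \<alpha> \<beta>.
           bc d (\<lambda>x. \<alpha> * c E x + \<beta> * s E x) (\<lambda>x. \<alpha> * c' E x + \<beta> * s' E x)}"
  then obtain \<alpha> \<beta> where u: "u = ext E \<alpha> \<beta>"
    and B: "bc d (\<lambda>x. \<alpha> * c E x + \<beta> * s E x) (\<lambda>x. \<alpha> * c' E x + \<beta> * s' E x)" by blast
  let ?v = "\<lambda>x. \<alpha> * c E x + \<beta> * s E x" and ?v' = "\<lambda>x. \<alpha> * c' E x + \<beta> * s' E x"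
  have "solves (\<lambda>x. V x - E) ?v ?v'" by (rule solves_lin[OF solves_c solves_s])
  then have Dv: "(?v has_real_derivative ?v' x) (at x within {0..d})"
     "(?v' has_real_derivative (V x - E) * ?v x) (at x within {0..d})" for x
    unfolding solves_def by (blast intro: has_field_derivative_at_within)+
  have Du: "(u has_real_derivative ?v' x) (at x within {0..d})" if "x \<in> {0..d}" for x
    unfolding has_field_derivative_def
    by (rule has_derivative_transform[OF that _ Dv(1)[unfolded has_field_derivative_def]])
       (simp add: u ext_def)
  have "bc d u ?v'" using B bc[of u ?v ?v' ?v'] d_pos by (simp add: u ext_def)
  moreover have "- ((V x - E) * ?v x) + V x * u x = E * u x" if "x \<in> {0..d}" for x
    using that by (simp add: u ext_def algebra_simps)
  moreover have "u x = 0" if "x \<notin> {0..d}" for x unfolding u ext_def using that by (rule if_not_P)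
  ultimately show "u \<in> eigenspace bc d V E"
    unfolding eigenspace_def mem_Collect_eq using Du Dv(2)
    by (intro conjI allI impI exI[of _ ?v'] exI[of _ "\<lambda>x. (V x - E) * ?v x"] ballI) simp_all
qed

lemma ext_scale: "ext E (k * \<alpha>) (k * \<beta>) x = k * ext E \<alpha> \<beta> x"
  by (simp add: ext_def algebra_simps)

lemma ext_zero: "ext E 0 0 = (\<lambda>x. 0)" by (simp add: ext_def fun_eq_iff)

lemma ext_eq_zero: "ext E \<alpha> \<beta> = (\<lambda>x. 0) \<longleftrightarrow> \<alpha> = 0 \<and> \<beta> = 0"
proof
  assume z: "ext E \<alpha> \<beta> = (\<lambda>x. 0)"
  then have "ext E \<alpha> \<beta> 0 = 0" "ext E \<alpha> \<beta> h = 0" by simp_all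
  then have "\<alpha> = 0" and "\<beta> * s E x = 0" if "x \<in> {0..d}" for x
    using d_pos fun_cong[OF z, of x] that by (auto simp: ext_def)
  then have \<alpha>: "\<alpha> = 0" and \<beta>: "\<And>x. x \<in> {0..d} \<Longrightarrow> \<beta> * s E x = 0" using d_pos by force+
  have "\<beta> = 0"
  proof (rule ccontr)
    assume "\<beta> \<noteq> 0"
    then have "s E h = 0" "s E d = 0" using \<beta>[of h] \<beta>[of d] d_pos by simp_all
    obtain e where e: "e > 0" "\<And>k. k > 0 \<Longrightarrow> k < e \<Longrightarrow> s E 0 < s E (0 + k)"
      using DERIV_pos_inc_right[OF DERIV_s(1)[of E 0]] by auto
    have "s E (0 + min e d / 2) > 0" using e(2)[of "min e d / 2"] e(1) d_pos by simp
    moreover have "min e d / 2 \<in> {0..d}" using e(1) d_pos by auto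
    ultimately show False using \<beta>[of "min e d / 2"] \<open>\<beta> \<noteq> 0\<close> by simp
  qed
  then show "\<alpha> = 0 \<and> \<beta> = 0" using \<alpha> by simp
qed (simp add: ext_zero)

lemma range_ext:
  "range (\<lambda>k. ext E 0 k) = range (\<lambda>k x. k * ext E 0 1 x)"
  "range (\<lambda>k. ext E k 0) = range (\<lambda>k x. k * ext E 1 0 x)"
proof -
  have "(\<lambda>k. ext E 0 k) = (\<lambda>k x. k * ext E 0 1 x)" "(\<lambda>k. ext E k 0) = (\<lambda>k x. k * ext E 1 0 x)"
    unfolding fun_eq_iff using ext_scale[of E _ 0 1] ext_scale[of E _ 1 0]
    unfolding mult_zero_right mult_1_right by blast+
  then show "range (\<lambda>k. ext E 0 k) = range (\<lambda>k x. k * ext E 0 1 x)"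
    "range (\<lambda>k. ext E k 0) = range (\<lambda>k x. k * ext E 1 0 x)" by metis+
qed

lemma dirichlet_space:
  "eigenspace dirichlet_bc d V E = (if s E h * s' E h = 0 then range (\<lambda>k x. k * ext E 0 1 x) else {\<lambda>x. 0})"
proof -
  have "eigenspace dirichlet_bc d V E = {ext E \<alpha> \<beta> | \<alpha> \<beta>. \<alpha> = 0 \<and> \<beta> * (s E h * s' E h) = 0}"
    by (subst eigenspace_eq) (auto simp: dirichlet_bc_def at_period)
  also have "\<dots> = (if s E h * s' E h = 0 then range (\<lambda>k. ext E 0 k) else {ext E 0 0})" by auto
  finally show ?thesis unfolding range_ext ext_zero .
qed

lemma neumann_space:
  "eigenspace neumann_bc d V E = (if c E h * c' E h = 0 then range (\<lambda>k x. k * ext E 1 0 x) else {\<lambda>x. 0})"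
proof -
  have "eigenspace neumann_bc d V E = {ext E \<alpha> \<beta> | \<alpha> \<beta>. \<beta> = 0 \<and> \<alpha> * (c E h * c' E h) = 0}"
    by (subst eigenspace_eq) (auto simp: neumann_bc_def at_period)
  also have "\<dots> = (if c E h * c' E h = 0 then range (\<lambda>k. ext E k 0) else {ext E 0 0})" by auto
  finally show ?thesis unfolding range_ext ext_zero .
qed

text \<open>
  With the half-period formulas, the antiperiodic conditions become \<open>s' (\<alpha> c + \<beta> s) = 0\<close> and
  \<open>c (\<alpha> c' + \<beta> s') = 0\<close> at \<open>h\<close>. The brackets vanish simultaneously only for \<open>\<alpha> = \<beta> = 0\<close>, so an eigenvalue
  needs \<open>c h = 0\<close> or \<open>s' h = 0\<close>.
\<close>
lemma antiperiodic_space: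
  assumes "\<not> (c E h = 0 \<and> s' E h = 0)"
  shows "eigenspace antiperiodic_bc d V E =
    (if c E h = 0 then range (\<lambda>k x. k * ext E 1 0 x)
     else if s' E h = 0 then range (\<lambda>k x. k * ext E 0 1 x) else {\<lambda>x. 0})"
proof -
  define C C' S S' where "C = c E h" "C' = c' E h" "S = s E h" "S' = s' E h"
  have w: "C * S' - C' * S = 1" using wronskian_cs[of E h] by (simp add: C_C'_S_S'_def)
  have "antiperiodic_bc d (\<lambda>x. \<alpha> * c E x + \<beta> * s E x) (\<lambda>x. \<alpha> * c' E x + \<beta> * s' E x)
      \<longleftrightarrow> S' * (\<alpha> * C + \<beta> * S) = 0 \<and> C * (\<alpha> * C' + \<beta> * S') = 0" for \<alpha> \<beta>
    unfolding antiperiodic_bc_def at_period C_C'_S_S'_def[symmetric] initial by (auto simp: algebra_simps)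
  then have eq: "eigenspace antiperiodic_bc d V E =
      {ext E \<alpha> \<beta> | \<alpha> \<beta>. S' * (\<alpha> * C + \<beta> * S) = 0 \<and> C * (\<alpha> * C' + \<beta> * S') = 0}"
    by (subst eigenspace_eq) (auto simp: antiperiodic_bc_def)
  consider "C = 0" "S' \<noteq> 0" "S \<noteq> 0" | "C \<noteq> 0" "S' = 0" "C' \<noteq> 0" | "C \<noteq> 0" "S' \<noteq> 0"
    using assms w unfolding C_C'_S_S'_def[symmetric] by fastforce
  then show ?thesis
  proof cases
    case 1
    then have "S' * (\<alpha> * C + \<beta> * S) = 0 \<and> C * (\<alpha> * C' + \<beta> * S') = 0 \<longleftrightarrow> \<beta> = 0" for \<alpha> \<beta> by simp
    then have "eigenspace antiperiodic_bc d V E = range (\<lambda>\<alpha>. ext E \<alpha> 0)" unfolding eq by auto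
    then show ?thesis using 1(1) unfolding C_C'_S_S'_def range_ext by simp
  next
    case 2
    then have "S' * (\<alpha> * C + \<beta> * S) = 0 \<and> C * (\<alpha> * C' + \<beta> * S') = 0 \<longleftrightarrow> \<alpha> = 0" for \<alpha> \<beta> by simp
    then have "eigenspace antiperiodic_bc d V E = range (\<lambda>\<beta>. ext E 0 \<beta>)" unfolding eq by auto
    then show ?thesis using 2(1,2) unfolding C_C'_S_S'_def range_ext by simp
  next
    case 3
    have zero: "\<alpha> = 0 \<and> \<beta> = 0" if "\<alpha> * C + \<beta> * S = 0" "\<alpha> * C' + \<beta> * S' = 0" for \<alpha> \<beta>
      using that w by algebra
    have "S' * (\<alpha> * C + \<beta> * S) = 0 \<and> C * (\<alpha> * C' + \<beta> * S') = 0 \<longleftrightarrow> \<alpha> = 0 \<and> \<beta> = 0" for \<alpha> \<beta>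
    proof
      assume "S' * (\<alpha> * C + \<beta> * S) = 0 \<and> C * (\<alpha> * C' + \<beta> * S') = 0"
      then have "\<alpha> * C + \<beta> * S = 0" "\<alpha> * C' + \<beta> * S' = 0" using 3 by (metis mult_eq_0_iff)+
      then show "\<alpha> = 0 \<and> \<beta> = 0" by (rule zero)
    qed simp
    then have "eigenspace antiperiodic_bc d V E = {ext E 0 0}" unfolding eq by auto
    then show ?thesis using 3 unfolding C_C'_S_S'_def by (simp add: ext_zero)
  qed
qed

theorem dirichlet_1: "dirichlet_eigenvalue d V 1 = b"
proof (rule first_eigenvalue)
  have "eigenspace dirichlet_bc d V b = range (\<lambda>k x. k * ext b 0 1 x)"
    by (simp add: dirichlet_space at_b)
  from multiplicity_line[OF this] show "multiplicity_of dirichlet_bc d V b = 1"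
    "eigenspace dirichlet_bc d V b \<noteq> {\<lambda>x. 0}" by (simp_all add: ext_eq_zero)
  fix E assume "E < b"
  then show "eigenspace dirichlet_bc d V E = {\<lambda>x. 0}"
    using s_pos[of E h] s'_pos[of E] h_pos by (simp add: dirichlet_space)
qed

theorem neumann_2: "neumann_eigenvalue d V 2 = a"
proof -
  obtain e where e: "e < a" "\<And>E. E \<le> a \<Longrightarrow> c' E h = 0 \<longleftrightarrow> E = e" using neumann_ground by blast
  have a0: "c a h = 0" by (rule ground_state(1)[OF h_pos])
  have A: "eigenspace neumann_bc d V a = range (\<lambda>k x. k * ext a 1 0 x)"
    by (simp add: neumann_space a0)
  have B: "eigenspace neumann_bc d V e = range (\<lambda>k x. k * ext e 1 0 x)"
    using e by (simp add: neumann_space)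
  show ?thesis
  proof (rule second_eigenvalue[OF e(1)])
    show "multiplicity_of neumann_bc d V a = 1" "eigenspace neumann_bc d V a \<noteq> {\<lambda>x. 0}"
      using multiplicity_line[OF A] by (simp_all add: ext_eq_zero)
    show "multiplicity_of neumann_bc d V e = 1" "eigenspace neumann_bc d V e \<noteq> {\<lambda>x. 0}"
      using multiplicity_line[OF B] by (simp_all add: ext_eq_zero)
    fix E assume "E \<le> a" "E \<noteq> e" "E \<noteq> a"
    then show "eigenspace neumann_bc d V E = {\<lambda>x. 0}"
      using e(2) c_zero_iff[of E] by (simp add: neumann_space)
  qed
qed

text \<open>
  The zeros of \<open>c h\<close> and of \<open>s' h\<close> up to \<open>max a b\<close> are exactly \<open>a\<close> and \<open>b\<close>. They are distinct, so
  both antiperiodic eigenvalues are simple and are the two edges of the gap.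
\<close>
theorem gap_1:
  assumes "a \<noteq> b"
  shows "gap d V 1 = {min a b <..< max a b}"
proof -
  have a0: "c a h = 0" by (rule ground_state(1)[OF h_pos])
  have nd: "\<not> (c E h = 0 \<and> s' E h = 0)" if "E \<le> max a b" for E
    using c_zero_iff[OF that] s'_zero_iff[OF that] assms by simp
  have A: "eigenspace antiperiodic_bc d V a = range (\<lambda>k x. k * ext a 1 0 x)"
    by (subst antiperiodic_space) (use nd a0 in auto)
  have "c b h \<noteq> 0" using c_zero_iff[of b] assms by simp
  then have B: "eigenspace antiperiodic_bc d V b = range (\<lambda>k x. k * ext b 0 1 x)"
    by (subst antiperiodic_space) (use at_b in auto)
  have other: "eigenspace antiperiodic_bc d V E = {\<lambda>x. 0}" if "E \<le> max a b" "E \<noteq> a" "E \<noteq> b" for E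
    by (subst antiperiodic_space) (use that c_zero_iff s'_zero_iff in auto)
  have A': "multiplicity_of antiperiodic_bc d V a = 1" "eigenspace antiperiodic_bc d V a \<noteq> {\<lambda>x. 0}"
    using multiplicity_line[OF A] by (simp_all add: ext_eq_zero)
  have B': "multiplicity_of antiperiodic_bc d V b = 1" "eigenspace antiperiodic_bc d V b \<noteq> {\<lambda>x. 0}"
    using multiplicity_line[OF B] by (simp_all add: ext_eq_zero)
  have "band_edge d V 2 = min a b"
    unfolding band_edge_def using A' B' other
    by (simp, intro first_eigenvalue[where e="min a b", simplified]) (auto simp: min_def split: if_splits)
  moreover have "band_edge d V 3 = max a b"
    unfolding band_edge_def using A' B' other assms
    by (simp, intro second_eigenvalue[where ?e1.0="min a b" and ?e2.0="max a b"]) (auto simp: min_def max_def split: if_splits)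
  ultimately show ?thesis by (simp add: gap_def)
qed

lemma dirichlet_eigenfunction_1:
  "dirichlet_eigenfunction d V 1 u \<longleftrightarrow> (\<exists>k. k \<noteq> 0 \<and> u = (\<lambda>x. k * ext b 0 1 x))"
proof -
  have "eigenspace dirichlet_bc d V b = range (\<lambda>k x. k * ext b 0 1 x)"
    by (simp add: dirichlet_space at_b)
  moreover have "(\<lambda>x. k * ext b 0 1 x) = (\<lambda>x. 0) \<longleftrightarrow> k = 0" for k
    using ext_eq_zero[of b 0 k] ext_scale[of b k 0 1] by (simp add: fun_eq_iff)
  ultimately show ?thesis unfolding dirichlet_eigenfunction_def dirichlet_1 by auto
qed

lemma neumann_eigenfunction_2:
  "neumann_eigenfunction d V 2 u \<longleftrightarrow> (\<exists>k. k \<noteq> 0 \<and> u = (\<lambda>x. k * ext a 1 0 x))"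
proof -
  have "eigenspace neumann_bc d V a = range (\<lambda>k x. k * ext a 1 0 x)"
    by (simp add: neumann_space ground_state(1)[OF h_pos])
  moreover have "(\<lambda>x. k * ext a 1 0 x) = (\<lambda>x. 0) \<longleftrightarrow> k = 0" for k
    using ext_eq_zero[of a k 0] ext_scale[of a k 1 0] by (simp add: fun_eq_iff)
  ultimately show ?thesis unfolding neumann_eigenfunction_def neumann_2 by auto
qed

end

section \<open>The decaying solution in the gap\<close>

context even_periodic
begin

text \<open>
  The coefficients of the decaying solution. It is \<open>c + m s\<close> with \<open>m\<^sup>2 = c' d / s d\<close>, which by the
  half-period formulas equals \<open>c h * c' h / (s h * s' h)\<close>. Clearing the denominator in \<open>m = R / P\<close> keeps
  everything continuous on the closed gap: at \<open>a\<close> the solution becomes a multiple of \<open>c\<close>, and at \<open>b\<close> a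
  multiple of \<open>s\<close>.
\<close>
definition P :: "real \<Rightarrow> real" where "P E = sqrt (s E h * s' E h)"
definition R :: "real \<Rightarrow> real" where "R E = sqrt (c E h * c' E h)"

abbreviation "psi E x \<equiv> P E * c E x + R E * s E x"
abbreviation "psi' E x \<equiv> P E * c' E x + R E * s' E x"
abbreviation "chi E x \<equiv> P E * c E x - R E * s E x"
abbreviation "chi' E x \<equiv> P E * c' E x - R E * s' E x"

lemma solves_psi: "solves (\<lambda>x. V x - E) (psi E) (psi' E)"
  by (rule solves_lin[OF solves_c solves_s])

lemma solves_diff: "solves (\<lambda>x. V x - E) (\<lambda>x. p * c E x - r * s E x) (\<lambda>x. p * c' E x - r * s' E x)"
  using solves_lin[OF solves_c solves_s, of E p "- r"] by simp

lemma P_pos: "E < b \<Longrightarrow> 0 < P E"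
  using s_pos[of E h] s'_pos[of E] h_pos by (simp add: P_def)

lemma R_pos: "a < E \<Longrightarrow> E \<le> b \<Longrightarrow> 0 < R E"
  using c_neg[of E] by (simp add: R_def mult_neg_neg)

lemma P_b: "P b = 0" and R_a: "R a = 0"
  using at_b ground_state(1)[OF h_pos] by (simp_all add: P_def R_def)

lemma cont_PR: "continuous_on X P" "continuous_on X R"
  unfolding P_def[abs_def] R_def[abs_def] using h_pos
  by (intro continuous_on_real_sqrt continuous_on_mult cont_E; simp)+

lemma square_P: "E \<le> b \<Longrightarrow> P E * P E = s E h * s' E h"
  using s_pos[of E h] s'_pos[of E] at_b(1) h_pos by (cases "E = b") (auto simp: P_def)

lemma square_R: "a \<le> E \<Longrightarrow> E \<le> b \<Longrightarrow> R E * R E = c E h * c' E h"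
  using c_neg[of E] ground_state(1)[OF h_pos] mult_neg_neg[of "c E h" "c' E h"]
  by (cases "E = a") (auto simp: R_def)

text \<open>
  Compare, for the two energies, the solutions that vanish at \<open>x\<close> and are positive before it: their
  slopes at \<open>0\<close> relative to their values there are \<open>- c x / s x\<close>.
\<close>
lemma dirichlet_ratio:
  assumes "E < F" "F \<le> b" "0 < x" "x \<le> h"
  shows "c F x * s E x < c E x * s F x"
proof -
  define k where "k G y = s G x * c G y - c G x * s G y" for G y
  define k' where "k' G y = s G x * c' G y - c G x * s' G y" for G y
  have sol: "solves (\<lambda>x. V x - G) (k G) (k' G)" for G
    unfolding k_def[abs_def] k'_def[abs_def] by (rule solves_diff)
  have pos: "k G y > 0" if "G \<le> b" "0 < y" "y < x" for G y
  proof -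
    have "s G x > 0" "s G y > 0" using s_pos[OF that(1)] that assms by simp_all
    then show ?thesis
      using c_over_s_decreasing[OF that assms(4)] by (simp add: k_def field_simps)
  qed
  have "k E x * k' F x - k' E x * k F x < k E 0 * k' F 0 - k' E 0 * k F 0"
    by (rule wronskian_decreasing[OF sol sol assms(1,3)]) (use pos assms in simp)
  then show ?thesis by (simp add: k_def k'_def algebra_simps)
qed

text \<open>
  The analogue of \<open>dirichlet_ratio\<close> at the point \<open>h\<close> for solutions with vanishing derivative there.
  They are reflections of the solution \<open>c\<close> for the translated potential, hence positive.
\<close>
lemma neumann_ratio:
  assumes "E < F" "F \<le> b"
  shows "c' F h * s' E h < c' E h * s' F h"
proof -
  interpret W: even_periodic W d by (rule half_shift)
  define k where "k G y = s' G h * c G y - c' G h * s G y" for G y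
  define k' where "k' G y = s' G h * c' G y - c' G h * s' G y" for G y
  have sol: "solves (\<lambda>x. V x - G) (k G) (k' G)" for G
    unfolding k_def[abs_def] k'_def[abs_def] by (rule solves_diff)
  have pos: "k G y > 0" if "G \<le> b" "0 < y" "y < h" for G y
  proof (cases "G = b")
    case True
    have "theta W b (h - y) > 0" using W.ground_state(2)[OF h_pos, of "h - y"] that by simp
    then show ?thesis using True by (simp add: k_def shift_expand)
  next
    case False
    then have "theta W G (h - y) > 0" using W.below_ground[OF h_pos, of G "h - y"] that by simp
    then show ?thesis by (simp add: k_def shift_expand)
  qed
  have "k E h * k' F h - k' E h * k F h < k E 0 * k' F 0 - k' E 0 * k F 0"
    by (rule wronskian_decreasing[OF sol sol assms(1) h_pos]) (use pos assms in simp)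
  then show ?thesis by (simp add: k_def k'_def algebra_simps)
qed

text \<open>
  The slope \<open>R / P\<close> of the decaying solution at \<open>0\<close> increases with the energy, its square being the
  product of the Dirichlet and the Neumann ratio. Cross-multiplied, the statement extends to the edges.
\<close>
lemma decaying_ratio_mono:
  assumes "a < b" "a \<le> E" "E < F" "F \<le> b"
  shows "R E * P F < P E * R F"
proof -
  have "P E > 0" "R F > 0" using P_pos[of E] R_pos[of F] assms by simp_all
  consider "E = a" | "F = b" | "a < E" "F < b" using assms by linarith
  then show ?thesis
  proof cases
    case 3
    have E: "c E h < 0" "c' E h < 0" "s E h > 0" "s' E h > 0"
      using c_neg[of E] s_pos[of E h] s'_pos[of E] assms 3 h_pos by simp_all
    have F: "c F h < 0" "c' F h < 0" "s F h > 0" "s' F h > 0"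
      using c_neg[of F] s_pos[of F h] s'_pos[of F] assms 3 h_pos by simp_all
    have "(- c E h * s F h) * (- c' E h * s' F h) < (- c F h * s E h) * (- c' F h * s' E h)"
    proof (rule mult_strict_mono)
      show "- c E h * s F h < - c F h * s E h" using dirichlet_ratio[OF assms(3,4), of h] h_pos by simp
      show "- c' E h * s' F h < - c' F h * s' E h" using neumann_ratio[OF assms(3,4)] by simp
      show "0 < - c F h * s E h" using E F by (simp add: mult_neg_pos)
      show "0 \<le> - c' E h * s' F h" using E F by (simp add: mult_nonpos_nonneg)
    qed
    then have "(c E h * c' E h) * (s F h * s' F h) < (s E h * s' E h) * (c F h * c' F h)"
      by (simp add: mult_ac)
    then show ?thesis unfolding P_def R_def real_sqrt_mult[symmetric] by simp
  qed (use \<open>P E > 0\<close> \<open>R F > 0\<close> in \<open>auto simp: P_b R_a\<close>)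
qed

text \<open>
  Sturm comparison from \<open>0\<close> beyond the first zero. The hypothesis on the coefficients says that the
  second solution starts at least as steeply downward; then it has its zero earlier. Starting the
  Wronskian argument at the zero of the first solution, where the sign is clear, avoids following the
  phase of the solutions through the zeros.
\<close>
lemma forward_comparison:
  assumes "E < F" "F \<le> b" "0 < x" "x \<le> h"
    and "0 < p1" "0 \<le> p2" "0 < p2 \<or> 0 < r2" "r1 * p2 \<le> p1 * r2"
    and neg: "p1 * c E x - r1 * s E x \<le> 0"
  shows "p2 * c F x - r2 * s F x < 0"
    and "(p1 * c E x - r1 * s E x) * (p2 * c' F x - r2 * s' F x) -
         (p1 * c' E x - r1 * s' E x) * (p2 * c F x - r2 * s F x) < 0"
proof -
  define y1 y1' y2 y2' where "y1 t = p1 * c E t - r1 * s E t" "y1' t = p1 * c' E t - r1 * s' E t"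
    "y2 t = p2 * c F t - r2 * s F t" "y2' t = p2 * c' F t - r2 * s' F t" for t
  note defs = y1_y1'_y2_y2'_def
  have sol: "solves (\<lambda>x. V x - E) y1 y1'" "solves (\<lambda>x. V x - F) y2 y2'"
    unfolding defs[abs_def] by (rule solves_diff)+
  have sE: "s E t > 0" and sF: "s F t > 0" if "0 < t" "t \<le> x" for t
    using s_pos[of E t] s_pos[of F t] that assms by simp_all
  have y2_neg: "y2 t < 0" if "0 < t" "t \<le> x" "y1 t \<le> 0" for t
  proof (cases "p2 = 0")
    case True
    then have "0 < r2 * s F t" using sF[OF that(1,2)] assms(7) by simp
    then show ?thesis using True by (simp add: defs)
  next
    case False
    then have "p2 > 0" using assms(6) by simp
    have "c F t * s E t < c E t * s F t" using dirichlet_ratio[of E F t] that assms by simp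
    then have "(p1 * p2) * (c F t * s E t) < (p1 * p2) * (c E t * s F t)"
      using \<open>p2 > 0\<close> assms(5) by (intro mult_strict_left_mono) auto
    moreover have "p2 * s F t * y1 t \<le> 0"
      using that(3) \<open>p2 > 0\<close> sF[OF that(1,2)] by (simp add: mult_nonneg_nonpos)
    moreover have "(r1 * p2) * (s E t * s F t) \<le> (p1 * r2) * (s E t * s F t)"
      using assms(8) sE[OF that(1,2)] sF[OF that(1,2)] by (intro mult_right_mono) auto
    ultimately have "(p1 * s E t) * y2 t < 0" by (simp add: defs algebra_simps)
    then show ?thesis using assms(5) sE[OF that(1,2)] by (simp add: mult_less_0_iff)
  qed
  have y1x: "y1 x \<le> 0" using neg by (simp add: defs)
  show "p2 * c F x - r2 * s F x < 0"
    using y2_neg[OF assms(3) order_refl y1x] by (simp add: defs)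
  have "y1 0 > 0" using assms(5) by (simp add: defs)
  obtain z where z: "0 < z" "z \<le> x" "y1 z = 0"
    by (rule first_zero[OF solves_continuous(1)[OF sol(1)] \<open>y1 0 > 0\<close> y1x]) (use assms(3) in auto)
  have "y1 z * s' E z - y1' z * s E z = p1 * (c E z * s' E z - c' E z * s E z)"
    by (simp add: defs algebra_simps)
  then have "y1' z * s E z < 0" using z(3) assms(5) by (simp add: wronskian_cs)
  then have "y1' z < 0" using sE[OF z(1,2)] by (simp add: mult_less_0_iff)
  have wz: "y1 z * y2' z - y1' z * y2 z < 0"
    using z y2_neg[OF z(1,2)] \<open>y1' z < 0\<close> by (simp add: mult_neg_neg)
  have "y1 x * y2' x - y1' x * y2 x < 0"
  proof (cases "z = x")
    case False
    then have "z < x" using z by simp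
    have "y1 x * y2' x - y1' x * y2 x < y1 z * y2' z - y1' z * y2 z"
    proof (rule wronskian_decreasing[OF sol assms(1) \<open>z < x\<close>])
      fix t assume t: "z < t" "t < x"
      have "c E t / s E t < c E z / s E z"
        using c_over_s_decreasing[of E z t] z t assms by simp
      then have "c E t * s E z < c E z * s E t"
        using sE[of z] sE[of t] z t by (simp add: field_simps)
      then have "p1 * (c E t * s E z) < p1 * (c E z * s E t)" using assms(5) by simp
      also have "\<dots> = r1 * s E t * s E z" using z(3) by (simp add: defs)
      finally have "y1 t * s E z < 0" by (simp add: defs algebra_simps)
      then have "y1 t < 0" using sE[of z] z by (simp add: mult_less_0_iff)
      moreover have "y2 t < 0" using y2_neg[of t] \<open>y1 t < 0\<close> z t by simp
      ultimately show "0 < y1 t * y2 t" by (simp add: mult_neg_neg)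
    qed
    then show ?thesis using wz by simp
  qed (use wz in simp)
  then show "(p1 * c E x - r1 * s E x) * (p2 * c' F x - r2 * s' F x) -
         (p1 * c' E x - r1 * s' E x) * (p2 * c F x - r2 * s F x) < 0" by (simp add: defs)
qed

text \<open>
  At \<open>h\<close> the two terms have opposite signs. The difference of their squares is the product of \<open>c s\<close>, or
  of \<open>c' s'\<close>, with the Wronskian, and so decides which one wins.
\<close>
lemma psi_at_half:
  assumes "a < E" "E < b"
  shows "psi E h > 0" "psi' E h < 0"
proof -
  have E: "c E h < 0" "c' E h < 0" "s E h > 0" "s' E h > 0" "P E > 0" "R E > 0"
    using c_neg[of E] s_pos[of E h] s'_pos[of E] P_pos[of E] R_pos[of E] assms h_pos by simp_all
  note PP = square_P[of E] and RR = square_R[of E]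
  have w: "c E h * s' E h - c' E h * s E h = 1" by (rule wronskian_cs)
  have "(R E * s E h)\<^sup>2 - (- P E * c E h)\<^sup>2 = (R E * R E) * (s E h)\<^sup>2 - (P E * P E) * (c E h)\<^sup>2"
    by (simp add: power2_eq_square)
  also have "\<dots> = - (c E h * s E h) * (c E h * s' E h - c' E h * s E h)"
    using assms by (simp add: PP RR power2_eq_square algebra_simps)
  also have "\<dots> > 0" unfolding w using E by (simp add: mult_neg_pos)
  finally have "(- P E * c E h)\<^sup>2 < (R E * s E h)\<^sup>2" by simp
  then have "- P E * c E h < R E * s E h" by (rule power2_less_imp_less) (use E in simp)
  then show "psi E h > 0" by simp
  have "(- P E * c' E h)\<^sup>2 - (R E * s' E h)\<^sup>2 = (P E * P E) * (c' E h)\<^sup>2 - (R E * R E) * (s' E h)\<^sup>2"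
    by (simp add: power2_eq_square)
  also have "\<dots> = - (c' E h * s' E h) * (c E h * s' E h - c' E h * s E h)"
    using assms by (simp add: PP RR power2_eq_square algebra_simps)
  also have "\<dots> > 0" unfolding w using E by (simp add: mult_neg_pos)
  finally have "(R E * s' E h)\<^sup>2 < (- P E * c' E h)\<^sup>2" by simp
  then have "R E * s' E h < - P E * c' E h"
    by (rule power2_less_imp_less) (use E in \<open>simp add: mult_nonneg_nonpos\<close>)
  then show "psi' E h < 0" by simp
qed

lemma chi_at_half:
  assumes "a < E" "E < b"
  shows "chi E h < 0" "chi' E h < 0"
proof -
  have E: "c E h < 0" "c' E h < 0" "s E h > 0" "s' E h > 0" "P E > 0" "R E > 0"
    using c_neg[of E] s_pos[of E h] s'_pos[of E] P_pos[of E] R_pos[of E] assms h_pos by simp_all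
  then have "P E * c E h < 0" "R E * s E h > 0" "P E * c' E h < 0" "R E * s' E h > 0"
    by (simp_all add: mult_pos_neg)
  then show "chi E h < 0" "chi' E h < 0" by simp_all
qed

lemma psi_pos:
  assumes "a < E" "E \<le> b" "0 \<le> x" "x \<le> h" "E < b \<or> 0 < x"
  shows "psi E x > 0"
proof (cases "E = b")
  case True
  then show ?thesis using R_pos[OF assms(1,2)] s_pos[of b x] assms by (simp add: P_b)
next
  case False
  then have "E < b" using assms by simp
  consider "x = 0" | "0 < x" "x < h" | "x = h" using assms by linarith
  then show ?thesis
  proof cases
    case 2
    have ss: "s E x > 0" "s E h > 0" using s_pos[of E] assms 2 by simp_all
    have "c E h / s E h < c E x / s E x" using c_over_s_decreasing[of E x h] assms 2 by simp
    then have "P E * (c E h / s E h) < P E * (c E x / s E x)"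
      using P_pos[OF \<open>E < b\<close>] by (rule mult_strict_left_mono)
    then have "psi E h / s E h < psi E x / s E x" using ss by (simp add: add_divide_distrib)
    moreover have "psi E h / s E h > 0" using psi_at_half[OF assms(1) \<open>E < b\<close>] ss by simp
    ultimately have "psi E x / s E x > 0" by simp
    then show ?thesis using ss by (simp add: zero_less_divide_iff)
  next
    case 3
    show ?thesis unfolding 3 by (rule psi_at_half(1)[OF assms(1) \<open>E < b\<close>])
  qed (use P_pos[OF \<open>E < b\<close>] in simp)
qed

text \<open>
  In other words \<open>(psi' / psi)\<^sup>2 = (s' / s) (c' / c)\<close> at \<open>h\<close>: seen from the symmetry point \<open>h\<close> the
  decaying solution has the same structure as seen from \<open>0\<close>.
\<close>
lemma psi_log_derivative_at_half:
  assumes "a < E" "E < b"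
  shows "(psi' E h)\<^sup>2 * (s E h * c E h) = (psi E h)\<^sup>2 * (s' E h * c' E h)"
proof -
  have PP: "P E * P E = s E h * s' E h" and RR: "R E * R E = c E h * c' E h"
    using square_P[of E] square_R[of E] assms by simp_all
  define B where "B = s' E h * c E h + 2 * (P E * R E) + c' E h * s E h"
  have "(psi E h)\<^sup>2 = (P E * P E) * (c E h)\<^sup>2 + 2 * (P E * R E) * (c E h * s E h) + (R E * R E) * (s E h)\<^sup>2"
    by (simp add: power2_eq_square algebra_simps)
  also have "\<dots> = c E h * s E h * B"
    unfolding PP RR B_def by (simp add: power2_eq_square algebra_simps)
  finally have 1: "(psi E h)\<^sup>2 = c E h * s E h * B" .
  have "(psi' E h)\<^sup>2 = (P E * P E) * (c' E h)\<^sup>2 + 2 * (P E * R E) * (c' E h * s' E h) + (R E * R E) * (s' E h)\<^sup>2"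
    by (simp add: power2_eq_square algebra_simps)
  also have "\<dots> = c' E h * s' E h * B"
    unfolding PP RR B_def by (simp add: power2_eq_square algebra_simps)
  finally have 2: "(psi' E h)\<^sup>2 = c' E h * s' E h * B" .
  show ?thesis unfolding 1 2 by (simp add: mult_ac)
qed

text \<open>
  The logarithmic derivative of \<open>psi\<close> increases with the energy. At \<open>h\<close> it is negative with the square
  given by \<open>psi_log_derivative_at_half\<close>, both factors of which decrease. From there the inequality
  propagates back to \<open>[0,h]\<close>, where \<open>psi\<close> is positive.
\<close>
lemma psi_wronskian_pos:
  assumes "a < E" "E < F" "F \<le> b" "0 \<le> x" "x \<le> h"
  shows "psi E x * psi' F x - psi' E x * psi F x > 0"
proof -
  have "E < b" using assms by simp
  note E = psi_at_half[OF assms(1) \<open>E < b\<close>]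
  have at_h: "psi E h * psi' F h - psi' E h * psi F h > 0"
  proof (cases "F = b")
    case True
    have "psi b h > 0" using psi_pos[of b h] assms h_pos by simp
    moreover have "psi' b h = 0" by (simp add: P_b at_b)
    ultimately show ?thesis using E(2) by (simp add: True mult_neg_pos)
  next
    case False
    then have "F < b" "a < F" using assms by simp_all
    note F = psi_at_half[OF \<open>a < F\<close> \<open>F < b\<close>]
    have sg: "c E h < 0" "c' E h < 0" "s E h > 0" "s' E h > 0" "c F h < 0" "c' F h < 0" "s F h > 0" "s' F h > 0"
      using c_neg[of E] c_neg[of F] s_pos[of E h] s_pos[of F h] s'_pos[of E] s'_pos[of F]
        assms \<open>F < b\<close> h_pos by simp_all
    have A: "s E h * s' F h < s' E h * s F h"
    proof -
      have "s E h * s' F h - s' E h * s F h < s E 0 * s' F 0 - s' E 0 * s F 0"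
        by (rule wronskian_decreasing[OF solves_s solves_s assms(2) h_pos])
           (use s_pos[of E] s_pos[of F] assms in simp)
      then show ?thesis by simp
    qed
    have B: "c E h * c' F h < c' E h * c F h"
      using forward_comparison(2)[OF assms(2,3) h_pos order_refl, of 1 1 0 0] sg by simp
    have "(s E h * s' F h) * (c E h * c' F h) < (s' E h * s F h) * (c' E h * c F h)"
    proof (rule mult_strict_mono[OF A B])
      show "0 < s' E h * s F h" using sg by simp
      show "0 \<le> c E h * c' F h" using sg by (simp add: mult_nonpos_nonpos)
    qed
    then have lt: "(s' F h * c' F h) * (s E h * c E h) < (s' E h * c' E h) * (s F h * c F h)"
      by (simp add: mult_ac)
    \<comment> \<open>Compare squares, multiplied by the positive number \<open>M\<close> that clears the denominators of \<open>psi_log_derivative_at_half\<close>.\<close>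
    define K where "K = (psi E h)\<^sup>2 * (psi F h)\<^sup>2"
    define M where "M = (s E h * c E h) * (s F h * c F h)"
    have "M > 0" unfolding M_def using sg by (simp add: mult_neg_neg mult_pos_neg)
    have "K > 0" using E F by (simp add: K_def)
    have "(- psi E h * psi' F h)\<^sup>2 * M = (psi E h)\<^sup>2 * ((psi' F h)\<^sup>2 * (s F h * c F h)) * (s E h * c E h)"
      by (simp only: M_def power_mult_distrib power2_minus) (simp only: mult_ac)
    also have "\<dots> = K * ((s' F h * c' F h) * (s E h * c E h))"
      unfolding psi_log_derivative_at_half[OF \<open>a < F\<close> \<open>F < b\<close>] K_def by (simp add: mult_ac)
    also have "\<dots> < K * ((s' E h * c' E h) * (s F h * c F h))" using lt \<open>K > 0\<close> by simp
    also have "\<dots> = (psi F h)\<^sup>2 * ((psi' E h)\<^sup>2 * (s E h * c E h)) * (s F h * c F h)"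
      unfolding psi_log_derivative_at_half[OF assms(1) \<open>E < b\<close>] K_def by (simp add: mult_ac)
    also have "\<dots> = (- psi' E h * psi F h)\<^sup>2 * M"
      by (simp only: M_def power_mult_distrib power2_minus) (simp only: mult_ac)
    finally have "(- psi E h * psi' F h)\<^sup>2 < (- psi' E h * psi F h)\<^sup>2"
      using \<open>M > 0\<close> by (simp only: mult_less_cancel_right_pos)
    then have "- psi E h * psi' F h < - psi' E h * psi F h"
      by (rule power2_less_imp_less) (use E(2) F(1) in \<open>simp only: minus_mult_left[symmetric] neg_0_le_iff_le mult_nonpos_nonneg less_imp_le\<close>)
    then show ?thesis by (simp only: minus_mult_left[symmetric] neg_less_iff_less diff_gt_0_iff_gt)
  qed
  show ?thesis
  proof (cases "x = h")
    case True
    show ?thesis unfolding True by (rule at_h)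
  next
    case False
    then have "x < h" using assms by simp
    have "psi E h * psi' F h - psi' E h * psi F h < psi E x * psi' F x - psi' E x * psi F x"
      by (rule wronskian_decreasing[OF solves_psi solves_psi assms(2) \<open>x < h\<close>])
         (use psi_pos[of E] psi_pos[of F] assms in simp)
    then show ?thesis using at_h by simp
  qed
qed

text \<open>
  On the mirrored half of the period the comparison starts at \<open>0\<close>, where the slope \<open>- R / P\<close>
  decreases with the energy.
\<close>
lemma chi_comparison:
  assumes "a < E" "E < F" "F \<le> b" "0 < x" "x \<le> h" "chi E x \<le> 0"
  shows "chi F x < 0" "chi E x * chi' F x - chi' E x * chi F x < 0"
proof -
  have "P E > 0" "P F \<ge> 0" "R F > 0" "R E * P F \<le> P E * R F"
    using P_pos[of E] P_pos[of F] P_b R_pos[of F] decaying_ratio_mono[of E F] assms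
    by (auto simp: le_less)
  from forward_comparison[OF assms(2-5) this(1,2) disjI2[OF this(3)] this(4) assms(6)]
  show "chi F x < 0" "chi E x * chi' F x - chi' E x * chi F x < 0" by simp_all
qed

text \<open>
  The Floquet multiplier of \<open>psi E\<close>, whose value at \<open>0\<close> is \<open>P E\<close>.
\<close>
definition multiplier :: "real \<Rightarrow> real" where
  "multiplier E = psi E d / P E"

text \<open>
  Of the two Floquet multipliers, whose product is the Wronskian \<open>1\<close>, the one belonging to \<open>c - m s\<close> is
  below \<open>-1\<close>.
\<close>
lemma multiplier:
  assumes "a < E" "E < b"
  shows "- 1 < multiplier E" "multiplier E < 0"
    and "psi E (x + d) = multiplier E * psi E x" "psi' E (x + d) = multiplier E * psi' E x"
proof -
  have E: "c E h < 0" "c' E h < 0" "s E h > 0" "s' E h > 0" "P E > 0" "R E > 0"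
    using c_neg[of E] s_pos[of E h] s'_pos[of E] P_pos[of E] R_pos[of E] assms h_pos by simp_all
  have PP: "P E * P E = s E h * s' E h" and RR: "R E * R E = c E h * c' E h"
    using square_P[of E] square_R[of E] assms by simp_all
  have cd: "s' E d = c E d" and PR: "P E * P E * c' E d = R E * R E * s E d"
    unfolding at_period PP RR by simp_all
  have p: "psi E d = multiplier E * P E" using E by (simp add: multiplier_def)
  have "P E * psi' E d = P E * P E * c' E d + P E * R E * s' E d" by (simp add: algebra_simps)
  also have "\<dots> = R E * psi E d" unfolding PR cd by (simp add: algebra_simps)
  also have "\<dots> = P E * (multiplier E * R E)" unfolding p by simp
  finally have p': "psi' E d = multiplier E * R E" using E by simp
  have "solves (\<lambda>x. V x - E) (\<lambda>x. psi E (x + d)) (\<lambda>x. psi' E (x + d))"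
    using solves_shift[OF solves_psi[of E], of d] by (simp add: periodic_V)
  note ex = expand[OF this, of x]
  have "psi E (x + d) = psi E d * c E x + psi' E d * s E x" using ex(1) by simp
  also have "\<dots> = multiplier E * psi E x" unfolding p p' by (simp add: algebra_simps)
  finally show "psi E (x + d) = multiplier E * psi E x" .
  have "psi' E (x + d) = psi E d * c' E x + psi' E d * s' E x" using ex(2) by simp
  also have "\<dots> = multiplier E * psi' E x" unfolding p p' by (simp add: algebra_simps)
  finally show "psi' E (x + d) = multiplier E * psi' E x" .
  \<comment> \<open>The other Floquet multiplier.\<close>
  define r where "r = c E d - R E / P E * s E d"
  have "c E h * s' E h < 0" using E by (simp add: mult_neg_pos)
  moreover have "R E / P E * s E d > 0" using E by (simp add: at_period)
  ultimately have "r < - 1" unfolding r_def at_period(1) by linarith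
  have "multiplier E = c E d + R E / P E * s E d"
    using E by (simp add: multiplier_def add_divide_distrib)
  then have "multiplier E * r = c E d * c E d - (R E * R E * s E d) * s E d / (P E * P E)"
    by (simp add: r_def algebra_simps)
  also have "\<dots> = c E d * s' E d - c' E d * s E d"
    unfolding PR[symmetric] cd using E by simp
  also have "\<dots> = 1" by (rule wronskian_cs)
  finally have m: "multiplier E = 1 / r" using \<open>r < - 1\<close> by (simp add: field_simps)
  show "- 1 < multiplier E" "multiplier E < 0"
    unfolding m using \<open>r < - 1\<close> by (simp_all add: field_simps)
qed

lemma psi_mirror:
  assumes "a < E" "E < b"
  shows "psi E (d - x) = multiplier E * chi E x" "psi' E (d - x) = - multiplier E * chi' E x"
  using multiplier(3,4)[OF assms, of "- x"] c_even[of E x] s_odd[of E x] by (simp_all add: algebra_simps)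

end

section \<open>Counting zeros for increasing potentials\<close>

locale increasing_well = even_periodic +
  assumes diff_V: "\<exists>D. (V has_real_derivative D) (at x)"
    and mono_V: "strict_mono_on {0..h} V"
begin

lemma V_less: "0 \<le> x \<Longrightarrow> x < y \<Longrightarrow> y \<le> h \<Longrightarrow> V x < V y"
  using strict_mono_onD[OF mono_V] by simp

text \<open>
  The factor \<open>V - E\<close> changes sign at most once, from negative to positive, so \<open>u'\<close> first decreases and
  then increases, and is below the larger of its end values.
\<close>
lemma deriv_neg_until_zero:
  assumes sol: "solves (\<lambda>x. V x - E) u u'"
    and "z \<le> h" "\<And>x. 0 < x \<Longrightarrow> x < z \<Longrightarrow> u x > 0" "u' 0 \<le> 0" "u' z < 0" "0 < x" "x \<le> z"
  shows "u' x < 0"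
proof (cases "x = z")
  case False
  then have "x < z" using assms by simp
  have D: "(u' has_real_derivative (V t - E) * u t) (at t)" for t using sol by (simp add: solves_def)
  show ?thesis
  proof (cases "V x \<le> E")
    case True
    have "u' x < u' 0"
    proof (rule DERIV_neg_imp_decreasing_open[OF \<open>0 < x\<close>])
      fix t assume t: "0 < t" "t < x"
      then have "V t < E" "u t > 0" using V_less[of t x] True assms by simp_all
      then show "\<exists>y. (u' has_real_derivative y) (at t) \<and> y < 0"
        using D by (meson diff_less_0_iff_less mult_neg_pos)
    qed (rule solves_continuous(2)[OF sol])
    then show ?thesis using assms by simp
  next
    case V: False
    have "u' x < u' z"
    proof (rule DERIV_pos_imp_increasing_open[OF \<open>x < z\<close>])
      fix t assume t: "x < t" "t < z"
      then have "V t > E" "u t > 0" using V_less[of x t] V assms by simp_all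
      then show "\<exists>y. (u' has_real_derivative y) (at t) \<and> 0 < y"
        using D by (meson diff_gt_0_iff_gt mult_pos_pos)
    qed (rule solves_continuous(2)[OF sol])
    then show ?thesis using assms by simp
  qed
qed (use assms in simp)

lemma c'_a_neg:
  assumes "0 < x" "x \<le> h" shows "c' a x < 0"
  by (rule deriv_neg_until_zero[OF solves_c order_refl])
     (use ground_state[OF h_pos] assms in auto)

text \<open>
  With \<open>z = - c'\<close> at energy \<open>a\<close>, differentiating the equation gives \<open>z'' = (V - a) z - V' c\<close>. The
  Wronskian of \<open>z\<close> with the ground state for \<open>b\<close> vanishes at both ends of \<open>[0,h]\<close>, but if \<open>b \<le> a\<close> it
  would be nonincreasing and somewhere strictly decreasing.
\<close>
lemma a_less_b: "a < b"
proof (rule ccontr)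
  assume "\<not> a < b"
  then have "b \<le> a" by simp
  obtain V' where V': "\<And>x. (V has_real_derivative V' x) (at x)" using diff_V by metis
  have V'_nonneg: "V' x \<ge> 0" if "0 < x" "x < h" for x
  proof (rule mono_on_imp_deriv_nonneg)
    show "mono_on {0..h} V" by (rule strict_mono_on_imp_mono_on[OF mono_V])
    show "(V has_real_derivative V' x) (at x)" by (rule V')
    show "x \<in> interior {0..h}" using that by simp
  qed
  define g where "g x = s' b x * c' a x - s b x * ((V x - a) * c a x)" for x
  define g' where "g' x = (a - b) * (s b x * c' a x) - V' x * (s b x * c a x)" for x
  have Dg: "(g has_real_derivative g' x) (at x)" for x
    unfolding g_def[abs_def] g'_def
    by (rule derivative_eq_intros DERIV_c DERIV_s V' refl)+ (simp add: algebra_simps)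
  have g'_le: "g' x \<le> - (V' x * (s b x * c a x))" if "0 < x" "x < h" for x
    using s_pos[of b x] c'_a_neg[of x] that \<open>b \<le> a\<close>
    by (simp add: g'_def mult_nonneg_nonpos mult_pos_neg less_imp_le)
  have V's: "V' x * (s b x * c a x) \<ge> 0" if "0 < x" "x < h" for x
    using V'_nonneg[OF that] s_pos[of b x] ground_state(2)[OF h_pos, of x] that by simp
  have noninc: "g y \<le> g x" if "0 \<le> x" "x \<le> y" "y \<le> h" for x y
  proof (rule DERIV_nonpos_imp_decreasing_open[OF that(2)])
    fix t assume "x < t" "t < y"
    then have "g' t \<le> 0" using g'_le[of t] V's[of t] that by simp
    then show "\<exists>y. (g has_real_derivative y) (at t) \<and> y \<le> 0" using Dg by blast
  next
    show "continuous_on {x..y} g"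
      by (rule continuous_at_imp_continuous_on, rule ballI, rule DERIV_isCont, rule Dg)
  qed
  have g0: "g 0 = 0" by (simp add: g_def)
  have gh: "g h = 0" unfolding g_def at_b(1) ground_state(1)[OF h_pos] by simp
  \<comment> \<open>A point with \<open>V' > 0\<close>, where \<open>g\<close> decreases strictly.\<close>
  obtain \<xi> where \<xi>: "0 < \<xi>" "\<xi> < h" "V h - V 0 = (h - 0) * V' \<xi>"
    using MVT2[OF h_pos, of V V'] V' by blast
  have "(h - 0) * V' \<xi> > 0" using V_less[of 0 h] h_pos unfolding \<xi>(3)[symmetric] by simp
  then have "V' \<xi> > 0" using h_pos by (simp add: zero_less_mult_iff)
  then have "V' \<xi> * (s b \<xi> * c a \<xi>) > 0"
    using s_pos[of b \<xi>] ground_state(2)[OF h_pos, of \<xi>] \<xi> by simp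
  then have "g' \<xi> < 0" using g'_le[OF \<xi>(1,2)] by simp
  then obtain \<delta> where \<delta>: "\<delta> > 0" "\<And>k. k > 0 \<Longrightarrow> k < \<delta> \<Longrightarrow> g (\<xi> + k) < g \<xi>"
    using DERIV_neg_dec_right[OF Dg, of \<xi>] by auto
  define k where "k = min \<delta> (h - \<xi>) / 2"
  have k: "0 < k" "k < \<delta>" "k < h - \<xi>" using \<delta>(1) \<xi> by (auto simp: k_def)
  have "g h \<le> g (\<xi> + k)" using noninc[of "\<xi> + k" h] k \<xi> by simp
  also have "\<dots> < g \<xi>" by (rule \<delta>(2)[OF k(1,2)])
  also have "\<dots> \<le> g 0" using noninc[of 0 \<xi>] \<xi> by simp
  finally show False using g0 gh by simp
qed

text \<open>
  The slope \<open>s'\<close> decreases as long as \<open>V \<le> b\<close> and increases afterwards, and it ends with the value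
  \<open>0\<close> at \<open>h\<close>. If it reaches \<open>0\<close> before \<open>h\<close>, it therefore stays negative until \<open>h\<close>.
\<close>
lemma s'_b_shape:
  obtains (increasing) "\<And>x. 0 \<le> x \<Longrightarrow> x < h \<Longrightarrow> s' b x > 0"
  | (turning) d0 where "0 < d0" "d0 < h" "\<And>x. 0 \<le> x \<Longrightarrow> x < d0 \<Longrightarrow> s' b x > 0"
      "s' b d0 = 0" "\<And>x. d0 < x \<Longrightarrow> x < h \<Longrightarrow> s' b x < 0"
proof (cases "\<forall>x. 0 \<le> x \<and> x < h \<longrightarrow> s' b x > 0")
  case True
  then show ?thesis using increasing by blast
next
  case False
  then obtain x where x: "0 \<le> x" "x < h" "s' b x \<le> 0" by (auto simp: not_less)
  obtain z where z: "0 < z" "z \<le> x" "s' b z = 0" "\<And>t. 0 \<le> t \<Longrightarrow> t < z \<Longrightarrow> s' b t > 0"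
    by (rule first_zero[where f="s' b" and y=x, OF cont_x(4)]) (use x in auto)
  have dec: "s' b y < s' b x" if "0 \<le> x" "x < y" "y \<le> h" "V y \<le> b" for x y
  proof (rule DERIV_neg_imp_decreasing_open[OF that(2)])
    fix t assume "x < t" "t < y"
    then have "V t < b" "s b t > 0" using V_less[of t y] s_pos[of b t] that by simp_all
    then show "\<exists>y. (s' b has_real_derivative y) (at t) \<and> y < 0"
      using DERIV_s(2)[of b t] by (meson diff_less_0_iff_less mult_neg_pos)
  qed (rule cont_x(4))
  have inc: "s' b x < s' b y" if "0 \<le> x" "x < y" "y \<le> h" "V x \<ge> b" for x y
  proof (rule DERIV_pos_imp_increasing_open[OF that(2)])
    fix t assume "x < t" "t < y"
    then have "V t > b" "s b t > 0" using V_less[of x t] s_pos[of b t] that by simp_all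
    then show "\<exists>y. (s' b has_real_derivative y) (at t) \<and> y > 0"
      using DERIV_s(2)[of b t] by (meson diff_gt_0_iff_gt mult_pos_pos)
  qed (rule cont_x(4))
  have "V z < b" using inc[of z h] z x at_b(1) by force
  have "s' b y < 0" if "z < y" "y < h" for y
    using dec[of z y] inc[of y h] z at_b(1) that by (cases "V y \<le> b") auto
  then show ?thesis using turning[of z] z x by auto
qed

lemma cont_psi:
  assumes "0 \<le> x"
  shows "continuous_on X (\<lambda>E. psi E x)" "continuous_on X (\<lambda>E. psi' E x)"
    "continuous_on X (\<lambda>E. chi E x)" "continuous_on X (\<lambda>E. chi' E x)"
  by (intro continuous_on_add continuous_on_diff continuous_on_mult cont_PR cont_E assms)+

lemma interior_zero:
  fixes f :: "real \<Rightarrow> real"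
  assumes "continuous_on {a..b} f" "f a < 0 \<and> f b > 0 \<or> f a > 0 \<and> f b < 0"
  obtains E where "a < E" "E < b" "f E = 0"
proof -
  have "\<exists>E\<ge>a. E \<le> b \<and> f E = 0"
    using assms(2) IVT'[of f a 0 b] IVT2'[of f b 0 a] assms(1) a_less_b by fastforce
  then obtain E where "a \<le> E" "E \<le> b" "f E = 0" by blast
  moreover have "E \<noteq> a" "E \<noteq> b" using \<open>f E = 0\<close> assms(2) by auto
  ultimately show ?thesis using that[of E] by simp
qed

lemma singleton_zero_set:
  fixes f :: "real \<Rightarrow> real"
  assumes "continuous_on {a..b} f" "f a < 0 \<and> f b > 0 \<or> f a > 0 \<and> f b < 0"
    and "\<And>E F. \<lbrakk>a < E; E < F; F < b; f E = 0\<rbrakk> \<Longrightarrow> f F \<noteq> 0"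
  obtains E where "{E \<in> {a<..<b}. f E = 0} = {E}"
proof -
  obtain E where E: "a < E" "E < b" "f E = 0" by (rule interior_zero[OF assms(1,2)])
  have "F = E" if "F \<in> {a<..<b}" "f F = 0" for F
    using assms(3)[of E F] assms(3)[of F E] E that by (cases E F rule: linorder_cases) auto
  moreover have "E \<in> {a<..<b}" using E by simp
  ultimately have "{E \<in> {a<..<b}. f E = 0} = {E}" using E(3) by blast
  then show ?thesis using that by blast
qed

text \<open>
  At \<open>a\<close> the value is negative and at \<open>b\<close> it has the sign of \<open>s'\<close>, while \<open>psi_wronskian_pos\<close> forbids
  a second zero. Applied with \<open>b\<close> as the larger energy, it also excludes a zero if \<open>s' \<le> 0\<close>.
\<close>
lemma psi'_zeros:
  assumes "0 < x" "x < h"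
  shows "finite {E \<in> {a<..<b}. psi' E x = 0}"
    "card {E \<in> {a<..<b}. psi' E x = 0} = (if s' b x > 0 then 1 else 0)"
proof -
  show "card {E \<in> {a<..<b}. psi' E x = 0} = (if s' b x > 0 then 1 else 0)"
    and "finite {E \<in> {a<..<b}. psi' E x = 0}"
  proof (atomize (full), cases "s' b x > 0")
    case True
    have "\<exists>E. {E \<in> {a<..<b}. psi' E x = 0} = {E}"
    proof (rule singleton_zero_set[of "\<lambda>E. psi' E x"])
      show "continuous_on {a..b} (\<lambda>E. psi' E x)" using cont_psi assms by simp
      have "psi' a x < 0" using c'_a_neg[of x] P_pos[OF a_less_b] assms by (simp add: R_a mult_pos_neg)
      moreover have "psi' b x > 0" using True R_pos[OF a_less_b] by (simp add: P_b)
      ultimately show "psi' a x < 0 \<and> psi' b x > 0 \<or> psi' a x > 0 \<and> psi' b x < 0" by blast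
      fix E F assume "a < E" "E < F" "F < b" "psi' E x = 0"
      then show "psi' F x \<noteq> 0" using psi_wronskian_pos[of E F x] assms by auto
    qed blast
    then obtain E where "{E \<in> {a<..<b}. psi' E x = 0} = {E}" ..
    then show "card {E \<in> {a<..<b}. psi' E x = 0} = (if s' b x > 0 then 1 else 0) \<and>
        finite {E \<in> {a<..<b}. psi' E x = 0}" using True by simp
  next
    case False
    have "psi' E x \<noteq> 0" if "a < E" "E < b" for E
    proof
      assume "psi' E x = 0"
      then have "psi E x * (R b * s' b x) > 0"
        using psi_wronskian_pos[of E b x] that assms by (simp add: P_b)
      then show False
        using psi_pos[of E x] R_pos[OF a_less_b] False that assms by (simp add: zero_less_mult_iff)
    qed
    then have none: "{E \<in> {a<..<b}. psi' E x = 0} = {}" by auto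
    show "card {E \<in> {a<..<b}. psi' E x = 0} = (if s' b x > 0 then 1 else 0) \<and>
        finite {E \<in> {a<..<b}. psi' E x = 0}" unfolding none using False by simp
  qed
qed

lemma chi_zero:
  assumes "0 < x" "x < h"
  obtains E where "{E \<in> {a<..<b}. chi E x = 0} = {E}"
proof (rule singleton_zero_set[of "\<lambda>E. chi E x"])
  show "continuous_on {a..b} (\<lambda>E. chi E x)" using cont_psi assms by simp
  have "chi a x > 0" using ground_state(2)[OF h_pos, of x] P_pos[OF a_less_b] assms by (simp add: R_a)
  moreover have "chi b x < 0" using s_pos[of b x] R_pos[OF a_less_b] assms by (simp add: P_b)
  ultimately show "chi a x < 0 \<and> chi b x > 0 \<or> chi a x > 0 \<and> chi b x < 0" by blast
  fix E F assume "a < E" "E < F" "F < b" "chi E x = 0"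
  then show "chi F x \<noteq> 0" using chi_comparison(1)[of E F x] assms by simp
qed (rule that)

text \<open>
  Up to its zero \<open>chi\<close> is strictly decreasing by \<open>deriv_neg_until_zero\<close>.
\<close>
lemma chi_neg_at_critical_point:
  assumes "a < E" "E < b" "0 < x" "x \<le> h" "chi' E x = 0"
  shows "chi E x < 0"
proof (rule ccontr)
  assume "\<not> chi E x < 0"
  have chi0: "chi E 0 > 0" using P_pos[OF assms(2)] by simp
  obtain z where z: "0 < z" "z \<le> h" "chi E z = 0" "\<And>t. 0 \<le> t \<Longrightarrow> t < z \<Longrightarrow> chi E t > 0"
    by (rule first_zero[where f="chi E" and y=h, OF solves_continuous(1)[OF solves_diff] chi0])
       (use chi_at_half(1)[OF assms(1,2)] h_pos in auto)
  have sz: "s E z > 0" using s_pos[of E z] z assms by simp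
  have "chi E z * s' E z - chi' E z * s E z = P E * (c E z * s' E z - c' E z * s E z)"
    by (simp add: algebra_simps)
  then have "chi' E z * s E z < 0" using P_pos[OF assms(2)] unfolding z(3) wronskian_cs by simp
  then have "chi' E z < 0" using sz by (simp only: mult_less_0_iff) auto
  have "x \<le> z"
  proof (rule ccontr)
    assume "\<not> x \<le> z"
    then have "c E x / s E x < c E z / s E z"
      using c_over_s_decreasing[of E z x] z assms by simp
    moreover have sx: "s E x > 0" using s_pos[of E x] assms by simp
    ultimately have "c E x * s E z < c E z * s E x" using sz by (simp add: field_simps)
    then have "P E * (c E x * s E z) < P E * (c E z * s E x)" using P_pos[OF assms(2)] by simp
    also have "\<dots> = R E * s E z * s E x" using z(3) by simp
    finally have "chi E x * s E z < 0" by (simp add: algebra_simps)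
    then show False using sz \<open>\<not> chi E x < 0\<close> by (simp only: mult_less_0_iff) auto
  qed
  have "chi' E x < 0"
    by (rule deriv_neg_until_zero[OF solves_diff z(2) _ _ \<open>chi' E z < 0\<close> assms(3) \<open>x \<le> z\<close>])
       (use z(4) R_pos[of E] assms in auto)
  then show False using assms(5) by simp
qed

lemma chi'_zeros:
  assumes "0 < x" "x < h"
  shows "finite {E \<in> {a<..<b}. chi' E x = 0}"
    "card {E \<in> {a<..<b}. chi' E x = 0} = (if s' b x < 0 then 1 else 0)"
proof -
  have step: "chi E x * chi' F x < 0"
    if "a < E" "E < F" "F \<le> b" "chi' E x = 0" for E F
  proof -
    have "chi E x < 0" using chi_neg_at_critical_point[of E x] that assms by simp
    then show ?thesis using chi_comparison(2)[of E F x] that assms by simp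
  qed
  show "card {E \<in> {a<..<b}. chi' E x = 0} = (if s' b x < 0 then 1 else 0)"
    and "finite {E \<in> {a<..<b}. chi' E x = 0}"
  proof (atomize (full), cases "s' b x < 0")
    case True
    have "\<exists>E. {E \<in> {a<..<b}. chi' E x = 0} = {E}"
    proof (rule singleton_zero_set[of "\<lambda>E. chi' E x"])
      show "continuous_on {a..b} (\<lambda>E. chi' E x)" using cont_psi assms by simp
      have "chi' a x < 0" using c'_a_neg[of x] P_pos[OF a_less_b] assms by (simp add: R_a mult_pos_neg)
      moreover have "chi' b x > 0" using True R_pos[OF a_less_b] by (simp add: P_b mult_pos_neg)
      ultimately show "chi' a x < 0 \<and> chi' b x > 0 \<or> chi' a x > 0 \<and> chi' b x < 0" by blast
      fix E F assume "a < E" "E < F" "F < b" "chi' E x = 0"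
      then show "chi' F x \<noteq> 0" using step[of E F] by auto
    qed blast
    then obtain E where "{E \<in> {a<..<b}. chi' E x = 0} = {E}" ..
    then show "card {E \<in> {a<..<b}. chi' E x = 0} = (if s' b x < 0 then 1 else 0) \<and>
        finite {E \<in> {a<..<b}. chi' E x = 0}" using True by simp
  next
    case False
    have "chi' E x \<noteq> 0" if "a < E" "E < b" for E
    proof
      assume z: "chi' E x = 0"
      have "chi E x * (- (R b * s' b x)) < 0" using step[of E b] that z by (simp add: P_b)
      moreover have "chi E x < 0" using chi_neg_at_critical_point[of E x] that assms z by simp
      moreover have "- (R b * s' b x) \<le> 0" using R_pos[OF a_less_b] False by simp
      ultimately show False using mult_nonpos_nonpos[of "chi E x" "- (R b * s' b x)"] by linarith
    qed
    then have none: "{E \<in> {a<..<b}. chi' E x = 0} = {}" by auto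
    show "card {E \<in> {a<..<b}. chi' E x = 0} = (if s' b x < 0 then 1 else 0) \<and>
        finite {E \<in> {a<..<b}. chi' E x = 0}" unfolding none using False by simp
  qed
qed

text \<open>
  The energies in the gap for which the decaying solution, translated by \<open>t\<close>, extends from the half
  line to an odd or to an even function.
\<close>
definition states :: "real \<Rightarrow> real set" where
  "states t = {E \<in> {a<..<b}. psi E t = 0 \<or> psi' E t = 0}"

lemma states_left:
  assumes "0 < t" "t < h"
  shows "finite (states t)" "card (states t) = (if s' b t > 0 then 1 else 0)"
proof -
  have "psi E t \<noteq> 0" if "a < E" "E < b" for E using psi_pos[of E t] that assms by simp
  then have "states t = {E \<in> {a<..<b}. psi' E t = 0}" by (auto simp: states_def)
  then show "finite (states t)" "card (states t) = (if s' b t > 0 then 1 else 0)"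
    using psi'_zeros[OF assms] by simp_all
qed

lemma states_half: "states h = {}"
proof -
  have "psi E h \<noteq> 0 \<and> psi' E h \<noteq> 0" if "a < E" "E < b" for E
    using psi_at_half[OF that] by (metis less_irrefl)
  then show ?thesis unfolding states_def Collect_empty_eq by (metis greaterThanLessThan_iff)
qed

text \<open>
  Here the mirrored solution \<open>chi\<close> may vanish for one energy and its derivative for another.
\<close>
lemma states_right:
  assumes "0 < x" "x < h"
  shows "finite (states (d - x))" "card (states (d - x)) = (if s' b x < 0 then 2 else 1)"
proof -
  have m: "multiplier E \<noteq> 0" if "a < E" "E < b" for E using multiplier(2)[OF that] by simp
  have st: "states (d - x) = {E \<in> {a<..<b}. chi E x = 0} \<union> {E \<in> {a<..<b}. chi' E x = 0}"
  proof (intro equalityI subsetI)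
    fix E assume "E \<in> states (d - x)"
    then have E: "a < E" "E < b" "psi E (d - x) = 0 \<or> psi' E (d - x) = 0" by (auto simp: states_def)
    then show "E \<in> {E \<in> {a<..<b}. chi E x = 0} \<union> {E \<in> {a<..<b}. chi' E x = 0}"
      using m[OF E(1,2)] unfolding psi_mirror[OF E(1,2)] by simp
  next
    fix E assume E: "E \<in> {E \<in> {a<..<b}. chi E x = 0} \<union> {E \<in> {a<..<b}. chi' E x = 0}"
    then have ab: "a < E" "E < b" by auto
    then show "E \<in> states (d - x)"
      using E unfolding states_def mem_Collect_eq psi_mirror[OF ab] by auto
  qed
  have disj: "{E \<in> {a<..<b}. chi E x = 0} \<inter> {E \<in> {a<..<b}. chi' E x = 0} = {}"
    using chi_neg_at_critical_point[of _ x] assms by fastforce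
  obtain E where E: "{E \<in> {a<..<b}. chi E x = 0} = {E}" by (rule chi_zero[OF assms])
  show "finite (states (d - x))" unfolding st E using chi'_zeros[OF assms] by simp
  have "card (states (d - x)) = card {E} + card {E \<in> {a<..<b}. chi' E x = 0}"
    unfolding st E by (rule card_Un_disjoint) (use chi'_zeros[OF assms] disj E in simp_all)
  then show "card (states (d - x)) = (if s' b x < 0 then 2 else 1)"
    unfolding chi'_zeros(2)[OF assms] by simp
qed

lemma states_period: "states d = {}"
proof -
  have "psi E d \<noteq> 0 \<and> psi' E d \<noteq> 0" if "a < E" "E < b" for E
    using multiplier(2)[OF that] psi_mirror[OF that, of 0] P_pos[of E] R_pos[of E] that by simp
  then show ?thesis unfolding states_def Collect_empty_eq by (metis greaterThanLessThan_iff)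
qed

end

section \<open>Weak derivatives on the line\<close>

text \<open>
  Almost every point is a Lebesgue point in the strong sense. It suffices to apply the differentiation
  theorem to \<open>|f - r|\<close> for all rational \<open>r\<close> and to choose \<open>r\<close> close to \<open>f x\<close>.
\<close>
lemma strong_lebesgue_points:
  fixes f :: "real \<Rightarrow> real"
  assumes f: "\<And>a b. f absolutely_integrable_on {a..b}"
  obtains N where "negligible N"
    "\<And>x e. \<lbrakk>x \<notin> N; 0 < e\<rbrakk> \<Longrightarrow> \<exists>d>0. \<forall>h. 0 < h \<and> h < d \<longrightarrow>
       integral {x..x+h} (\<lambda>y. \<bar>f y - f x\<bar>) \<le> e * h"
proof -
  have ai: "(\<lambda>y. \<bar>f y - r\<bar>) absolutely_integrable_on {a..b}" for r a b
  proof -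
    have "(\<lambda>y. f y - r) absolutely_integrable_on {a..b}"
      by (intro set_integral_diff f absolutely_integrable_on_const) auto
    from absolutely_integrable_norm[OF this] show ?thesis by (simp add: o_def)
  qed
  have io: "(\<lambda>y. \<bar>f y - r\<bar>) integrable_on {a..b}" for r a b
    using ai by (rule set_lebesgue_integral_eq_integral(1))
  have "\<exists>N. negligible N \<and> (\<forall>x e. x \<notin> N \<longrightarrow> 0 < e \<longrightarrow> (\<exists>d>0. \<forall>h. 0 < h \<and> h < d \<longrightarrow>
            \<bar>integral {x..x+h} (\<lambda>y. \<bar>f y - r\<bar>) / h - \<bar>f x - r\<bar>\<bar> < e))" for r
  proof -
    have "(\<lambda>y. \<bar>f y - r\<bar>) integrable_on cbox a b" for a b using io by simp
    from integrable_ccontinuous_explicit[OF this] obtain N where "negligible N"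
      "\<And>x e. x \<notin> N \<Longrightarrow> 0 < e \<Longrightarrow> \<exists>d>0. \<forall>h. 0 < h \<and> h < d \<longrightarrow>
        norm (integral (cbox x (x + h *\<^sub>R One)) (\<lambda>y. \<bar>f y - r\<bar>) /\<^sub>R h ^ DIM(real) - \<bar>f x - r\<bar>) < e"
      by metis
    then show ?thesis by (intro exI[of _ N]) (simp add: divide_inverse mult.commute)
  qed
  then obtain N where N: "\<And>r. negligible (N r)"
    "\<And>r x e. x \<notin> N r \<Longrightarrow> 0 < e \<Longrightarrow> \<exists>d>0. \<forall>h. 0 < h \<and> h < d \<longrightarrow>
            \<bar>integral {x..x+h} (\<lambda>y. \<bar>f y - r\<bar>) / h - \<bar>f x - r\<bar>\<bar> < e"
    by metis
  show ?thesis
  proof (rule that[of "\<Union>r\<in>\<rat>. N r"])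
    show "negligible (\<Union>r\<in>\<rat>. N r)"
      by (rule negligible_countable_Union) (use N(1) countable_rat in auto)
    fix x e :: real assume x: "x \<notin> (\<Union>r\<in>\<rat>. N r)" and "0 < e"
    obtain r where r: "r \<in> \<rat>" "f x < r" "r < f x + e / 4"
      using Rats_dense_in_real[of "f x" "f x + e / 4"] \<open>0 < e\<close> by auto
    then have "x \<notin> N r" using x by blast
    from N(2)[OF this, of "e / 4"] \<open>0 < e\<close> obtain d where "d > 0" and
      d: "\<And>h. 0 < h \<Longrightarrow> h < d \<Longrightarrow> \<bar>integral {x..x+h} (\<lambda>y. \<bar>f y - r\<bar>) / h - \<bar>f x - r\<bar>\<bar> < e / 4" by auto
    have "integral {x..x+h} (\<lambda>y. \<bar>f y - f x\<bar>) \<le> e * h" if h: "0 < h" "h < d" for h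
    proof -
      have "integral {x..x+h} (\<lambda>y. \<bar>f y - r\<bar>) / h < e / 2" using d[OF h] r by linarith
      then have 1: "integral {x..x+h} (\<lambda>y. \<bar>f y - r\<bar>) < e / 2 * h" using h by (simp add: divide_less_eq)
      have "integral {x..x+h} (\<lambda>y. \<bar>f y - f x\<bar>) \<le> integral {x..x+h} (\<lambda>y. \<bar>f y - r\<bar> + e / 4)"
        by (rule integral_le) (use io r in \<open>auto intro!: integrable_add\<close>)
      also have "\<dots> = integral {x..x+h} (\<lambda>y. \<bar>f y - r\<bar>) + integral {x..x+h} (\<lambda>y. e / 4)"
        by (rule integral_add) (use io in auto)
      also have "\<dots> \<le> e / 2 * h + e / 4 * h" using 1 h by (simp add: mult.commute)
      also have "\<dots> \<le> e * h" using h \<open>0 < e\<close> by (simp add: algebra_simps)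
      finally show ?thesis .
    qed
    then show "\<exists>d>0. \<forall>h. 0 < h \<and> h < d \<longrightarrow> integral {x..x+h} (\<lambda>y. \<bar>f y - f x\<bar>) \<le> e * h"
      using \<open>d > 0\<close> by blast
  qed
qed

text \<open>
  A continuously differentiable transition from \<open>0\<close> to \<open>1\<close> on \<open>[0, 2\<epsilon>]\<close>, the second difference quotient
  of \<open>(max 0 x)\<^sup>2 / 2\<close>. Its derivative is a tent of mass \<open>1\<close>.
\<close>
definition smooth_step :: "real \<Rightarrow> real \<Rightarrow> real" where
  "smooth_step \<epsilon> x = ((max 0 x)\<^sup>2 - 2 * (max 0 (x - \<epsilon>))\<^sup>2 + (max 0 (x - 2 * \<epsilon>))\<^sup>2) / (2 * \<epsilon>\<^sup>2)"

definition tent :: "real \<Rightarrow> real \<Rightarrow> real" where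
  "tent \<epsilon> x = (max 0 x - 2 * max 0 (x - \<epsilon>) + max 0 (x - 2 * \<epsilon>)) / \<epsilon>\<^sup>2"

lemma DERIV_max_square: "((\<lambda>x::real. (max 0 x)\<^sup>2) has_real_derivative 2 * max 0 x) (at x)"
proof -
  consider "x > 0" | "x < 0" | "x = 0" by linarith
  then show ?thesis
  proof cases
    case 1
    have "((\<lambda>x::real. x\<^sup>2) has_real_derivative 2 * max 0 x) (at x)"
      using 1 by (auto intro!: derivative_eq_intros)
    then show ?thesis
      by (rule has_field_derivative_transform_within_open[of _ _ _ "{0<..}"]) (use 1 in auto)
  next
    case 2
    have "((\<lambda>x::real. 0) has_real_derivative 2 * max 0 x) (at x)" using 2 by simp
    then show ?thesis
      by (rule has_field_derivative_transform_within_open[of _ _ _ "{..<0}"]) (use 2 in auto)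
  next
    case 3
    have "((\<lambda>h::real. (max 0 h)\<^sup>2 / h) \<longlongrightarrow> 0) (at 0)"
    proof (rule Lim_null_comparison[where g="\<lambda>h. \<bar>h\<bar>"])
      show "\<forall>\<^sub>F h::real in at 0. norm ((max 0 h)\<^sup>2 / h) \<le> \<bar>h\<bar>"
        by (rule always_eventually) (auto simp: max_def power2_eq_square)
      show "((\<lambda>h::real. \<bar>h\<bar>) \<longlongrightarrow> 0) (at 0)"
        by (rule tendsto_rabs_zero) (rule tendsto_ident_at)
    qed
    then show ?thesis using 3 by (simp add: DERIV_def)
  qed
qed

lemma DERIV_smooth_step:
  assumes "\<epsilon> > 0"
  shows "((\<lambda>x. smooth_step \<epsilon> (x - p)) has_real_derivative tent \<epsilon> (x - p)) (at x)"
proof -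
  have D: "((\<lambda>x::real. (max 0 (x - a))\<^sup>2) has_real_derivative 2 * max 0 (x - a)) (at x)" for a x
  proof -
    have "((\<lambda>x. x - a) has_real_derivative 1) (at x)" by (auto intro!: derivative_eq_intros)
    from DERIV_chain'[OF this DERIV_max_square] show ?thesis by simp
  qed
  have "((\<lambda>x. ((max 0 (x - p))\<^sup>2 - 2 * (max 0 (x - (p + \<epsilon>)))\<^sup>2 + (max 0 (x - (p + 2 * \<epsilon>)))\<^sup>2) / (2 * \<epsilon>\<^sup>2))
      has_real_derivative (2 * max 0 (x - p) - 2 * (2 * max 0 (x - (p + \<epsilon>))) + 2 * max 0 (x - (p + 2 * \<epsilon>))) / (2 * \<epsilon>\<^sup>2)) (at x)"
    by (intro DERIV_cdivide DERIV_add DERIV_diff DERIV_cmult D)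
  moreover have "(2 * max 0 (x - p) - 2 * (2 * max 0 (x - (p + \<epsilon>))) + 2 * max 0 (x - (p + 2 * \<epsilon>))) / (2 * \<epsilon>\<^sup>2) = tent \<epsilon> (x - p)"
  proof -
    have "(2 * A - 2 * (2 * B) + 2 * C) / (2 * \<epsilon>\<^sup>2) = (A - 2 * B + C) / \<epsilon>\<^sup>2" for A B C :: real
      using assms by (simp add: field_simps)
    then show ?thesis by (simp add: tent_def diff_diff_eq)
  qed
  ultimately show ?thesis by (simp add: smooth_step_def diff_diff_eq)
qed

lemma smooth_step_0: "\<epsilon> > 0 \<Longrightarrow> x \<le> 0 \<Longrightarrow> smooth_step \<epsilon> x = 0"
  by (simp add: smooth_step_def)

lemma smooth_step_1: "\<epsilon> > 0 \<Longrightarrow> x \<ge> 2 * \<epsilon> \<Longrightarrow> smooth_step \<epsilon> x = 1"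
  by (simp add: smooth_step_def field_simps power2_eq_square)

lemma tent_0: "\<epsilon> > 0 \<Longrightarrow> x \<le> 0 \<or> x \<ge> 2 * \<epsilon> \<Longrightarrow> tent \<epsilon> x = 0"
  by (auto simp: tent_def)

lemma tent_bounds: assumes "\<epsilon> > 0" shows "0 \<le> tent \<epsilon> x" "tent \<epsilon> x \<le> 1 / \<epsilon>"
proof -
  have "0 \<le> max 0 x - 2 * max 0 (x - \<epsilon>) + max 0 (x - 2 * \<epsilon>)"
    and *: "max 0 x - 2 * max 0 (x - \<epsilon>) + max 0 (x - 2 * \<epsilon>) \<le> \<epsilon>"
    using assms by (auto simp: max_def)
  then show "0 \<le> tent \<epsilon> x" by (simp add: tent_def)
  have "tent \<epsilon> x \<le> \<epsilon> / \<epsilon>\<^sup>2" unfolding tent_def using * by (intro divide_right_mono) auto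
  then show "tent \<epsilon> x \<le> 1 / \<epsilon>" using assms by (simp add: power2_eq_square)
qed

lemma continuous_tent: "continuous_on X (\<lambda>x. tent \<epsilon> (x - p))"
  by (simp only: tent_def divide_inverse) (intro continuous_on_mult_right continuous_intros)

lemma smooth_step_bounds: assumes "\<epsilon> > 0" shows "0 \<le> smooth_step \<epsilon> x" "smooth_step \<epsilon> x \<le> 1"
proof -
  have mono: "smooth_step \<epsilon> x \<le> smooth_step \<epsilon> y" if "x \<le> y" for x y
    using DERIV_nonneg_imp_nondecreasing[OF that, of "smooth_step \<epsilon>"]
      DERIV_smooth_step[OF assms, of 0] tent_bounds(1)[OF assms] by auto
  show "0 \<le> smooth_step \<epsilon> x"
    using mono[of "min 0 x" x] smooth_step_0[OF assms, of "min 0 x"] by simp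
  show "smooth_step \<epsilon> x \<le> 1"
    using mono[of x "max (2 * \<epsilon>) x"] smooth_step_1[OF assms, of "max (2 * \<epsilon>) x"] by simp
qed

lemma has_integral_tent:
  assumes "\<epsilon> > 0"
  shows "((\<lambda>x. tent \<epsilon> (x - p)) has_integral 1) {p..p + 2 * \<epsilon>}"
proof -
  have "((\<lambda>x. tent \<epsilon> (x - p)) has_integral smooth_step \<epsilon> (p + 2 * \<epsilon> - p) - smooth_step \<epsilon> (p - p)) {p..p + 2 * \<epsilon>}"
    by (rule fundamental_theorem_of_calculus)
       (use assms DERIV_smooth_step[OF assms] in \<open>auto simp: has_real_derivative_iff_has_vector_derivative[symmetric]
          intro: has_field_derivative_at_within\<close>)
  then show ?thesis using assms by (simp add: smooth_step_0 smooth_step_1)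
qed

definition real_weak_derivative :: "(real \<Rightarrow> real) \<Rightarrow> (real \<Rightarrow> real) \<Rightarrow> bool" where
  "real_weak_derivative f g \<longleftrightarrow>
    (\<forall>\<phi>. test_function \<phi> \<longrightarrow>
      (LINT x|lborel. deriv \<phi> x * f x) = - (LINT x|lborel. \<phi> x * g x))"

lemma C1_on_UNIV:
  "\<phi> C1_differentiable_on UNIV \<longleftrightarrow>
     (\<forall>x. (\<phi> has_real_derivative deriv \<phi> x) (at x)) \<and> continuous_on UNIV (deriv \<phi>)"
  for \<phi> :: "real \<Rightarrow> real"
proof
  assume "\<phi> C1_differentiable_on UNIV"
  then obtain D where D: "\<And>x. (\<phi> has_vector_derivative D x) (at x)" "continuous_on UNIV D"
    unfolding C1_differentiable_on_def by auto
  then have D': "(\<phi> has_real_derivative D x) (at x)" for x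
    by (simp add: has_real_derivative_iff_has_vector_derivative)
  then have "deriv \<phi> = D" using DERIV_imp_deriv by (intro ext) blast
  then show "(\<forall>x. (\<phi> has_real_derivative deriv \<phi> x) (at x)) \<and> continuous_on UNIV (deriv \<phi>)"
    using D' D(2) by simp
next
  assume "(\<forall>x. (\<phi> has_real_derivative deriv \<phi> x) (at x)) \<and> continuous_on UNIV (deriv \<phi>)"
  then show "\<phi> C1_differentiable_on UNIV"
    unfolding C1_differentiable_on_def has_real_derivative_iff_has_vector_derivative by blast
qed

lemma test_function_step_difference:
  assumes "\<epsilon> > 0" "p \<le> q"
  shows "test_function (\<lambda>x. smooth_step \<epsilon> (x - p) - smooth_step \<epsilon> (x - q))"
    and "deriv (\<lambda>x. smooth_step \<epsilon> (x - p) - smooth_step \<epsilon> (x - q)) = (\<lambda>x. tent \<epsilon> (x - p) - tent \<epsilon> (x - q))"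
proof -
  let ?\<phi> = "\<lambda>x. smooth_step \<epsilon> (x - p) - smooth_step \<epsilon> (x - q)"
  have D: "(?\<phi> has_real_derivative tent \<epsilon> (x - p) - tent \<epsilon> (x - q)) (at x)" for x
    by (intro DERIV_diff DERIV_smooth_step assms)
  then show d: "deriv ?\<phi> = (\<lambda>x. tent \<epsilon> (x - p) - tent \<epsilon> (x - q))"
    using DERIV_imp_deriv by (intro ext) blast
  have "?\<phi> C1_differentiable_on UNIV"
    unfolding C1_on_UNIV d using D by (auto intro!: continuous_on_diff continuous_tent)
  moreover have "{x. ?\<phi> x \<noteq> 0} \<subseteq> {p..q + 2 * \<epsilon>}"
  proof (rule subsetI, rule ccontr)
    fix x assume "x \<in> {x. ?\<phi> x \<noteq> 0}" "x \<notin> {p..q + 2 * \<epsilon>}"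
    then consider "x < p" | "x > q + 2 * \<epsilon>" by fastforce
    then show False
    proof cases
      case 1
      then show ?thesis using \<open>x \<in> {x. ?\<phi> x \<noteq> 0}\<close> assms by (simp add: smooth_step_0)
    next
      case 2
      then show ?thesis using \<open>x \<in> {x. ?\<phi> x \<noteq> 0}\<close> assms by (simp add: smooth_step_1)
    qed
  qed
  then have "closure {x. ?\<phi> x \<noteq> 0} \<subseteq> {p..q + 2 * \<epsilon>}" by (rule closure_minimal) simp
  then have "compact (closure {x. ?\<phi> x \<noteq> 0})"
    by (meson bounded_closed_interval bounded_subset closed_closure compact_eq_bounded_closed)
  ultimately show "test_function ?\<phi>" by (simp add: test_function_def)
qed

lemma set_integrable_bounded_mult:
  fixes k f :: "real \<Rightarrow> real"
  assumes "k \<in> borel_measurable lborel" "\<And>x. x \<in> X \<Longrightarrow> \<bar>k x\<bar> \<le> B"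
    and "set_integrable lborel X f"
  shows "set_integrable lborel X (\<lambda>x. k x * f x)"
  unfolding set_integrable_def
proof (rule Bochner_Integration.integrable_bound)
  have f: "(\<lambda>x. indicator X x *\<^sub>R f x) \<in> borel_measurable lborel"
    using assms(3) unfolding set_integrable_def by (rule borel_measurable_integrable)
  show "integrable lborel (\<lambda>x. B * (indicator X x *\<^sub>R f x))"
    using assms(3) unfolding set_integrable_def by (rule integrable_mult_right)
  have "(\<lambda>x. k x * (indicator X x *\<^sub>R f x)) \<in> borel_measurable lborel"
    by (intro borel_measurable_times assms(1) f)
  then show "(\<lambda>x. indicator X x *\<^sub>R (k x * f x)) \<in> borel_measurable lborel"
    by (simp add: mult.left_commute)
  show "AE x in lborel. norm (indicator X x *\<^sub>R (k x * f x)) \<le> norm (B * (indicator X x *\<^sub>R f x))"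
    using assms(2) by (intro AE_I2) (force simp: indicator_def abs_mult intro!: mult_right_mono)
qed

lemma set_integrable_lebesgue:
  fixes f :: "real \<Rightarrow> real"
  assumes "set_integrable lborel X f" shows "f absolutely_integrable_on X"
  using assms integrable_completion[of "\<lambda>x. indicator X x *\<^sub>R f x" lborel]
  unfolding set_integrable_def by (metis borel_measurable_integrable)

lemma LINT_supported:
  fixes f :: "real \<Rightarrow> real"
  assumes "set_integrable lborel X f" "\<And>x. x \<notin> X \<Longrightarrow> f x = 0"
  shows "(LINT x|lborel. f x) = integral X f" "f integrable_on X" "integrable lborel f"
proof -
  have eq: "(\<lambda>x. indicator X x *\<^sub>R f x) = f" using assms(2) by (auto simp: fun_eq_iff indicator_def)
  show "(LINT x|lborel. f x) = integral X f" "f integrable_on X"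
    using set_borel_integral_eq_integral[OF assms(1)] unfolding set_lebesgue_integral_def eq by simp_all
  show "integrable lborel f" using assms(1) unfolding set_integrable_def eq .
qed

text \<open>
  Tent averages converge at strong Lebesgue points although the tent is not a mean over an interval:
  it is bounded by \<open>1/\<epsilon>\<close> on an interval of length \<open>2\<epsilon>\<close>.
\<close>
lemma tent_average:
  fixes f :: "real \<Rightarrow> real"
  assumes f: "\<And>a b. set_integrable lborel {a..b} f" and "\<epsilon> > 0"
    and le: "integral {p..p + 2 * \<epsilon>} (\<lambda>y. \<bar>f y - f p\<bar>) \<le> e * (2 * \<epsilon>)"
  shows "integrable lborel (\<lambda>x. tent \<epsilon> (x - p) * f x)"
    and "\<bar>(LINT x|lborel. tent \<epsilon> (x - p) * f x) - f p\<bar> \<le> 2 * e"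
proof -
  let ?I = "{p..p + 2 * \<epsilon>}"
  have tm: "(\<lambda>x. tent \<epsilon> (x - p)) \<in> borel_measurable lborel"
    using borel_measurable_continuous_onI[OF continuous_tent] by simp
  have bd: "\<bar>tent \<epsilon> (x - p)\<bar> \<le> 1 / \<epsilon>" for x using tent_bounds[OF \<open>\<epsilon> > 0\<close>, of "x - p"] by simp
  have si: "set_integrable lborel ?I (\<lambda>x. tent \<epsilon> (x - p) * f x)"
    by (rule set_integrable_bounded_mult[OF tm bd f])
  have zero: "tent \<epsilon> (x - p) * f x = 0" if "x \<notin> ?I" for x
  proof -
    have "x - p \<le> 0 \<or> x - p \<ge> 2 * \<epsilon>" using that by auto
    then show ?thesis using tent_0[OF \<open>\<epsilon> > 0\<close>] by simp
  qed
  note L = LINT_supported[OF si zero]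
  show "integrable lborel (\<lambda>x. tent \<epsilon> (x - p) * f x)" by (rule L(3))
  have t_int: "((\<lambda>x. tent \<epsilon> (x - p) * f p) has_integral 1 * f p) ?I"
    by (rule has_integral_mult_left[OF has_integral_tent[OF \<open>\<epsilon> > 0\<close>]])
  have si2: "set_integrable lborel ?I (\<lambda>x. tent \<epsilon> (x - p) * (f x - f p))"
    by (rule set_integrable_bounded_mult[OF tm bd])
       (intro set_integral_diff f borel_integrable_atLeastAtMost' continuous_on_const)
  have ai2: "(\<lambda>x. \<bar>f x - f p\<bar>) integrable_on ?I"
  proof -
    have "set_integrable lborel ?I (\<lambda>x. f x - f p)"
      by (intro set_integral_diff f borel_integrable_atLeastAtMost' continuous_on_const)
    from set_borel_integral_eq_integral(1)[OF set_integrable_norm[OF this]] show ?thesis by simp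
  qed
  have "(LINT x|lborel. tent \<epsilon> (x - p) * f x) - f p = integral ?I (\<lambda>x. tent \<epsilon> (x - p) * f x) - integral ?I (\<lambda>x. tent \<epsilon> (x - p) * f p)"
    using L(1) integral_unique[OF t_int] by simp
  also have "\<dots> = integral ?I (\<lambda>x. tent \<epsilon> (x - p) * f x - tent \<epsilon> (x - p) * f p)"
    by (rule integral_diff[symmetric]) (use L(2) t_int in auto)
  also have "\<dots> = integral ?I (\<lambda>x. tent \<epsilon> (x - p) * (f x - f p))" by (simp add: right_diff_distrib)
  finally have eq: "(LINT x|lborel. tent \<epsilon> (x - p) * f x) - f p = integral ?I (\<lambda>x. tent \<epsilon> (x - p) * (f x - f p))" .
  have "norm (integral ?I (\<lambda>x. tent \<epsilon> (x - p) * (f x - f p))) \<le> integral ?I (\<lambda>x. 1 / \<epsilon> * \<bar>f x - f p\<bar>)"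
  proof (rule integral_norm_bound_integral)
    show "(\<lambda>x. tent \<epsilon> (x - p) * (f x - f p)) integrable_on ?I"
      by (rule set_borel_integral_eq_integral(1)[OF si2])
    show "(\<lambda>x. 1 / \<epsilon> * \<bar>f x - f p\<bar>) integrable_on ?I" by (rule integrable_on_mult_right[OF ai2])
    show "norm (tent \<epsilon> (x - p) * (f x - f p)) \<le> 1 / \<epsilon> * \<bar>f x - f p\<bar>" for x
      unfolding real_norm_def abs_mult by (rule mult_right_mono[OF bd]) simp
  qed
  also have "\<dots> = 1 / \<epsilon> * integral ?I (\<lambda>x. \<bar>f x - f p\<bar>)" by (rule integral_mult_right)
  also have "\<dots> \<le> 1 / \<epsilon> * (e * (2 * \<epsilon>))" using le \<open>\<epsilon> > 0\<close> by (intro mult_left_mono) auto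
  also have "\<dots> = 2 * e" using \<open>\<epsilon> > 0\<close> by simp
  finally show "\<bar>(LINT x|lborel. tent \<epsilon> (x - p) * f x) - f p\<bar> \<le> 2 * e" unfolding eq by simp
qed

lemma smooth_step_tendsto:
  "(\<lambda>n. smooth_step (1 / Suc n) y) \<longlonglongrightarrow> indicator {0<..} y"
proof (cases "y > 0")
  case True
  have "\<forall>\<^sub>F n in sequentially. 2 * (1 / real (Suc n)) < y"
    using order_tendstoD(2)[OF tendsto_mult_right_zero[OF lim_inverse_n'[THEN LIMSEQ_Suc], of 2] True]
    by simp
  then have "\<forall>\<^sub>F n in sequentially. smooth_step (1 / Suc n) y = 1"
    by eventually_elim (simp add: smooth_step_1)
  then show ?thesis using True by (simp add: tendsto_eventually)
next
  case False
  then show ?thesis by (simp add: smooth_step_0)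
qed

text \<open>
  Test the weak derivative with a smoothed indicator function of \<open>(p,q]\<close>. The left-hand side is a
  difference of tent averages of \<open>f\<close> at \<open>p\<close> and \<open>q\<close>, and the right-hand side converges by dominated
  convergence.
\<close>
theorem weak_derivative_increment:
  assumes f: "\<And>a b. set_integrable lborel {a..b} f" and g: "\<And>a b. set_integrable lborel {a..b} g"
    and weak: "real_weak_derivative f g"
  obtains N where "negligible N" "\<And>p q. p \<notin> N \<Longrightarrow> q \<notin> N \<Longrightarrow> p < q \<Longrightarrow> f q - f p = integral {p..q} g"
proof -
  have "f absolutely_integrable_on {a..b}" for a b using f by (rule set_integrable_lebesgue)
  then obtain N where N: "negligible N"
    "\<And>x e. \<lbrakk>x \<notin> N; 0 < e\<rbrakk> \<Longrightarrow> \<exists>d>0. \<forall>h. 0 < h \<and> h < d \<longrightarrow> integral {x..x+h} (\<lambda>y. \<bar>f y - f x\<bar>) \<le> e * h"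
    using strong_lebesgue_points by blast
  define \<epsilon> where "\<epsilon> n = 1 / real (Suc n)" for n
  have \<epsilon>: "\<epsilon> n > 0" "\<epsilon> n \<le> 1" for n by (simp_all add: \<epsilon>_def)
  have \<epsilon>_lim: "\<epsilon> \<longlonglongrightarrow> 0" unfolding \<epsilon>_def[abs_def] by (rule LIMSEQ_Suc[OF lim_inverse_n'])
  have tm: "(\<lambda>x. tent (\<epsilon> n) (x - p)) \<in> borel_measurable lborel" for n p
    using borel_measurable_continuous_onI[OF continuous_tent] by simp
  have ti: "integrable lborel (\<lambda>x. tent (\<epsilon> n) (x - p) * f x)" for n p
  proof (rule LINT_supported(3))
    show "set_integrable lborel {p..p + 2 * \<epsilon> n} (\<lambda>x. tent (\<epsilon> n) (x - p) * f x)"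
    proof (rule set_integrable_bounded_mult[OF tm _ f])
      show "\<bar>tent (\<epsilon> n) (x - p)\<bar> \<le> 1 / \<epsilon> n" for x using tent_bounds[OF \<epsilon>(1), of n "x - p"] by simp
    qed
    show "tent (\<epsilon> n) (x - p) * f x = 0" if "x \<notin> {p..p + 2 * \<epsilon> n}" for x
      using that tent_0[OF \<epsilon>(1), of "x - p" n] by auto
  qed
  have avg: "(\<lambda>n. LINT x|lborel. tent (\<epsilon> n) (x - p) * f x) \<longlonglongrightarrow> f p" if "p \<notin> N" for p
  proof (rule LIMSEQ_I)
    fix r :: real assume "0 < r"
    from N(2)[OF that, of "r / 4"] \<open>0 < r\<close> obtain d where "d > 0" and
      d: "\<And>h. 0 < h \<Longrightarrow> h < d \<Longrightarrow> integral {p..p+h} (\<lambda>y. \<bar>f y - f p\<bar>) \<le> r / 4 * h" by auto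
    from LIMSEQ_D[OF \<epsilon>_lim, of "d / 2"] \<open>d > 0\<close> obtain n0 where n0: "\<And>n. n \<ge> n0 \<Longrightarrow> \<bar>\<epsilon> n\<bar> < d / 2" by auto
    have "norm ((LINT x|lborel. tent (\<epsilon> n) (x - p) * f x) - f p) < r" if "n \<ge> n0" for n
    proof -
      have "2 * \<epsilon> n < d" using n0[OF that] by simp
      then have "\<bar>(LINT x|lborel. tent (\<epsilon> n) (x - p) * f x) - f p\<bar> \<le> 2 * (r / 4)"
        by (intro tent_average(2)[OF f \<epsilon>(1)] d) (simp_all add: \<epsilon>)
      then show ?thesis using \<open>0 < r\<close> by simp
    qed
    then show "\<exists>n0. \<forall>n\<ge>n0. norm ((LINT x|lborel. tent (\<epsilon> n) (x - p) * f x) - f p) < r" by blast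
  qed
  show ?thesis
  proof (rule that[OF N(1)])
    fix p q assume pq: "p \<notin> N" "q \<notin> N" "p < q"
    define \<phi> where "\<phi> n x = smooth_step (\<epsilon> n) (x - p) - smooth_step (\<epsilon> n) (x - q)" for n x
    have w: "(LINT x|lborel. tent (\<epsilon> n) (x - p) * f x) - (LINT x|lborel. tent (\<epsilon> n) (x - q) * f x)
        = - (LINT x|lborel. \<phi> n x * g x)" for n
    proof -
      have "test_function (\<phi> n)" "deriv (\<phi> n) = (\<lambda>x. tent (\<epsilon> n) (x - p) - tent (\<epsilon> n) (x - q))"
        unfolding \<phi>_def[abs_def] using test_function_step_difference[OF \<epsilon>(1)] pq(3) by simp_all
      then have "(LINT x|lborel. (tent (\<epsilon> n) (x - p) - tent (\<epsilon> n) (x - q)) * f x) = - (LINT x|lborel. \<phi> n x * g x)"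
        using weak unfolding real_weak_derivative_def by metis
      moreover have "(LINT x|lborel. (tent (\<epsilon> n) (x - p) - tent (\<epsilon> n) (x - q)) * f x) =
          (LINT x|lborel. tent (\<epsilon> n) (x - p) * f x) - (LINT x|lborel. tent (\<epsilon> n) (x - q) * f x)"
        unfolding left_diff_distrib by (rule Bochner_Integration.integral_diff[OF ti ti])
      ultimately show ?thesis by simp
    qed
    have g_meas: "(\<lambda>x. indicator {p..q + 2} x *\<^sub>R g x) \<in> borel_measurable lborel"
      using g[of p "q + 2"] unfolding set_integrable_def by (rule borel_measurable_integrable)
    have \<phi>_meas: "\<phi> n \<in> borel_measurable lborel" for n
    proof -
      have "continuous_on UNIV (\<phi> n)" unfolding \<phi>_def[abs_def]
        by (rule continuous_at_imp_continuous_on, rule ballI, rule DERIV_isCont,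
            rule DERIV_diff[OF DERIV_smooth_step[OF \<epsilon>(1)] DERIV_smooth_step[OF \<epsilon>(1)]])
      then show ?thesis using borel_measurable_continuous_onI by simp
    qed
    have \<phi>_supp: "\<phi> n x = 0" if outside: "x \<notin> {p..q + 2}" for n x
    proof -
      consider "x < p" | "x > q + 2" using outside by fastforce
      then show ?thesis
        using \<epsilon>[of n] pq(3) by cases (simp_all add: \<phi>_def smooth_step_0 smooth_step_1)
    qed
    have \<phi>_bd: "\<bar>\<phi> n x\<bar> \<le> 1" for n x
      using smooth_step_bounds[OF \<epsilon>(1), of n "x - p"] smooth_step_bounds[OF \<epsilon>(1), of n "x - q"]
      by (simp add: \<phi>_def abs_le_iff)
    have \<phi>g: "\<phi> n x * g x = \<phi> n x * (indicator {p..q + 2} x *\<^sub>R g x)" for n x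
      using \<phi>_supp[of x n] by (cases "x \<in> {p..q + 2}") simp_all
    have g_pq_meas: "(\<lambda>x. indicator {p<..q} x * g x) \<in> borel_measurable lborel"
    proof -
      have "(\<lambda>x. indicator {p<..q} x * g x) = (\<lambda>x. indicator {p<..q} x * (indicator {p..q + 2} x *\<^sub>R g x))"
        by (auto simp: fun_eq_iff indicator_def)
      then show ?thesis using g_meas by simp
    qed
    have "(\<lambda>n. LINT x|lborel. \<phi> n x * g x) \<longlonglongrightarrow> (LINT x|lborel. indicator {p<..q} x * g x)"
    proof (rule integral_dominated_convergence[where w="\<lambda>x. norm (indicator {p..q + 2} x *\<^sub>R g x)"])
      show "(\<lambda>x. \<phi> n x * g x) \<in> borel_measurable lborel" for n
        unfolding \<phi>g by (intro borel_measurable_times \<phi>_meas g_meas)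
      show "integrable lborel (\<lambda>x. norm (indicator {p..q + 2} x *\<^sub>R g x))"
        using g[of p "q + 2"] unfolding set_integrable_def by (rule integrable_norm)
      show "AE x in lborel. (\<lambda>n. \<phi> n x * g x) \<longlonglongrightarrow> indicator {p<..q} x * g x"
      proof (rule AE_I2)
        fix x
        have "(\<lambda>n. \<phi> n x) \<longlonglongrightarrow> indicator {0<..} (x - p) - indicator {0<..} (x - q)"
          unfolding \<phi>_def \<epsilon>_def by (intro tendsto_diff smooth_step_tendsto)
        moreover have "indicator {0<..} (x - p) - indicator {0<..} (x - q) = (indicator {p<..q} x :: real)"
          using pq(3) by (auto simp: indicator_def)
        ultimately show "(\<lambda>n. \<phi> n x * g x) \<longlonglongrightarrow> indicator {p<..q} x * g x"
          by (intro tendsto_mult) simp_all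
      qed
      show "AE x in lborel. norm (\<phi> n x * g x) \<le> norm (indicator {p..q + 2} x *\<^sub>R g x)" for n
      proof (rule AE_I2)
        fix x
        have "\<bar>\<phi> n x\<bar> * \<bar>indicator {p..q + 2} x *\<^sub>R g x\<bar> \<le> 1 * \<bar>indicator {p..q + 2} x *\<^sub>R g x\<bar>"
          by (rule mult_right_mono[OF \<phi>_bd]) simp
        then show "norm (\<phi> n x * g x) \<le> norm (indicator {p..q + 2} x *\<^sub>R g x)"
          unfolding \<phi>g real_norm_def abs_mult by simp
      qed
    qed (rule g_pq_meas)
    from tendsto_minus[OF this] have "(\<lambda>n. (LINT x|lborel. tent (\<epsilon> n) (x - p) * f x) - (LINT x|lborel. tent (\<epsilon> n) (x - q) * f x))
        \<longlonglongrightarrow> - (LINT x|lborel. indicator {p<..q} x * g x)" unfolding w .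
    from LIMSEQ_unique[OF this tendsto_diff[OF avg[OF pq(1)] avg[OF pq(2)]]]
    have "f q - f p = (LINT x|lborel. indicator {p<..q} x * g x)" by simp
    also have "\<dots> = (LINT x|lborel. indicator {p..q} x *\<^sub>R g x)"
    proof (rule integral_cong_AE)
      show "(\<lambda>x. indicator {p<..q} x * g x) \<in> borel_measurable lborel" by (rule g_pq_meas)
      show "(\<lambda>x. indicator {p..q} x *\<^sub>R g x) \<in> borel_measurable lborel"
        using g[of p q] unfolding set_integrable_def by (rule borel_measurable_integrable)
      show "AE x in lborel. indicator {p<..q} x * g x = indicator {p..q} x *\<^sub>R g x"
        using AE_lborel_singleton[of p] by eventually_elim (auto simp: indicator_def)
    qed
    also have "\<dots> = integral {p..q} g"
      using set_borel_integral_eq_integral(2)[OF g[of p q]] by (simp add: set_lebesgue_integral_def)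
    finally show "f q - f p = integral {p..q} g" .
  qed
qed

theorem weak_derivative_representative:
  assumes f: "\<And>a b. set_integrable lborel {a..b} f" and g: "\<And>a b. set_integrable lborel {a..b} g"
    and weak: "real_weak_derivative f g"
  obtains F where "AE x in lborel. f x = F x" "\<And>x y. x \<le> y \<Longrightarrow> F y - F x = integral {x..y} g"
proof -
  obtain N where N: "negligible N" "\<And>p q. p \<notin> N \<Longrightarrow> q \<notin> N \<Longrightarrow> p < q \<Longrightarrow> f q - f p = integral {p..q} g"
    using weak_derivative_increment[OF f g weak] by blast
  have "N \<noteq> UNIV" using N(1) non_negligible_UNIV by blast
  then obtain p where p: "p \<notin> N" by blast
  have gi: "g integrable_on {x..y}" for x y by (rule set_borel_integral_eq_integral(1)[OF g])
  define F where "F x = f p + (if p \<le> x then integral {p..x} g else - integral {x..p} g)" for x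
  have "f x = F x" if "x \<notin> N" for x
    using N(2)[OF p that] N(2)[OF that p] by (cases p x rule: linorder_cases) (auto simp: F_def)
  then have "{x. f x \<noteq> F x} \<subseteq> N" by blast
  then have "negligible {x. f x \<noteq> F x}" using negligible_subset[OF N(1)] by blast
  then have "AE x in lebesgue. f x = F x" by (simp add: AE_iff_null_sets negligible_iff_null_sets eventually_ae_filter) (metis (mono_tags, lifting) negligible_iff_null_sets order_refl)
  then have "AE x in lborel. f x = F x" by (simp add: AE_completion_iff)
  moreover have "F y - F x = integral {x..y} g" if "x \<le> y" for x y
  proof -
    consider "p \<le> x" | "x < p" "p \<le> y" | "y < p" by linarith
    then show ?thesis
    proof cases
      case 1
      then show ?thesis
        using that Henstock_Kurzweil_Integration.integral_combine[OF 1 that gi] by (simp add: F_def)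
    next
      case 2
      then show ?thesis
        using Henstock_Kurzweil_Integration.integral_combine[of x p y g] gi by (simp add: F_def)
    next
      case 3
      then show ?thesis
        using that Henstock_Kurzweil_Integration.integral_combine[of x y p g] gi by (simp add: F_def)
    qed
  qed
  ultimately show ?thesis using that by blast
qed

section \<open>Eigenfunctions of the dislocation problem are glued decaying solutions\<close>

definition real_square_integrable :: "(real \<Rightarrow> real) \<Rightarrow> bool" where
  "real_square_integrable f \<longleftrightarrow> f \<in> borel_measurable lborel \<and> integrable lborel (\<lambda>x. (f x)\<^sup>2)"

lemma set_integrable_of_square:
  assumes "real_square_integrable f" shows "set_integrable lborel {a..b} f"
  unfolding set_integrable_def
proof (rule Bochner_Integration.integrable_bound)
  have "set_integrable lborel {a..b} (\<lambda>x. (f x)\<^sup>2)"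
    using assms unfolding set_integrable_def real_square_integrable_def
    by (intro integrable_mult_indicator) auto
  moreover have "set_integrable lborel {a..b} (\<lambda>x::real. 1::real)"
    by (rule borel_integrable_atLeastAtMost'[OF continuous_on_const])
  ultimately have "set_integrable lborel {a..b} (\<lambda>x. 1 + (f x)\<^sup>2)" by (intro set_integral_add)
  then show "integrable lborel (\<lambda>x. indicator {a..b} x *\<^sub>R (1 + (f x)\<^sup>2))" by (simp add: set_integrable_def)
  have fm: "f \<in> borel_measurable lborel" using assms by (simp add: real_square_integrable_def)
  show "(\<lambda>x. indicator {a..b} x *\<^sub>R f x) \<in> borel_measurable lborel"
    by (intro borel_measurable_scaleR borel_measurable_indicator fm) simp
  have "\<bar>y\<bar> \<le> 1 + y\<^sup>2" for y :: real
  proof -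
    have "(\<bar>y\<bar> - 1)\<^sup>2 = 1 + y\<^sup>2 - 2 * \<bar>y\<bar>" by (simp add: power2_eq_square algebra_simps)
    then have "2 * \<bar>y\<bar> \<le> 1 + y\<^sup>2" using zero_le_power2[of "\<bar>y\<bar> - 1"] by linarith
    then show ?thesis by linarith
  qed
  then show "AE x in lborel. norm (indicator {a..b} x *\<^sub>R f x) \<le> norm (indicator {a..b} x *\<^sub>R (1 + (f x)\<^sup>2))"
    by (intro AE_I2) (auto simp: indicator_def)
qed

lemma test_function_support:
  assumes "test_function \<phi>"
  obtains K where "0 < K" "\<And>x. x \<notin> {-K..K} \<Longrightarrow> \<phi> x = 0" "\<And>x. x \<notin> {-K..K} \<Longrightarrow> deriv \<phi> x = 0"
proof -
  have D: "(\<phi> has_real_derivative deriv \<phi> x) (at x)" for x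
    using assms by (simp add: test_function_def C1_on_UNIV)
  have "bounded (closure {x. \<phi> x \<noteq> 0})"
    using assms by (intro compact_imp_bounded) (simp add: test_function_def)
  from bounded_subset_cbox_symmetric[OF this]
  obtain K where K: "closure {x. \<phi> x \<noteq> 0} \<subseteq> {-K..K}" by auto
  define L where "L = \<bar>K\<bar> + 1"
  have zero: "\<phi> x = 0" if "x \<notin> {-K..K}" for x using K closure_subset[of "{x. \<phi> x \<noteq> 0}"] that by blast
  show ?thesis
  proof (rule that[of L])
    show "0 < L" by (simp add: L_def)
    fix x assume x: "x \<notin> {-L..L}"
    then have xK: "x \<in> - {-K..K}" by (auto simp: L_def)
    then show "\<phi> x = 0" using zero by blast
    have "(\<phi> has_real_derivative 0) (at x)"
      by (rule has_field_derivative_transform_within_open[where f="\<lambda>_. 0" and S="- {-K..K}"])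
         (use xK zero in \<open>auto simp: open_Compl\<close>)
    then show "deriv \<phi> x = 0" using D DERIV_unique by blast
  qed
qed

lemma test_function_product:
  fixes f :: "real \<Rightarrow> real"
  assumes "test_function \<phi>" and f: "\<And>a b. set_integrable lborel {a..b} f"
  shows "integrable lborel (\<lambda>x. \<phi> x * f x)" "integrable lborel (\<lambda>x. deriv \<phi> x * f x)"
proof -
  obtain K where K: "0 < K" "\<And>x. x \<notin> {-K..K} \<Longrightarrow> \<phi> x = 0" "\<And>x. x \<notin> {-K..K} \<Longrightarrow> deriv \<phi> x = 0"
    by (rule test_function_support[OF assms(1)]) (rule that)
  have cont: "continuous_on UNIV \<phi>" "continuous_on UNIV (deriv \<phi>)"
    using assms(1) unfolding test_function_def C1_on_UNIV
    by (auto intro!: continuous_at_imp_continuous_on DERIV_isCont)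
  have prod: "integrable lborel (\<lambda>x. k x * f x)"
    if k: "continuous_on UNIV k" and supp: "\<And>x. x \<notin> {-K..K} \<Longrightarrow> k x = 0" for k :: "real \<Rightarrow> real"
  proof (rule LINT_supported(3))
    have "bounded (k ` {-K..K})"
      by (intro compact_imp_bounded compact_continuous_image continuous_on_subset[OF k]) auto
    then obtain B where "\<forall>x\<in>{-K..K}. \<bar>k x\<bar> \<le> B" by (auto simp: bounded_iff)
    then have B: "\<And>x. x \<in> {-K..K} \<Longrightarrow> \<bar>k x\<bar> \<le> B" by blast
    show "set_integrable lborel {-K..K} (\<lambda>x. k x * f x)"
      by (rule set_integrable_bounded_mult[OF _ B f]) (use borel_measurable_continuous_onI[OF k] in simp)
  qed (use supp in simp)
  show "integrable lborel (\<lambda>x. \<phi> x * f x)" by (rule prod[OF cont(1) K(2)])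
  show "integrable lborel (\<lambda>x. deriv \<phi> x * f x)" by (rule prod[OF cont(2) K(3)])
qed

lemma real_component:
  assumes T: "T = Re \<or> T = Im" and "H2_with_derivatives u u' u''"
  shows "real_square_integrable (\<lambda>x. T (u x))" "real_square_integrable (\<lambda>x. T (u' x))"
    "real_square_integrable (\<lambda>x. T (u'' x))"
    "real_weak_derivative (\<lambda>x. T (u x)) (\<lambda>x. T (u' x))"
    "real_weak_derivative (\<lambda>x. T (u' x)) (\<lambda>x. T (u'' x))"
proof -
  have bl: "bounded_linear T" using T bounded_linear_Re bounded_linear_Im by blast
  have Tle: "\<bar>T z\<bar> \<le> norm z" for z using T abs_Re_le_cmod abs_Im_le_cmod by metis
  have sq: "real_square_integrable (\<lambda>x. T (f x))" "real_square_integrable (\<lambda>x. norm (f x))"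
    if f: "square_integrable f" for f
  proof -
    have fm: "f \<in> borel_measurable lborel" and fi: "integrable lborel (\<lambda>x. (norm (f x))\<^sup>2)"
      using f by (simp_all add: square_integrable_def)
    have "continuous_on UNIV T" using linear_continuous_on[OF bl] .
    then have "T \<in> borel_measurable borel" by (rule borel_measurable_continuous_onI)
    then have Tm: "(\<lambda>x. T (f x)) \<in> borel_measurable lborel" using measurable_compose[OF fm] by simp
    have "integrable lborel (\<lambda>x. (T (f x))\<^sup>2)"
    proof (rule Bochner_Integration.integrable_bound[OF fi])
      show "(\<lambda>x. (T (f x))\<^sup>2) \<in> borel_measurable lborel" by (intro borel_measurable_power Tm)
      show "AE x in lborel. norm ((T (f x))\<^sup>2) \<le> norm ((norm (f x))\<^sup>2)"
        using power_mono[OF Tle abs_ge_zero, of _ 2] by (intro AE_I2) simp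
    qed
    then show "real_square_integrable (\<lambda>x. T (f x))" using Tm by (simp add: real_square_integrable_def)
    show "real_square_integrable (\<lambda>x. norm (f x))" using fm fi by (simp add: real_square_integrable_def)
  qed
  have wd: "real_weak_derivative (\<lambda>x. T (f x)) (\<lambda>x. T (g x))"
    if f: "square_integrable f" and g: "square_integrable g" and w: "weak_derivative f g" for f g
    unfolding real_weak_derivative_def
  proof (intro allI impI)
    fix \<phi> assume \<phi>: "test_function \<phi>"
    have D: "(\<phi> has_real_derivative deriv \<phi> x) (at x)" and cd: "continuous_on UNIV (deriv \<phi>)" for x
      using \<phi> by (simp_all add: test_function_def C1_on_UNIV)
    have m: "\<phi> \<in> borel_measurable lborel" "deriv \<phi> \<in> borel_measurable lborel"
    proof -
      have "continuous_on UNIV \<phi>"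
        by (rule continuous_at_imp_continuous_on, rule ballI, rule DERIV_isCont, rule D)
      from borel_measurable_continuous_onI[OF this] show "\<phi> \<in> borel_measurable lborel" by simp
      from borel_measurable_continuous_onI[OF cd] show "deriv \<phi> \<in> borel_measurable lborel" by simp
    qed
    have int: "integrable lborel (\<lambda>x. k x *\<^sub>R F x)"
      if "k \<in> borel_measurable lborel" "F \<in> borel_measurable lborel" "integrable lborel (\<lambda>x. k x * norm (F x))"
      for k :: "real \<Rightarrow> real" and F :: "real \<Rightarrow> complex"
      by (rule Bochner_Integration.integrable_bound[OF that(3)])
         (use that in \<open>auto simp: abs_mult intro!: borel_measurable_scaleR\<close>)
    have fm: "f \<in> borel_measurable lborel" "g \<in> borel_measurable lborel"
      using f g by (simp_all add: square_integrable_def)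
    have i1: "integrable lborel (\<lambda>x. deriv \<phi> x *\<^sub>R f x)"
      by (rule int[OF m(2) fm(1) test_function_product(2)[OF \<phi> set_integrable_of_square[OF sq(2)[OF f]]]])
    have i2: "integrable lborel (\<lambda>x. \<phi> x *\<^sub>R g x)"
      by (rule int[OF m(1) fm(2) test_function_product(1)[OF \<phi> set_integrable_of_square[OF sq(2)[OF g]]]])
    have Ts: "T (r *\<^sub>R z) = r * T z" for r z using T by auto
    have Tm: "T (- z) = - T z" for z using T by auto
    have "(LINT x|lborel. deriv \<phi> x * T (f x)) = T (LINT x|lborel. deriv \<phi> x *\<^sub>R f x)"
      unfolding Ts[symmetric] by (rule integral_bounded_linear[OF bl i1])
    also have "\<dots> = - T (LINT x|lborel. \<phi> x *\<^sub>R g x)"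
      using w \<phi> unfolding weak_derivative_def Tm[symmetric] by metis
    also have "T (LINT x|lborel. \<phi> x *\<^sub>R g x) = (LINT x|lborel. \<phi> x * T (g x))"
      unfolding Ts[symmetric] by (rule integral_bounded_linear[OF bl i2, symmetric])
    finally show "(LINT x|lborel. deriv \<phi> x * T (f x)) = - (LINT x|lborel. \<phi> x * T (g x))" .
  qed
  note H = assms(2)[unfolded H2_with_derivatives_def]
  show "real_square_integrable (\<lambda>x. T (u x))" "real_square_integrable (\<lambda>x. T (u' x))"
    "real_square_integrable (\<lambda>x. T (u'' x))"
    "real_weak_derivative (\<lambda>x. T (u x)) (\<lambda>x. T (u' x))"
    "real_weak_derivative (\<lambda>x. T (u' x)) (\<lambda>x. T (u'' x))"
    using H by (auto intro!: sq(1) wd)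
qed

lemma AE_lborel_negligible:
  assumes "AE x in lborel. Q (x::real)"
  obtains N where "negligible N" "\<And>x. x \<notin> N \<Longrightarrow> Q x"
proof -
  obtain N where N: "{x \<in> space lborel. \<not> Q x} \<subseteq> N" "N \<in> null_sets lborel"
    using assms by (auto simp: eventually_ae_filter)
  then have "negligible N" by (simp add: negligible_iff_null_sets null_sets_completionI)
  then show ?thesis using that[of N] N(1) by auto
qed

lemma integral_cong_AE_lborel:
  fixes f g :: "real \<Rightarrow> real"
  assumes "AE x in lborel. f x = g x"
  shows "integral S f = integral S g" "f integrable_on S \<longleftrightarrow> g integrable_on S"
proof -
  obtain N where N: "negligible N" "\<And>x. x \<notin> N \<Longrightarrow> f x = g x" using AE_lborel_negligible[OF assms] by blast
  show "integral S f = integral S g" by (rule integral_spike[OF N(1)]) (use N(2) in simp)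
  show "f integrable_on S \<longleftrightarrow> g integrable_on S"
    using integrable_spike[of f S N g] integrable_spike[of g S N f] N by auto
qed

lemma square_bound:
  assumes f: "real_square_integrable f" and F: "AE x in lborel. f x = F x"
  shows "(\<lambda>x. (F x)\<^sup>2) integrable_on {a..b}"
    "integral {a..b} (\<lambda>x. (F x)\<^sup>2) \<le> (LINT x|lborel. (f x)\<^sup>2)"
proof -
  have i: "integrable lborel (\<lambda>x. (f x)\<^sup>2)" using f by (simp add: real_square_integrable_def)
  then have si: "set_integrable lborel {a..b} (\<lambda>x. (f x)\<^sup>2)"
    unfolding set_integrable_def by (intro integrable_mult_indicator) auto
  have AE2: "AE x in lborel. (f x)\<^sup>2 = (F x)\<^sup>2" using F by eventually_elim simp
  show "(\<lambda>x. (F x)\<^sup>2) integrable_on {a..b}"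
    using set_borel_integral_eq_integral(1)[OF si] integral_cong_AE_lborel(2)[OF AE2] by simp
  have "integral {a..b} (\<lambda>x. (F x)\<^sup>2) = (LINT x|lborel. indicator {a..b} x *\<^sub>R (f x)\<^sup>2)"
    using set_borel_integral_eq_integral(2)[OF si] integral_cong_AE_lborel(1)[OF AE2]
    by (simp add: set_lebesgue_integral_def)
  also have "\<dots> \<le> (LINT x|lborel. (f x)\<^sup>2)"
    using si i unfolding set_integrable_def by (intro integral_mono) (auto simp: indicator_def)
  finally show "integral {a..b} (\<lambda>x. (F x)\<^sup>2) \<le> (LINT x|lborel. (f x)\<^sup>2)" .
qed

lemma C1_of_increment:
  fixes F g :: "real \<Rightarrow> real"
  assumes "continuous_on {0..r} g" "\<And>x. 0 \<le> x \<Longrightarrow> F x - F 0 = integral {0..x} g" "x \<in> {0..r}"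
  shows "(F has_real_derivative g x) (at x within {0..r})"
proof -
  have "((\<lambda>x. F 0 + integral {0..x} g) has_real_derivative g x) (at x within {0..r})"
    using DERIV_add[OF DERIV_const integral_has_real_derivative[OF assms(1,3)]] by simp
  moreover have "F y = F 0 + integral {0..y} g" if "y \<in> {0..r}" for y using assms(2)[of y] that by simp
  ultimately show ?thesis
    unfolding has_field_derivative_def by (rule has_derivative_transform[OF assms(3), rotated]) blast
qed

lemma periodic_bounded:
  fixes G :: "real \<Rightarrow> real"
  assumes "0 < d" "continuous_on UNIV G" and per: "\<And>x. G (x + d) = G x"
  obtains B where "0 < B" "\<And>x. 0 \<le> x \<Longrightarrow> \<bar>G x\<bar> \<le> B"
proof -
  have pern: "G (r + real n * d) = G r" for r n
  proof (induction n)
    case (Suc n)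
    have "r + real (Suc n) * d = (r + real n * d) + d" by (simp add: algebra_simps)
    then show ?case using per[of "r + real n * d"] Suc by (simp only:)
  qed simp
  have "bounded (G ` {0..d})"
    by (intro compact_imp_bounded compact_continuous_image continuous_on_subset[OF assms(2)]) auto
  then obtain B where "\<forall>x\<in>{0..d}. \<bar>G x\<bar> \<le> B" by (auto simp: bounded_iff)
  then have B: "\<And>x. x \<in> {0..d} \<Longrightarrow> \<bar>G x\<bar> \<le> B" by blast
  have "\<bar>G x\<bar> \<le> \<bar>B\<bar> + 1" if "0 \<le> x" for x
  proof -
    define n where "n = nat \<lfloor>x / d\<rfloor>"
    have "real n = of_int \<lfloor>x / d\<rfloor>" using that assms(1) by (simp add: n_def)
    then have "real n \<le> x / d" "x / d < real n + 1" by linarith+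
    then have "x - real n * d \<in> {0..d}" using assms(1) by (simp add: field_simps)
    from B[OF this] show ?thesis using pern[of "x - real n * d" n] by simp
  qed
  then show ?thesis by (intro that[of "\<bar>B\<bar> + 1"]) auto
qed

context even_periodic
begin

lemma exponential_decay:
  assumes "a < E" "E < b"
  obtains C \<kappa> where "0 < C" "0 < \<kappa>"
    "\<And>x. 0 \<le> x \<Longrightarrow> \<bar>psi E x\<bar> \<le> C * exp (- \<kappa> * x) \<and> \<bar>psi' E x\<bar> \<le> C * exp (- \<kappa> * x)"
proof -
  define m where "m = - multiplier E"
  have m: "0 < m" "m < 1" using multiplier(1,2)[OF assms(1,2)] by (simp_all add: m_def)
  \<comment> \<open>With this rate, \<open>|psi x| exp (\<kappa> x)\<close> is periodic, hence bounded.\<close>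
  define \<kappa> where "\<kappa> = - ln m / d"
  have "\<kappa> > 0" using m d_pos by (simp add: \<kappa>_def divide_neg_pos)
  have md: "m * exp (\<kappa> * d) = 1"
  proof -
    have "exp (\<kappa> * d) = exp (- ln m)" using d_pos by (simp add: \<kappa>_def)
    then show ?thesis using m by (simp add: exp_minus)
  qed
  have decay: "\<exists>B>0. \<forall>x\<ge>0. \<bar>f x\<bar> \<le> B * exp (- \<kappa> * x)"
    if f: "continuous_on UNIV f" "\<And>x. f (x + d) = multiplier E * f x" for f
  proof -
    define G where "G x = \<bar>f x\<bar> * exp (\<kappa> * x)" for x
    have per: "G (x + d) = G x" for x
    proof -
      have "G (x + d) = \<bar>f x\<bar> * (m * exp (\<kappa> * d)) * exp (\<kappa> * x)"
        using m unfolding G_def f(2) by (simp add: abs_mult m_def distrib_left exp_add)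
      then show ?thesis by (simp add: md G_def)
    qed
    have "continuous_on UNIV G" unfolding G_def[abs_def] by (intro continuous_intros f(1))
    then obtain B where B: "0 < B" "\<And>x. 0 \<le> x \<Longrightarrow> \<bar>G x\<bar> \<le> B"
      using periodic_bounded[where G=G, OF d_pos _ per] by metis
    have "\<bar>f x\<bar> \<le> B * exp (- \<kappa> * x)" if "0 \<le> x" for x
    proof -
      have "\<bar>f x\<bar> = G x * exp (- \<kappa> * x)" by (simp add: G_def mult.assoc exp_add[symmetric])
      also have "\<dots> \<le> B * exp (- \<kappa> * x)" using B(2)[OF that] by (intro mult_right_mono) auto
      finally show ?thesis .
    qed
    then show ?thesis using B(1) by blast
  qed
  obtain B1 where B1: "B1 > 0" "\<And>x. x \<ge> 0 \<Longrightarrow> \<bar>psi E x\<bar> \<le> B1 * exp (- \<kappa> * x)"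
    using decay[OF solves_continuous(1)[OF solves_psi] multiplier(3)[OF assms(1,2)]] by blast
  obtain B2 where B2: "B2 > 0" "\<And>x. x \<ge> 0 \<Longrightarrow> \<bar>psi' E x\<bar> \<le> B2 * exp (- \<kappa> * x)"
    using decay[OF solves_continuous(2)[OF solves_psi] multiplier(4)[OF assms(1,2)]] by blast
  show ?thesis
  proof (rule that[of "B1 + B2" \<kappa>])
    fix x :: real assume "0 \<le> x"
    have "B1 * exp (- \<kappa> * x) \<le> (B1 + B2) * exp (- \<kappa> * x)" "B2 * exp (- \<kappa> * x) \<le> (B1 + B2) * exp (- \<kappa> * x)"
      using B1 B2 by (auto intro!: mult_right_mono)
    then show "\<bar>psi E x\<bar> \<le> (B1 + B2) * exp (- \<kappa> * x) \<and> \<bar>psi' E x\<bar> \<le> (B1 + B2) * exp (- \<kappa> * x)"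
      using B1(2)[OF \<open>0 \<le> x\<close>] B2(2)[OF \<open>0 \<le> x\<close>] by linarith
  qed (use B1 B2 \<open>\<kappa> > 0\<close> in auto)
qed

text \<open>
  The Wronskian \<open>w\<close> of \<open>F\<close> with \<open>psi (x + t)\<close> is constant, and since \<open>psi\<close> and \<open>psi'\<close> are bounded,
  \<open>w\<^sup>2\<close> is dominated by the integrable function \<open>F\<^sup>2 + F1\<^sup>2\<close>. On an infinite interval this forces \<open>w = 0\<close>.
\<close>
lemma half_line_solution:
  assumes gap: "a < E" "E < b" "0 \<le> t"
    and inc: "\<And>x. 0 \<le> x \<Longrightarrow> F x - F 0 = integral {0..x} F1"
      "\<And>x. 0 \<le> x \<Longrightarrow> F1 x - F1 0 = integral {0..x} (\<lambda>x. (V (x + t) - E) * F x)"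
    and cont: "\<And>r. continuous_on {0..r} F" "\<And>r. continuous_on {0..r} F1"
    and L2: "\<And>r. (\<lambda>x. (F x)\<^sup>2) integrable_on {0..r}" "\<And>r. (\<lambda>x. (F1 x)\<^sup>2) integrable_on {0..r}"
      "\<And>r. integral {0..r} (\<lambda>x. (F x)\<^sup>2) \<le> B" "\<And>r. integral {0..r} (\<lambda>x. (F1 x)\<^sup>2) \<le> B"
  shows "F 0 * psi' E t - F1 0 * psi E t = 0"
    and "F 0 = 0 \<Longrightarrow> F1 0 = 0 \<Longrightarrow> 0 \<le> x \<Longrightarrow> F x = 0"
proof -
  have contV: "continuous_on X (\<lambda>x. V (x + t))" for X
    by (rule continuous_on_compose2[OF cont_V]) (auto intro!: continuous_intros)
  have D: "(F has_real_derivative F1 x) (at x within {0..r})" if "x \<in> {0..r}" for x r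
    by (rule C1_of_increment[OF cont(2) inc(1) that])
  have D1: "(F1 has_real_derivative (V (x + t) - E) * F x) (at x within {0..r})" if "x \<in> {0..r}" for x r
    by (rule C1_of_increment[OF _ inc(2) that]) (intro continuous_intros contV cont(1))
  define w where "w x = F x * psi' E (x + t) - F1 x * psi E (x + t)" for x
  have sol: "solves (\<lambda>x. V (x + t) - E) (\<lambda>x. psi E (x + t)) (\<lambda>x. psi' E (x + t))"
    by (rule solves_shift[OF solves_psi])
  have Dpsi: "((\<lambda>x. psi E (x + t)) has_real_derivative psi' E (x + t)) (at x within S)"
    "((\<lambda>x. psi' E (x + t)) has_real_derivative (V (x + t) - E) * psi E (x + t)) (at x within S)" for x S
    using sol unfolding solves_def by (blast intro: has_field_derivative_at_within)+
  have wconst: "w x = w 0" if "0 \<le> x" for x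
  proof -
    have "(w has_real_derivative 0) (at y within {0..x})" if "y \<in> {0..x}" for y
    proof -
      have "(w has_real_derivative (F1 y * psi' E (y + t) + ((V (y + t) - E) * psi E (y + t)) * F y)
          - (((V (y + t) - E) * F y) * psi E (y + t) + psi' E (y + t) * F1 y)) (at y within {0..x})"
        unfolding w_def[abs_def] by (intro DERIV_diff DERIV_mult D D1 Dpsi that)
      then show ?thesis by (simp add: algebra_simps)
    qed
    then obtain k where "\<And>y. y \<in> {0..x} \<Longrightarrow> w y = k"
      using has_field_derivative_zero_constant[OF convex_closed_interval] by metis
    then show ?thesis using that by simp
  qed
  obtain C \<kappa> where C: "0 < C" "0 < \<kappa>"
    "\<And>x. 0 \<le> x \<Longrightarrow> \<bar>psi E x\<bar> \<le> C * exp (- \<kappa> * x) \<and> \<bar>psi' E x\<bar> \<le> C * exp (- \<kappa> * x)"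
    by (rule exponential_decay[OF gap(1,2)]) (rule that)
  have bound: "\<bar>psi E (x + t)\<bar> \<le> C" "\<bar>psi' E (x + t)\<bar> \<le> C" if "0 \<le> x" for x
  proof -
    have "C * exp (- \<kappa> * (x + t)) \<le> C * 1" using C that gap(3) by (intro mult_left_mono) auto
    then show "\<bar>psi E (x + t)\<bar> \<le> C" "\<bar>psi' E (x + t)\<bar> \<le> C" using C(3)[of "x + t"] that gap(3) by auto
  qed
  have w2: "(w x)\<^sup>2 \<le> 2 * C\<^sup>2 * ((F x)\<^sup>2 + (F1 x)\<^sup>2)" if "0 \<le> x" for x
  proof -
    have "(A - B)\<^sup>2 \<le> 2 * (A\<^sup>2 + B\<^sup>2)" for A B :: real
      using zero_le_power2[of "A + B"] by (simp add: power2_eq_square algebra_simps)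
    then have "(w x)\<^sup>2 \<le> 2 * ((F x * psi' E (x + t))\<^sup>2 + (F1 x * psi E (x + t))\<^sup>2)"
      unfolding w_def .
    also have "\<dots> = 2 * ((F x)\<^sup>2 * (psi' E (x + t))\<^sup>2 + (F1 x)\<^sup>2 * (psi E (x + t))\<^sup>2)"
      by (simp only: power_mult_distrib)
    also have "\<dots> \<le> 2 * ((F x)\<^sup>2 * C\<^sup>2 + (F1 x)\<^sup>2 * C\<^sup>2)"
    proof -
      have "(psi' E (x + t))\<^sup>2 \<le> C\<^sup>2" "(psi E (x + t))\<^sup>2 \<le> C\<^sup>2"
        using bound[OF that] by (metis abs_ge_zero power2_abs power_mono)+
      then show ?thesis by (intro mult_left_mono add_mono) auto
    qed
    also have "\<dots> = 2 * C\<^sup>2 * ((F x)\<^sup>2 + (F1 x)\<^sup>2)" by (simp add: algebra_simps)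
    finally show ?thesis .
  qed
  have "w 0 = 0"
  proof (rule ccontr)
    assume "w 0 \<noteq> 0"
    have le: "(w 0)\<^sup>2 * r \<le> 2 * C\<^sup>2 * (B + B)" if "r > 0" for r
    proof -
      have "(w 0)\<^sup>2 * r = integral {0..r} (\<lambda>x. (w 0)\<^sup>2)" using that by simp
      also have "\<dots> \<le> integral {0..r} (\<lambda>x. 2 * C\<^sup>2 * ((F x)\<^sup>2 + (F1 x)\<^sup>2))"
      proof (rule integral_le)
        show "(\<lambda>x. 2 * C\<^sup>2 * ((F x)\<^sup>2 + (F1 x)\<^sup>2)) integrable_on {0..r}"
          by (intro integrable_on_mult_right integrable_add L2)
        show "(w 0)\<^sup>2 \<le> 2 * C\<^sup>2 * ((F x)\<^sup>2 + (F1 x)\<^sup>2)" if "x \<in> {0..r}" for x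
          using w2[of x] wconst[of x] that by simp
      qed auto
      also have "\<dots> = 2 * C\<^sup>2 * (integral {0..r} (\<lambda>x. (F x)\<^sup>2) + integral {0..r} (\<lambda>x. (F1 x)\<^sup>2))"
        by (simp only: integral_mult_right Henstock_Kurzweil_Integration.integral_add[OF L2(1,2)])
      also have "\<dots> \<le> 2 * C\<^sup>2 * (B + B)" using L2(3,4) by (intro mult_left_mono add_mono) auto
      finally show ?thesis .
    qed
    \<comment> \<open>An interval too long for the bound just obtained.\<close>
    define r where "r = (2 * C\<^sup>2 * \<bar>B + B\<bar> + 1) / (w 0)\<^sup>2"
    have "r > 0" unfolding r_def using \<open>w 0 \<noteq> 0\<close> by (intro divide_pos_pos add_nonneg_pos) auto
    have "(w 0)\<^sup>2 * r = 2 * C\<^sup>2 * \<bar>B + B\<bar> + 1" using \<open>w 0 \<noteq> 0\<close> by (simp add: r_def)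
    moreover have "2 * C\<^sup>2 * (B + B) \<le> 2 * C\<^sup>2 * \<bar>B + B\<bar>" by (intro mult_left_mono) auto
    ultimately show False using le[OF \<open>r > 0\<close>] by linarith
  qed
  then show "F 0 * psi' E t - F1 0 * psi E t = 0" by (simp add: w_def)
  assume z: "F 0 = 0" "F1 0 = 0" "0 \<le> x"
  interpret T: potential "\<lambda>x. V (x + t)" by unfold_locales (rule contV)
  have "F x = F 0 * T.c E x + F1 0 * T.s E x"
    by (rule T.expand_on(1)[of "{0..x}"]) (use z D D1 in auto)
  then show "F x = 0" using z by simp
qed

lemma dislocation_even: "dislocation_potential V t (- x) = dislocation_potential V t x"
  using even_V[of "x - t"] even_V[of "x + t"] by (auto simp: dislocation_potential_def)

text \<open>
  The dislocated potential is even, so \<open>half_line_solution\<close> applies to \<open>F\<close> and to its mirror image. The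
  two relations at \<open>0\<close> differ in one sign only and force \<open>F\<close> and its derivative to vanish at \<open>0\<close>.
\<close>
lemma real_weak_solution_zero:
  assumes gap: "a < E" "E < b" "0 \<le> t" and nz: "psi E t \<noteq> 0" "psi' E t \<noteq> 0"
    and sq: "real_square_integrable f" "real_square_integrable f1" "real_square_integrable f2"
    and weak: "real_weak_derivative f f1" "real_weak_derivative f1 f2"
    and eq: "AE x in lborel. - f2 x + dislocation_potential V t x * f x = E * f x"
  shows "AE x in lborel. f x = 0"
proof -
  let ?Q = "dislocation_potential V t"
  obtain F where F: "AE x in lborel. f x = F x" "\<And>x y. x \<le> y \<Longrightarrow> F y - F x = integral {x..y} f1"
    using weak_derivative_representative[OF set_integrable_of_square[OF sq(1)] set_integrable_of_square[OF sq(2)] weak(1)] by blast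
  obtain F1 where F1: "AE x in lborel. f1 x = F1 x" "\<And>x y. x \<le> y \<Longrightarrow> F1 y - F1 x = integral {x..y} f2"
    using weak_derivative_representative[OF set_integrable_of_square[OF sq(2)] set_integrable_of_square[OF sq(3)] weak(2)] by blast
  have eq2: "AE x in lborel. f2 x = (?Q x - E) * F x"
    using eq F(1) by eventually_elim (simp add: algebra_simps)
  have incF: "F y - F x = integral {x..y} F1" if "x \<le> y" for x y
    using F(2)[OF that] integral_cong_AE_lborel(1)[OF F1(1)] by simp
  have incF1: "F1 y - F1 x = integral {x..y} (\<lambda>x. (?Q x - E) * F x)" if "x \<le> y" for x y
    using F1(2)[OF that] integral_cong_AE_lborel(1)[OF eq2] by simp
  have cont: "continuous_on {x..y} F" "continuous_on {x..y} F1" for x y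
  proof -
    have *: "continuous_on {x..y} G" if "\<And>u v. u \<le> v \<Longrightarrow> G v - G u = integral {u..v} g"
        "real_square_integrable g" for G g
    proof -
      have "continuous_on {x..y} (\<lambda>v. G x + integral {x..v} g)"
        by (intro continuous_on_add continuous_on_const indefinite_integral_continuous_1
            set_borel_integral_eq_integral(1) set_integrable_of_square that(2))
      moreover have "G x + integral {x..v} g = G v" if "v \<in> {x..y}" for v
        using \<open>\<And>u v. u \<le> v \<Longrightarrow> G v - G u = integral {u..v} g\<close>[of x v] that by simp
      ultimately show ?thesis by (rule continuous_on_eq)
    qed
    show "continuous_on {x..y} F" by (rule *[OF F(2) sq(2)])
    show "continuous_on {x..y} F1" by (rule *[OF F1(2) sq(3)])
  qed
  define B where "B = max (LINT x|lborel. (f x)\<^sup>2) (LINT x|lborel. (f1 x)\<^sup>2)"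
  have L2: "(\<lambda>x. (F x)\<^sup>2) integrable_on {x..y}" "(\<lambda>x. (F1 x)\<^sup>2) integrable_on {x..y}"
    "integral {x..y} (\<lambda>x. (F x)\<^sup>2) \<le> B" "integral {x..y} (\<lambda>x. (F1 x)\<^sup>2) \<le> B" for x y
    using square_bound[OF sq(1) F(1), of x y] square_bound[OF sq(2) F1(1), of x y] by (auto simp: B_def)
  have incF1r: "F1 x - F1 0 = integral {0..x} (\<lambda>x. (V (x + t) - E) * F x)" if "0 \<le> x" for x
    unfolding incF1[OF that] by (rule integral_cong) (simp add: dislocation_potential_def)
  note right = half_line_solution[OF gap incF incF1r cont L2]
  define G G1 where "G x = F (- x)" and "G1 x = - F1 (- x)" for x
  have mirror: "integral {0..x} (\<lambda>y. k (- y)) = integral {- x..0} k" for x and k :: "real \<Rightarrow> real"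
    using Henstock_Kurzweil_Integration.integral_reflect_real[of 0 "- x" k] by simp
  have mirror_i: "(\<lambda>y. k (- y)) integrable_on {0..x}" if "k integrable_on {- x..0}" for x and k :: "real \<Rightarrow> real"
    using that Henstock_Kurzweil_Integration.integrable_reflect_real[of k 0 "- x"] by simp
  have incG: "G x - G 0 = integral {0..x} G1" if "0 \<le> x" for x
  proof -
    have "integral {0..x} G1 = - integral {0..x} (\<lambda>y. F1 (- y))" unfolding G1_def by (rule integral_neg)
    also have "\<dots> = - (F 0 - F (- x))" using incF[of "- x" 0] that by (simp add: mirror)
    finally show ?thesis by (simp add: G_def)
  qed
  have incG1: "G1 x - G1 0 = integral {0..x} (\<lambda>x. (V (x + t) - E) * G x)" if "0 \<le> x" for x
  proof -
    have "integral {0..x} (\<lambda>x. (V (x + t) - E) * G x) = integral {0..x} (\<lambda>y. (?Q (- y) - E) * F (- y))"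
      by (rule integral_cong) (simp add: G_def dislocation_even, simp add: dislocation_potential_def)
    also have "\<dots> = F1 0 - F1 (- x)"
      using incF1[of "- x" 0] that mirror[of x "\<lambda>x. (?Q x - E) * F x"] by simp
    finally show ?thesis by (simp add: G1_def)
  qed
  have contG: "continuous_on {0..r} G" "continuous_on {0..r} G1" for r
    unfolding G_def[abs_def] G1_def[abs_def]
    by (auto intro!: continuous_on_minus continuous_on_compose2[OF cont(1)[of "- r" 0]]
        continuous_on_compose2[OF cont(2)[of "- r" 0]] continuous_on_id)
  have L2G: "(\<lambda>x. (G x)\<^sup>2) integrable_on {0..r}" "(\<lambda>x. (G1 x)\<^sup>2) integrable_on {0..r}"
    "integral {0..r} (\<lambda>x. (G x)\<^sup>2) \<le> B" "integral {0..r} (\<lambda>x. (G1 x)\<^sup>2) \<le> B" for r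
    unfolding G_def G1_def power2_minus
    using mirror_i[OF L2(1)] mirror_i[OF L2(2)] L2(3,4) mirror[of r "\<lambda>x. (F x)\<^sup>2"] mirror[of r "\<lambda>x. (F1 x)\<^sup>2"] by simp_all
  note left = half_line_solution[OF gap incG incG1 contG L2G]
  have "F 0 * psi' E t - F1 0 * psi E t = 0" by (rule right(1)) simp_all
  moreover have "F 0 * psi' E t + F1 0 * psi E t = 0" using left(1) by (simp add: G_def G1_def)
  ultimately have "F 0 * psi' E t = 0" "F1 0 * psi E t = 0" by linarith+
  then have F0: "F 0 = 0" "F1 0 = 0" using nz unfolding mult_eq_0_iff by blast+
  have "F x = 0" for x
  proof (cases "0 \<le> x")
    case True
    then show ?thesis using right(2)[of x] F0 by simp
  next
    case False
    then have "G (- x) = 0" using left(2)[of "- x"] F0 by (simp add: G_def G1_def)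
    then show ?thesis by (simp add: G_def)
  qed
  then show ?thesis using F(1) by simp
qed

theorem eigenvalue_imp_boundary:
  assumes gap: "a < E" "E < b" "0 \<le> t" and eig: "schroedinger_eigenvalue (dislocation_potential V t) E"
  shows "psi E t = 0 \<or> psi' E t = 0"
proof (rule ccontr)
  assume nz: "\<not> ?thesis"
  obtain u u' u'' where u: "H2_with_derivatives u u' u''" "\<not> (AE x in lborel. u x = 0)"
    and eq: "AE x in lborel. - u'' x + of_real (dislocation_potential V t x) * u x = of_real E * u x"
    using eig unfolding schroedinger_eigenvalue_def by blast
  have "AE x in lborel. T (u x) = 0" if T: "T = Re \<or> T = Im" for T
  proof (rule real_weak_solution_zero[OF gap _ _ real_component[OF T u(1)]])
    show "AE x in lborel. - T (u'' x) + dislocation_potential V t x * T (u x) = E * T (u x)"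
      using eq
    proof eventually_elim
      case (elim x)
      have "T (- u'' x + of_real (dislocation_potential V t x) * u x) = T (of_real E * u x)"
        by (simp only: elim)
      then show ?case using T by auto
    qed
  qed (use nz in auto)
  from this[of Re] this[of Im] have "AE x in lborel. Re (u x) = 0 \<and> Im (u x) = 0" by simp
  then have "AE x in lborel. u x = 0" by eventually_elim (simp add: complex_eq_iff)
  then show False using u(2) by simp
qed

end

section \<open>Glued decaying solutions are eigenfunctions\<close>

lemma integrable_exp_abs:
  assumes "0 < k" shows "integrable lborel (\<lambda>x::real. exp (- k * \<bar>x\<bar>))"
proof -
  have m: "(\<lambda>x::real. indicator {0..} x *\<^sub>R exp (- k * x)) \<in> borel_measurable lborel" by measurable
  have "(\<lambda>x::real. exp (- k * x)) integrable_on {0..}"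
    using has_integral_exp_minus_to_infinity[OF assms, of 0] by blast
  then have "(\<lambda>x::real. exp (- k * x)) absolutely_integrable_on {0..}"
    by (rule nonnegative_absolutely_integrable_1) simp
  then have i: "integrable lborel (\<lambda>x::real. indicator {0..} x *\<^sub>R exp (- k * x))"
    unfolding set_integrable_def using integrable_completion[OF m] by simp
  from lborel_integrable_real_affine[OF this, of "- 1" 0]
  have i': "integrable lborel (\<lambda>x::real. indicator {0..} (- x) *\<^sub>R exp (- k * (- x)))" by simp
  show ?thesis
  proof (rule Bochner_Integration.integrable_bound[OF Bochner_Integration.integrable_add[OF i i']])
    show "AE x in lborel. norm (exp (- k * \<bar>x\<bar>)) \<le> norm (indicator {0..} x *\<^sub>R exp (- k * x) +
        indicator {0..} (- x) *\<^sub>R exp (- k * (- x)) :: real)"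
      by (intro AE_I2) (auto simp: indicator_def)
  qed measurable
qed

lemma square_integrable_of_decay:
  assumes "f \<in> borel_measurable lborel" "0 < k" "\<And>x. \<bar>f x\<bar> \<le> C * exp (- k * \<bar>x\<bar>)"
  shows "square_integrable (\<lambda>x. complex_of_real (f x))"
  unfolding square_integrable_def
proof
  show "(\<lambda>x. complex_of_real (f x)) \<in> borel_measurable lborel" using assms(1) by measurable
  have "integrable lborel (\<lambda>x. C\<^sup>2 * exp (- (2 * k) * \<bar>x\<bar>))"
    by (intro integrable_mult_right integrable_exp_abs) (use assms in simp)
  then show "integrable lborel (\<lambda>x. (norm (complex_of_real (f x)))\<^sup>2)"
  proof (rule Bochner_Integration.integrable_bound)
    show "(\<lambda>x. (norm (complex_of_real (f x)))\<^sup>2) \<in> borel_measurable lborel" using assms(1) by measurable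
    have "\<bar>f x\<bar>\<^sup>2 \<le> C\<^sup>2 * exp (- (2 * k) * \<bar>x\<bar>)" for x
    proof -
      have "\<bar>f x\<bar>\<^sup>2 \<le> (C * exp (- k * \<bar>x\<bar>))\<^sup>2" by (intro power_mono assms) simp
      also have "\<dots> = C\<^sup>2 * exp (- (2 * k) * \<bar>x\<bar>)"
        by (simp add: power_mult_distrib exp_double[symmetric] mult_ac)
      finally show ?thesis .
    qed
    then show "AE x in lborel. norm ((norm (complex_of_real (f x)))\<^sup>2) \<le> norm (C\<^sup>2 * exp (- (2 * k) * \<bar>x\<bar>))"
      by (intro AE_I2) (simp add: abs_mult)
  qed
qed

lemma weak_derivative_of_C1:
  fixes f g :: "real \<Rightarrow> real"
  assumes f: "continuous_on UNIV f" "\<And>x. x \<noteq> 0 \<Longrightarrow> (f has_real_derivative g x) (at x)"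
    and g: "\<And>a b. set_integrable lborel {a..b} g"
  shows "weak_derivative (\<lambda>x. complex_of_real (f x)) (\<lambda>x. complex_of_real (g x))"
  unfolding weak_derivative_def
proof (intro allI impI)
  fix \<phi> assume \<phi>: "test_function \<phi>"
  have D: "(\<phi> has_real_derivative deriv \<phi> x) (at x)" for x
    using \<phi> by (simp add: test_function_def C1_on_UNIV)
  obtain K where K: "0 < K" "\<And>x. x \<notin> {-K..K} \<Longrightarrow> \<phi> x = 0" "\<And>x. x \<notin> {-K..K} \<Longrightarrow> deriv \<phi> x = 0"
    by (rule test_function_support[OF \<phi>]) (rule that)
  define L where "L = K + 1"
  have fi: "set_integrable lborel {a..b} f" for a b
    by (rule borel_integrable_atLeastAtMost'[OF continuous_on_subset[OF f(1)]]) simp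
  note i1 = test_function_product(2)[OF \<phi> fi] and i2 = test_function_product(1)[OF \<phi> g]
  have i12: "integrable lborel (\<lambda>x. deriv \<phi> x * f x + \<phi> x * g x)"
    by (rule Bochner_Integration.integrable_add[OF i1 i2])
  have "((\<lambda>x. deriv \<phi> x * f x + \<phi> x * g x) has_integral \<phi> L * f L - \<phi> (- L) * f (- L)) {-L..L}"
  proof (rule fundamental_theorem_of_calculus_interior_strong[where S="{0}"])
    show "continuous_on {-L..L} (\<lambda>x. \<phi> x * f x)"
      by (intro continuous_on_mult continuous_on_subset[OF f(1)] continuous_at_imp_continuous_on ballI
          DERIV_isCont[OF D]) simp
    fix x assume "x \<in> {-L<..<L} - {0}"
    then have "((\<lambda>x. \<phi> x * f x) has_real_derivative deriv \<phi> x * f x + g x * \<phi> x) (at x)"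
      by (intro DERIV_mult D f(2)) simp
    then show "((\<lambda>x. \<phi> x * f x) has_vector_derivative deriv \<phi> x * f x + \<phi> x * g x) (at x)"
      by (simp add: has_real_derivative_iff_has_vector_derivative mult.commute)
  qed (use K(1) in \<open>auto simp: L_def\<close>)
  moreover have "\<phi> L = 0" "\<phi> (- L) = 0" using K(1) by (auto intro!: K(2) simp: L_def)
  ultimately have z: "integral {-L..L} (\<lambda>x. deriv \<phi> x * f x + \<phi> x * g x) = 0" by (simp add: integral_unique)
  have "(LINT x|lborel. deriv \<phi> x * f x + \<phi> x * g x) = integral {-L..L} (\<lambda>x. deriv \<phi> x * f x + \<phi> x * g x)"
  proof (rule LINT_supported(1))
    show "set_integrable lborel {-L..L} (\<lambda>x. deriv \<phi> x * f x + \<phi> x * g x)"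
      unfolding set_integrable_def by (rule integrable_mult_indicator[OF _ i12]) simp
    fix x assume "x \<notin> {-L..L}"
    then have "x \<notin> {-K..K}" by (auto simp: L_def)
    then show "deriv \<phi> x * f x + \<phi> x * g x = 0" using K(2,3) by simp
  qed
  then have "(LINT x|lborel. deriv \<phi> x * f x) + (LINT x|lborel. \<phi> x * g x) = 0"
    using Bochner_Integration.integral_add[OF i1 i2] z by simp
  then have "complex_of_real (LINT x|lborel. deriv \<phi> x * f x) = - complex_of_real (LINT x|lborel. \<phi> x * g x)"
    by (simp add: eq_neg_iff_add_eq_0 of_real_add[symmetric] del: of_real_add)
  then show "(LINT x|lborel. deriv \<phi> x *\<^sub>R complex_of_real (f x)) = - (LINT x|lborel. \<phi> x *\<^sub>R complex_of_real (g x))"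
    unfolding integral_complex_of_real[symmetric] by (simp add: scaleR_conv_of_real)
qed

context even_periodic
begin

lemma V_bounded_global: obtains M where "0 < M" "\<And>x. \<bar>V x\<bar> \<le> M"
proof -
  obtain M where M: "0 < M" "\<And>x. 0 \<le> x \<Longrightarrow> \<bar>V x\<bar> \<le> M"
    by (rule periodic_bounded[OF d_pos cont_V periodic_V]) (rule that)
  have "\<bar>V x\<bar> \<le> M" for x
    using M(2)[of "\<bar>x\<bar>"] even_V[of x] by (cases "0 \<le> x") auto
  then show ?thesis using that M(1) by blast
qed

text \<open>
  The eigenfunction is \<open>psi (|x| + t)\<close>, with a sign \<open>\<sigma>\<close> on the left: even if \<open>psi' t = 0\<close>, odd if
  \<open>psi t = 0\<close>. This is exactly what makes it and its derivative continuous at \<open>0\<close>; the second derivative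
  may jump there.
\<close>
theorem boundary_imp_eigenvalue:
  assumes gap: "a < E" "E < b" "0 \<le> t" and bd: "psi E t = 0 \<or> psi' E t = 0"
  shows "schroedinger_eigenvalue (dislocation_potential V t) E"
proof -
  let ?Q = "dislocation_potential V t"
  define y y' where "y = psi E" and "y' = psi' E"
  have bd': "y t = 0 \<or> y' t = 0" using bd by (simp only: y_def y'_def)
  obtain \<sigma> :: real where \<sigma>: "\<bar>\<sigma>\<bar> = 1" "\<sigma> * y t = y t" "- \<sigma> * y' t = y' t"
  proof (cases "y t = 0")
    case True
    then show ?thesis by (intro that[of "- 1"]) auto
  next
    case False
    then show ?thesis using bd' by (intro that[of 1]) auto
  qed
  define f where "f x = (if x \<le> 0 then \<sigma> * y (t - x) else y (x + t))" for x
  define f1 where "f1 x = (if x \<le> 0 then - \<sigma> * y' (t - x) else y' (x + t))" for x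
  define f2 where "f2 x = (?Q x - E) * f x" for x
  have cp: "continuous_on UNIV y" "continuous_on UNIV y'"
    by (rule solves_continuous[OF solves_psi, of _ E, folded y_def y'_def])+
  have cont: "continuous_on UNIV f" "continuous_on UNIV f1"
    unfolding f_def[abs_def] f1_def[abs_def] using \<sigma>(2,3)
    by (intro continuous_on_cases_le continuous_on_mult_left continuous_on_compose2[OF cp(1)]
        continuous_on_compose2[OF cp(2)] continuous_intros; simp)+
  have Dm: "((\<lambda>x. t - x) has_real_derivative - 1) (at x)" and Dp: "((\<lambda>x. x + t) has_real_derivative 1) (at x)" for x
    by (auto intro!: derivative_eq_intros)
  have Dpsi: "(y has_real_derivative y' x) (at x)" "(y' has_real_derivative (V x - E) * y x) (at x)" for x
    using solves_psi[of E, folded y_def y'_def] by (simp_all add: solves_def)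
  have Df: "(f has_real_derivative f1 x) (at x)" "(f1 has_real_derivative f2 x) (at x)" if "x \<noteq> 0" for x
  proof -
    have "(f has_real_derivative f1 x) (at x) \<and> (f1 has_real_derivative f2 x) (at x)"
    proof (cases "x < 0")
      case True
      have V: "V (t - x) = ?Q x" using True even_V[of "x - t"] by (simp add: dislocation_potential_def)
      have "((\<lambda>x. \<sigma> * y (t - x)) has_real_derivative f1 x) (at x)"
        using DERIV_cmult[OF DERIV_chain'[OF Dm Dpsi(1)], of \<sigma> x] True by (simp add: f1_def)
      moreover have "((\<lambda>x. - \<sigma> * y' (t - x)) has_real_derivative f2 x) (at x)"
        using DERIV_cmult[OF DERIV_chain'[OF Dm Dpsi(2)], of "- \<sigma>" x] True
        by (simp add: f2_def f_def V algebra_simps)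
      ultimately show ?thesis
        by (auto intro!: has_field_derivative_transform_within_open[where S="{..<0}" and g=f]
            has_field_derivative_transform_within_open[where S="{..<0}" and g=f1] simp: True)
           (auto simp: f_def f1_def)
    next
      case False
      then have x: "x > 0" using that by simp
      have V: "V (x + t) = ?Q x" using x by (simp add: dislocation_potential_def)
      have "((\<lambda>x. y (x + t)) has_real_derivative f1 x) (at x)"
        using DERIV_chain'[OF Dp Dpsi(1), of x] x by (simp add: f1_def)
      moreover have "((\<lambda>x. y' (x + t)) has_real_derivative f2 x) (at x)"
        using DERIV_chain'[OF Dp Dpsi(2), of x] x by (simp add: f2_def f_def V)
      ultimately show ?thesis
        by (auto intro!: has_field_derivative_transform_within_open[where S="{0<..}" and g=f]
            has_field_derivative_transform_within_open[where S="{0<..}" and g=f1] simp: x)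
           (auto simp: f_def f1_def)
    qed
    then show "(f has_real_derivative f1 x) (at x)" "(f1 has_real_derivative f2 x) (at x)" by blast+
  qed
  have cV: "continuous_on UNIV (\<lambda>x. V (x + r))" for r
    by (rule continuous_on_compose2[OF cont_V]) (auto intro!: continuous_intros)
  have mV: "(\<lambda>x. V (x + r)) \<in> borel_measurable borel" for r
    by (rule borel_measurable_continuous_onI[OF cV])
  have mQ: "?Q \<in> borel_measurable lborel"
  proof -
    have "(\<lambda>x. if x < 0 then V (x - t) else V (x + t)) \<in> borel_measurable lborel"
      using mV[of "- t", unfolded add_uminus_conv_diff] mV[of t] by measurable
    then show ?thesis by (simp add: dislocation_potential_def[abs_def])
  qed
  have m: "f \<in> borel_measurable lborel" "f1 \<in> borel_measurable lborel" "f2 \<in> borel_measurable lborel"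
  proof -
    show 1: "f \<in> borel_measurable lborel" "f1 \<in> borel_measurable lborel"
      using borel_measurable_continuous_onI[OF cont(1)] borel_measurable_continuous_onI[OF cont(2)] by simp_all
    show "f2 \<in> borel_measurable lborel"
      unfolding f2_def[abs_def] using 1(1) mQ by measurable
  qed
  obtain C \<kappa> where C0: "0 < C" "0 < \<kappa>"
    "\<And>x. 0 \<le> x \<Longrightarrow> \<bar>psi E x\<bar> \<le> C * exp (- \<kappa> * x) \<and> \<bar>psi' E x\<bar> \<le> C * exp (- \<kappa> * x)"
    by (rule exponential_decay[OF gap(1,2)]) (rule that)
  have "\<bar>y x\<bar> \<le> C * exp (- \<kappa> * x) \<and> \<bar>y' x\<bar> \<le> C * exp (- \<kappa> * x)" if "0 \<le> x" for x
    using C0(3)[OF that] by (simp only: y_def y'_def)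
  note C = C0(1,2) this
  have decay: "\<bar>f x\<bar> \<le> C * exp (- \<kappa> * \<bar>x\<bar>)" "\<bar>f1 x\<bar> \<le> C * exp (- \<kappa> * \<bar>x\<bar>)" for x
  proof -
    have "C * exp (- \<kappa> * (\<bar>x\<bar> + t)) \<le> C * exp (- \<kappa> * \<bar>x\<bar>)"
      using C gap(3) by (intro mult_left_mono) auto
    moreover have "\<bar>y (\<bar>x\<bar> + t)\<bar> \<le> C * exp (- \<kappa> * (\<bar>x\<bar> + t))" "\<bar>y' (\<bar>x\<bar> + t)\<bar> \<le> C * exp (- \<kappa> * (\<bar>x\<bar> + t))"
      using C(3)[of "\<bar>x\<bar> + t"] gap(3) by simp_all
    moreover have "\<bar>f x\<bar> = \<bar>y (\<bar>x\<bar> + t)\<bar>" "\<bar>f1 x\<bar> = \<bar>y' (\<bar>x\<bar> + t)\<bar>"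
      unfolding f_def f1_def using \<sigma>(1) by (cases "x \<le> 0"; simp only: abs_mult abs_minus_cancel if_True if_False; simp add: add.commute)+
    ultimately show "\<bar>f x\<bar> \<le> C * exp (- \<kappa> * \<bar>x\<bar>)" "\<bar>f1 x\<bar> \<le> C * exp (- \<kappa> * \<bar>x\<bar>)" by linarith+
  qed
  obtain M where M: "0 < M" "\<And>x. \<bar>V x\<bar> \<le> M" by (rule V_bounded_global) (rule that)
  have decay2: "\<bar>f2 x\<bar> \<le> ((M + \<bar>E\<bar>) * C) * exp (- \<kappa> * \<bar>x\<bar>)" for x
  proof -
    have "\<bar>?Q x - E\<bar> \<le> M + \<bar>E\<bar>"
      using M(2)[of "x - t"] M(2)[of "x + t"] by (auto simp: dislocation_potential_def)
    then have "\<bar>f2 x\<bar> \<le> (M + \<bar>E\<bar>) * (C * exp (- \<kappa> * \<bar>x\<bar>))"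
      unfolding f2_def abs_mult using decay(1)[of x] M(1) by (intro mult_mono) auto
    then show ?thesis by (simp add: mult.assoc)
  qed
  have f1i: "set_integrable lborel {x..y} f1" for x y
    by (rule borel_integrable_atLeastAtMost'[OF continuous_on_subset[OF cont(2)]]) simp
  have fi: "set_integrable lborel {x..y} f" for x y
    by (rule borel_integrable_atLeastAtMost'[OF continuous_on_subset[OF cont(1)]]) simp
  have f2i: "set_integrable lborel {x..y} f2" for x y
    unfolding f2_def[abs_def]
  proof (rule set_integrable_bounded_mult[OF _ _ fi])
    show "(\<lambda>x. ?Q x - E) \<in> borel_measurable lborel" using mQ by measurable
    show "\<bar>?Q x - E\<bar> \<le> M + \<bar>E\<bar>" for x
      using M(2)[of "x - t"] M(2)[of "x + t"] by (auto simp: dislocation_potential_def)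
  qed
  have H2: "H2_with_derivatives (\<lambda>x. complex_of_real (f x)) (\<lambda>x. complex_of_real (f1 x)) (\<lambda>x. complex_of_real (f2 x))"
    unfolding H2_with_derivatives_def
    using square_integrable_of_decay[OF m(1) C(2) decay(1)] square_integrable_of_decay[OF m(2) C(2) decay(2)]
      square_integrable_of_decay[OF m(3) C(2) decay2]
      weak_derivative_of_C1[OF cont(1) Df(1) f1i] weak_derivative_of_C1[OF cont(2) Df(2) f2i] by blast
  moreover have "\<not> (AE x in lborel. complex_of_real (f x) = 0)"
  proof
    assume "AE x in lborel. complex_of_real (f x) = 0"
    then have "AE x in lborel. f x = 0" by simp
    then obtain N where N: "negligible N" "\<And>x. x \<notin> N \<Longrightarrow> f x = 0" using AE_lborel_negligible by blast
    have "open {x. f x \<noteq> 0}"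
    proof -
      have "open (f -` (- {0}))" by (rule open_vimage[OF _ cont(1)]) auto
      then show ?thesis by (simp add: vimage_def)
    qed
    moreover have "negligible {x. f x \<noteq> 0}" by (rule negligible_subset[OF N(1)]) (use N(2) in blast)
    ultimately have "{x. f x \<noteq> 0} = {}" using open_not_negligible by blast
    then have zero: "f x = 0" for x by blast
    have "y (1 + t) = 0" using zero[of 1] by (simp add: f_def)
    moreover have "f1 1 = 0"
    proof -
      have "f = (\<lambda>x. 0)" using zero by blast
      then have "((\<lambda>x::real. 0::real) has_real_derivative f1 1) (at 1)" using Df(1)[of 1] by simp
      from DERIV_unique[OF this DERIV_const] show ?thesis .
    qed
    then have "y' (1 + t) = 0" by (simp add: f1_def)
    moreover have "psi E x * chi' E x - psi' E x * chi E x = - 2 * P E * R E" for x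
    proof -
      have "psi E x * chi' E x - psi' E x * chi E x = - 2 * P E * R E * (c E x * s' E x - c' E x * s E x)"
        by (simp add: algebra_simps)
      then show ?thesis by (simp add: wronskian_cs)
    qed
    from this[of "1 + t"] have "psi E (1 + t) * chi' E (1 + t) - psi' E (1 + t) * chi E (1 + t) \<noteq> 0"
      using P_pos[of E] R_pos[of E] gap by simp
    ultimately show False by (simp only: y_def y'_def mult_zero_left)
  qed
  moreover have "AE x in lborel. - complex_of_real (f2 x) + of_real (?Q x) * complex_of_real (f x) = of_real E * complex_of_real (f x)"
    by (intro AE_I2) (simp add: f2_def algebra_simps)
  ultimately show ?thesis unfolding schroedinger_eigenvalue_def by blast
qed

end

section \<open>Shape of the eigenfunctions and number of eigenvalues\<close>

text \<open>
  The sign of the product of consecutive increments tells a monotone function from one that turns,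
  irrespective of the sign of the function. This makes the two cases comparable for eigenfunctions, which are
  determined up to a factor.
\<close>
lemma strictly_monotone_increments:
  assumes "strictly_monotone_on A f" "x \<in> A" "y \<in> A" "z \<in> A" "x < y" "y < z"
  shows "(f y - f x) * (f z - f y) > 0"
  using assms unfolding strictly_monotone_on_def monotone_on_def
  by (elim disjE) (simp_all add: mult_neg_neg)

lemma changes_monotonicity_increments:
  assumes "changes_monotonicity_once p q f c" "p \<le> x" "x < c" "c < z" "z \<le> q"
  shows "(f c - f x) * (f z - f c) < 0"
proof -
  have "x \<in> {p..c}" "c \<in> {p..c}" "c \<in> {c..q}" "z \<in> {c..q}" using assms by auto
  then show ?thesis
    using assms unfolding changes_monotonicity_once_def monotone_on_def
    by (elim conjE disjE) (simp_all add: mult_pos_neg mult_neg_pos)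
qed

lemma changes_monotonicity_sides:
  assumes "changes_monotonicity_once p q f c"
  shows "strictly_monotone_on {p..c} f" "strictly_monotone_on {c..q} f" "p < c" "c < q"
  using assms by (auto simp: changes_monotonicity_once_def strictly_monotone_on_def)

lemma strictly_monotone_cong:
  assumes "\<And>x. x \<in> A \<Longrightarrow> f x = g x"
  shows "strictly_monotone_on A f = strictly_monotone_on A g"
  using assms by (simp add: strictly_monotone_on_def monotone_on_def)

lemma changes_monotonicity_cong:
  assumes "\<And>x. x \<in> {p..q} \<Longrightarrow> f x = g x"
  shows "changes_monotonicity_once p q f c = changes_monotonicity_once p q g c"
proof (cases "c \<in> {p<..<q}")
  case True
  then have "\<And>x. x \<in> {p..c} \<Longrightarrow> f x = g x" "\<And>x. x \<in> {c..q} \<Longrightarrow> f x = g x" using assms by auto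
  then show ?thesis by (simp add: changes_monotonicity_once_def monotone_on_def)
next
  case False
  then show ?thesis unfolding changes_monotonicity_once_def by (simp only: simp_thms)
qed

lemma monotone_mirror:
  fixes f :: "real \<Rightarrow> real"
  shows "strict_mono_on {p..q} f \<Longrightarrow> strict_antimono_on {r - q..r - p} (\<lambda>x. f (r - x))"
    and "strict_antimono_on {p..q} f \<Longrightarrow> strict_mono_on {r - q..r - p} (\<lambda>x. f (r - x))"
  by (auto simp: monotone_on_def)

lemma strictly_monotone_mirror:
  assumes "strictly_monotone_on {0..r} f"
  shows "strictly_monotone_on {0..r} (\<lambda>x. f (r - x))"
  using assms monotone_mirror[of 0 r f r] unfolding strictly_monotone_on_def by auto

lemma changes_monotonicity_mirror:
  assumes "changes_monotonicity_once 0 r f c"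
  shows "changes_monotonicity_once 0 r (\<lambda>x. f (r - x)) (r - c)"
  using assms monotone_mirror[of 0 c f r] monotone_mirror[of c r f r]
  unfolding changes_monotonicity_once_def by auto

lemma strictly_monotone_scale:
  assumes "k \<noteq> 0"
  shows "strict_mono_on A g \<Longrightarrow> strictly_monotone_on A (\<lambda>x. k * g x)"
    and "strict_antimono_on A g \<Longrightarrow> strictly_monotone_on A (\<lambda>x. k * g x)"
  using assms unfolding strictly_monotone_on_def monotone_on_def
  by (cases "k > 0"; simp)+

lemma strict_mono_of_deriv:
  fixes f :: "real \<Rightarrow> real"
  assumes "\<And>x. (f has_real_derivative f' x) (at x)" "\<And>x. p < x \<Longrightarrow> x < q \<Longrightarrow> f' x > 0"
  shows "strict_mono_on {p..q} f"
proof (rule strict_mono_onI)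
  fix x y assume xy: "x \<in> {p..q}" "y \<in> {p..q}" "x < y"
  show "f x < f y"
  proof (rule DERIV_pos_imp_increasing_open[OF xy(3)])
    fix t assume "x < t" "t < y"
    then have "f' t > 0" using assms(2)[of t] xy by simp
    then show "\<exists>l. (f has_real_derivative l) (at t) \<and> 0 < l" using assms(1) by blast
  next
    show "continuous_on {x..y} f"
      by (rule continuous_at_imp_continuous_on, rule ballI, rule DERIV_isCont, rule assms(1))
  qed
qed

lemma strict_antimono_of_deriv:
  fixes f :: "real \<Rightarrow> real"
  assumes "\<And>x. (f has_real_derivative f' x) (at x)" "\<And>x. p < x \<Longrightarrow> x < q \<Longrightarrow> f' x < 0"
  shows "strict_antimono_on {p..q} f"
proof -
  have "strict_mono_on {p..q} (\<lambda>x. - f x)"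
    by (rule strict_mono_of_deriv[OF DERIV_minus[OF assms(1)]]) (use assms(2) in simp)
  then show ?thesis by (simp add: monotone_on_def)
qed

context increasing_well
begin

lemma scaled_s_b_alternative:
  assumes "k \<noteq> 0"
  shows "strictly_monotone_on {0..h} (\<lambda>x. k * s b x) \<or> (\<exists>d0. changes_monotonicity_once 0 h (\<lambda>x. k * s b x) d0)"
proof (cases rule: s'_b_shape)
  case increasing
  have "strict_mono_on {0..h} (s b)"
    by (rule strict_mono_of_deriv[OF DERIV_s(1)]) (use increasing in simp)
  then show ?thesis using strictly_monotone_scale(1)[OF assms] by blast
next
  case (turning d0)
  have "strict_mono_on {0..d0} (s b)"
    by (rule strict_mono_of_deriv[OF DERIV_s(1)]) (use turning in simp)
  moreover have "strict_antimono_on {d0..h} (s b)"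
    by (rule strict_antimono_of_deriv[OF DERIV_s(1)]) (use turning in simp)
  ultimately have "changes_monotonicity_once 0 h (\<lambda>x. k * s b x) d0"
    using assms turning(1,2) unfolding changes_monotonicity_once_def monotone_on_def
    by (cases "k > 0") (auto simp: not_less)
  then show ?thesis by blast
qed

lemma scaled_increments: "(k * A - k * B) * (k * C - k * A) = k\<^sup>2 * ((A - B) * (C - A))" for k A B C :: real
  by (simp add: power2_eq_square algebra_simps)

lemma monotone_imp_s'_pos:
  assumes "strictly_monotone_on {0..h} (\<lambda>x. k * s b x)" "0 < x" "x < h"
  shows "s' b x > 0"
proof (cases rule: s'_b_shape)
  case (turning d0)
  have "s b 0 < s b d0"
    using strict_mono_onD[OF strict_mono_of_deriv[OF DERIV_s(1)], of 0 d0 b 0 d0] turning by simp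
  moreover have "s b h < s b d0"
    using strict_antimono_of_deriv[OF DERIV_s(1), of d0 h b] turning by (auto simp: monotone_on_def)
  ultimately have "(s b d0 - s b 0) * (s b h - s b d0) < 0" by (intro mult_pos_neg) auto
  moreover have "k\<^sup>2 * ((s b d0 - s b 0) * (s b h - s b d0)) > 0"
    using strictly_monotone_increments[OF assms(1), of 0 d0 h] turning(1,2)
    unfolding scaled_increments by simp
  ultimately show ?thesis by (smt (verit) mult_nonneg_nonpos zero_le_power2)
qed (use assms in simp)

text \<open>
  The turning point of the eigenfunction is the zero of \<open>s'\<close>: at any other point there are neighbours
  with increments of equal sign.
\<close>
lemma turning_imp_s'_sign:
  assumes "changes_monotonicity_once 0 h (\<lambda>x. k * s b x) d0"
  shows "0 < d0" "d0 < h" "\<And>x. 0 < x \<Longrightarrow> x < d0 \<Longrightarrow> s' b x > 0"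
    "s' b d0 = 0" "\<And>x. d0 < x \<Longrightarrow> x < h \<Longrightarrow> s' b x < 0"
proof -
  show d0: "0 < d0" "d0 < h" using changes_monotonicity_sides[OF assms] by simp_all
  have k: "k\<^sup>2 * ((s b d0 - s b x) * (s b z - s b d0)) < 0" if "0 \<le> x" "x < d0" "d0 < z" "z \<le> h" for x z
    using changes_monotonicity_increments[OF assms that] unfolding scaled_increments .
  have "(s b d0 - s b x) * (s b z - s b d0) < 0" if "0 \<le> x" "x < d0" "d0 < z" "z \<le> h" for x z
    using k[OF that] by (simp add: mult_less_0_iff)
  note turn = this
  have "(\<forall>x. 0 < x \<longrightarrow> x < d0 \<longrightarrow> s' b x > 0) \<and> s' b d0 = 0 \<and> (\<forall>x. d0 < x \<longrightarrow> x < h \<longrightarrow> s' b x < 0)"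
  proof (cases rule: s'_b_shape)
    case increasing
    have "strict_mono_on {0..h} (s b)"
      by (rule strict_mono_of_deriv[OF DERIV_s(1)]) (use increasing in simp)
    then have "s b 0 < s b d0" "s b d0 < s b h"
      using strict_mono_onD[of "{0..h}" "s b" 0 d0] strict_mono_onD[of "{0..h}" "s b" d0 h] d0 by simp_all
    then have "(s b d0 - s b 0) * (s b h - s b d0) > 0" by simp
    then show ?thesis using turn[of 0 h] d0 by simp
  next
    case (turning e)
    have up: "strict_mono_on {0..e} (s b)"
      by (rule strict_mono_of_deriv[OF DERIV_s(1)]) (use turning in simp)
    have down: "strict_antimono_on {e..h} (s b)"
      by (rule strict_antimono_of_deriv[OF DERIV_s(1)]) (use turning in simp)
    have "\<not> d0 < e"
    proof
      assume "d0 < e"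
      then have "s b 0 < s b d0" "s b d0 < s b e"
        using strict_mono_onD[OF up, of 0 d0] strict_mono_onD[OF up, of d0 e] d0 by simp_all
      then have "(s b d0 - s b 0) * (s b e - s b d0) > 0" by simp
      then show False using turn[of 0 e] d0 \<open>d0 < e\<close> turning(2) by simp
    qed
    moreover have "\<not> e < d0"
    proof
      assume "e < d0"
      then have "s b d0 < s b e" "s b h < s b d0"
        using monotone_onD[OF down, of e d0] monotone_onD[OF down, of d0 h] d0 by simp_all
      then have "(s b d0 - s b e) * (s b h - s b d0) > 0" by (simp add: mult_neg_neg)
      then show False using turn[of e h] d0 \<open>e < d0\<close> turning(1) by simp
    qed
    ultimately have "d0 = e" by simp
    then show ?thesis using turning by simp
  qed
  then show "\<And>x. 0 < x \<Longrightarrow> x < d0 \<Longrightarrow> s' b x > 0" "s' b d0 = 0" "\<And>x. d0 < x \<Longrightarrow> x < h \<Longrightarrow> s' b x < 0"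
    by blast+
qed

text \<open>
  The ground state for \<open>a\<close> is odd about \<open>h\<close>, so its derivative is negative on both halves of \<open>[0,d]\<close>.
\<close>
lemma c_a_antimono: "strict_antimono_on {0..d} (c a)"
proof (rule strict_antimono_of_deriv[OF DERIV_c(1)])
  fix x assume x: "0 < x" "x < d"
  have "c a d = - 1" "c' a d = 0" unfolding at_period ground_state(1)[OF h_pos] by simp_all
  then have "c' a (d - x) = c' a x" using mirror_c(2)[of a x] by simp
  then show "c' a x < 0" using c'_a_neg[of x] c'_a_neg[of "d - x"] x by (cases "x \<le> h") auto
qed

lemma num_iff:
  assumes "0 \<le> t"
  shows "num_dislocation_eigenvalues V t {a<..<b} n \<longleftrightarrow> finite (states t) \<and> card (states t) = n"
proof -
  have "{E \<in> {a<..<b}. schroedinger_eigenvalue (dislocation_potential V t) E} = states t"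
    unfolding states_def using eigenvalue_imp_boundary boundary_imp_eigenvalue assms by auto
  then show ?thesis by (simp only: num_dislocation_eigenvalues_def Let_def)
qed

lemma num_left:
  "0 < t \<Longrightarrow> t < h \<Longrightarrow> num_dislocation_eigenvalues V t {a<..<b} (if s' b t > 0 then 1 else 0)"
  using num_iff[of t] states_left[of t] by simp

lemma num_half: "num_dislocation_eigenvalues V h {a<..<b} 0"
  using num_iff[of h] states_half h_pos by simp

lemma num_right:
  assumes "h < t" "t < d"
  shows "num_dislocation_eigenvalues V t {a<..<b} (if s' b (d - t) < 0 then 2 else 1)"
proof -
  have "0 < d - t" "d - t < h" using assms by (auto simp: field_simps)
  from states_right[OF this] show ?thesis using num_iff[of t] assms d_pos by simp
qed

lemma num_period: "num_dislocation_eigenvalues V d {a<..<b} 0"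
  using num_iff[of d] states_period d_pos by simp

lemma gap_increasing: "gap d V 1 = {a<..<b}"
  using gap_1 a_less_b by simp

lemma neumann_eigenfunction_monotone:
  assumes "neumann_eigenfunction d V 2 u"
  shows "strictly_monotone_on {0..d} u"
proof -
  obtain k where k: "k \<noteq> 0" "u = (\<lambda>x. k * ext a 1 0 x)"
    using assms unfolding neumann_eigenfunction_2 by blast
  have "strictly_monotone_on {0..d} u = strictly_monotone_on {0..d} (\<lambda>x. k * c a x)"
    by (rule strictly_monotone_cong) (simp add: k ext_def)
  then show ?thesis using strictly_monotone_scale(2)[OF k(1) c_a_antimono] by simp
qed

lemma dirichlet_eigenfunction_shape:
  assumes "dirichlet_eigenfunction d V 1 u"
  obtains k where "k \<noteq> 0"
    "strictly_monotone_on {0..h} u \<longleftrightarrow> strictly_monotone_on {0..h} (\<lambda>x. k * s b x)"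
    "\<And>d0. changes_monotonicity_once 0 h u d0 \<longleftrightarrow> changes_monotonicity_once 0 h (\<lambda>x. k * s b x) d0"
proof -
  obtain k where k: "k \<noteq> 0" "u = (\<lambda>x. k * ext b 0 1 x)"
    using assms unfolding dirichlet_eigenfunction_1 by blast
  have eq: "u x = k * s b x" if "x \<in> {0..h}" for x using that d_pos by (simp add: k ext_def)
  show ?thesis
    by (rule that[OF k(1) strictly_monotone_cong[OF eq] changes_monotonicity_cong[OF eq]])
qed

lemma count_monotone:
  assumes "dirichlet_eigenfunction d V 1 u" "strictly_monotone_on {0..h} u"
  shows "(\<forall>t \<in> {0<..<d} - {h}. num_dislocation_eigenvalues V t (gap d V 1) 1) \<and>
    num_dislocation_eigenvalues V h (gap d V 1) 0"
proof -
  obtain k where "strictly_monotone_on {0..h} (\<lambda>x. k * s b x)"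
    using dirichlet_eigenfunction_shape[OF assms(1)] assms(2) by metis
  note pos = monotone_imp_s'_pos[OF this]
  have "num_dislocation_eigenvalues V t {a<..<b} 1" if "0 < t" "t < d" "t \<noteq> h" for t
  proof (cases "t < h")
    case True
    then show ?thesis using num_left[of t] pos[of t] that by simp
  next
    case False
    then have "h < t" "0 < d - t" "d - t < h" using that by (auto simp: field_simps)
    then show ?thesis using num_right[of t] pos[of "d - t"] that by simp
  qed
  then show ?thesis unfolding gap_increasing using num_half by simp
qed

lemma count_turning:
  assumes "dirichlet_eigenfunction d V 1 u" "changes_monotonicity_once 0 h u d0"
  shows "(\<forall>t \<in> {0<..<d0}. num_dislocation_eigenvalues V t (gap d V 1) 1) \<and>
    (\<forall>t \<in> {d0..h}. num_dislocation_eigenvalues V t (gap d V 1) 0) \<and>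
    (\<forall>t \<in> {h<..<d - d0}. num_dislocation_eigenvalues V t (gap d V 1) 2) \<and>
    (\<forall>t \<in> {d - d0..<d}. num_dislocation_eigenvalues V t (gap d V 1) 1) \<and>
    num_dislocation_eigenvalues V d (gap d V 1) 0"
proof -
  obtain k where "changes_monotonicity_once 0 h (\<lambda>x. k * s b x) d0"
    using dirichlet_eigenfunction_shape[OF assms(1)] assms(2) by metis
  note sg = turning_imp_s'_sign[OF this]
  have left: "num_dislocation_eigenvalues V t {a<..<b} 1" if "0 < t" "t < d0" for t
    using num_left[of t] sg(2) sg(3)[OF that] that by simp
  have mid: "num_dislocation_eigenvalues V t {a<..<b} 0" if "d0 \<le> t" "t \<le> h" for t
  proof (cases "t = h")
    case True
    show ?thesis unfolding True by (rule num_half)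
  next
    case False
    have "\<not> s' b t > 0" using sg(4) sg(5)[of t] that False by (cases "t = d0") auto
    then show ?thesis using num_left[of t] sg(1) that False by simp
  qed
  have two: "num_dislocation_eigenvalues V t {a<..<b} 2" if "h < t" "t < d - d0" for t
  proof -
    have "d0 < d - t" "d - t < h" using that by (auto simp: field_simps)
    then show ?thesis using num_right[of t] sg(1) sg(5)[of "d - t"] that by simp
  qed
  have one: "num_dislocation_eigenvalues V t {a<..<b} 1" if "d - d0 \<le> t" "t < d" for t
  proof -
    have "0 < d - t" "d - t \<le> d0" "h < t" using that sg(2) by (auto simp: field_simps)
    moreover from this have "\<not> s' b (d - t) < 0" using sg(4) sg(3)[of "d - t"] by (cases "d - t = d0") auto
    ultimately show ?thesis using num_right[of t] that by simp
  qed
  show ?thesis unfolding gap_increasing using left mid two one num_period by simp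
qed

end

locale decreasing_well = even_periodic +
  assumes increasing_half_shift: "increasing_well (half_shift d V) d"
begin

sublocale W: increasing_well "half_shift d V" d
  by (rule increasing_half_shift)

lemma b_less_a: "b < a"
  using W.a_less_b by (simp only: half_shift_twice)

lemma gap_decreasing: "gap d V 1 = {b<..<a}"
  using gap_1 b_less_a by simp

text \<open>
  Translating the potential by \<open>d/2\<close> changes the dislocation parameter by \<open>d/2\<close>. The two forms differ by a
  period; the first is used for \<open>t \<le> d/2\<close> and the second for \<open>t > d/2\<close>, so that the parameter stays in \<open>[0,d]\<close>.
\<close>
lemma num_half_shift:
  "num_dislocation_eigenvalues V t G n = num_dislocation_eigenvalues W (t + h) G n"
  "num_dislocation_eigenvalues V t G n = num_dislocation_eigenvalues W (t - h) G n"
proof -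
  have "dislocation_potential V t x = dislocation_potential W (t + h) x" for x
  proof -
    have "x - (t + h) + h = x - t" "x + (t + h) + h = (x + t) + d" by simp_all
    then show ?thesis unfolding dislocation_potential_def half_shift_def by (simp only: periodic_V)
  qed
  then show "num_dislocation_eigenvalues V t G n = num_dislocation_eigenvalues W (t + h) G n"
    unfolding num_dislocation_eigenvalues_def by presburger
  have "dislocation_potential V t x = dislocation_potential W (t - h) x" for x
  proof -
    have "x - (t - h) + h = (x - t) + d" "x + (t - h) + h = x + t" by simp_all
    then show ?thesis unfolding dislocation_potential_def half_shift_def by (simp only: periodic_V)
  qed
  then show "num_dislocation_eigenvalues V t G n = num_dislocation_eigenvalues W (t - h) G n"
    unfolding num_dislocation_eigenvalues_def by presburger
qed

lemma num_left:
  assumes "0 < t" "t < h"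
  shows "num_dislocation_eigenvalues V t {b<..<a} (if phi' W a (h - t) < 0 then 2 else 1)"
proof -
  have "h < t + h" "t + h < d" "d - (t + h) = h - t" using assms by (auto simp: field_simps)
  then show ?thesis using W.num_right[of "t + h"] unfolding half_shift_twice num_half_shift(1) by simp
qed

lemma num_half: "num_dislocation_eigenvalues V h {b<..<a} 0"
  using W.num_period unfolding half_shift_twice num_half_shift(1)[of h] by simp

lemma num_right:
  assumes "h < t" "t < d"
  shows "num_dislocation_eigenvalues V t {b<..<a} (if phi' W a (t - h) > 0 then 1 else 0)"
proof -
  have "0 < t - h" "t - h < h" using assms by (auto simp: field_simps)
  then show ?thesis using W.num_left[of "t - h"] unfolding half_shift_twice num_half_shift(2)[of t] by simp
qed

lemma num_period: "num_dislocation_eigenvalues V d {b<..<a} 0"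
proof -
  have "d - h = h" by simp
  then show ?thesis using W.num_half unfolding half_shift_twice num_half_shift(2)[of d] by simp
qed

lemma dirichlet_eigenfunction_monotone:
  assumes "dirichlet_eigenfunction d V 1 u"
  shows "strictly_monotone_on {0..h} u"
proof -
  obtain k where k: "k \<noteq> 0" "u = (\<lambda>x. k * ext b 0 1 x)"
    using assms unfolding dirichlet_eigenfunction_1 by blast
  have "c' b h \<noteq> 0" using at_b(2) by simp
  define k' where "k' = - k / c' b h"
  have "k' \<noteq> 0" using k \<open>c' b h \<noteq> 0\<close> by (simp add: k'_def)
  have eq: "u x = k' * theta W b (h - x)" if "x \<in> {0..h}" for x
    using that d_pos \<open>c' b h \<noteq> 0\<close> unfolding at_b(3) by (simp add: k ext_def k'_def)
  have "strict_antimono_on {0..h} (theta W b)"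
    by (rule monotone_on_subset[OF W.c_a_antimono]) (use d_pos in auto)
  then have "strict_mono_on {h - h..h - 0} (\<lambda>x. theta W b (h - x))" by (rule monotone_mirror(2))
  then have "strictly_monotone_on {0..h} (\<lambda>x. k' * theta W b (h - x))"
    using strictly_monotone_scale(1)[OF \<open>k' \<noteq> 0\<close>] by simp
  then show ?thesis using strictly_monotone_cong[of "{0..h}" u, OF eq] by simp
qed

text \<open>
  On \<open>[0,h]\<close> the second Neumann eigenfunction is the reflection of the first Dirichlet eigenfunction of the
  translated potential, so a turning point \<open>d0\<close> of the former is the turning point \<open>h - d0\<close> of the latter.
\<close>
lemma neumann_eigenfunction_shape:
  assumes "neumann_eigenfunction d V 2 u"
  obtains k where "k \<noteq> 0"
    "strictly_monotone_on {0..h} u \<longleftrightarrow> strictly_monotone_on {0..h} (\<lambda>x. k * phi W a x)"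
    "\<And>d0. changes_monotonicity_once 0 h u d0 \<longleftrightarrow>
           changes_monotonicity_once 0 h (\<lambda>x. k * phi W a x) (h - d0)"
proof -
  obtain k where k: "k \<noteq> 0" "u = (\<lambda>x. k * ext a 1 0 x)"
    using assms unfolding neumann_eigenfunction_2 by blast
  define k' where "k' = k * (- theta' W a h)"
  define y where "y x = k' * phi W a x" for x
  have "theta' W a h < 0" using W.at_b(2) by (simp only: half_shift_twice)
  then have "k' \<noteq> 0" using k by (simp add: k'_def)
  have ca: "c a (h - x) = - theta' W a h * phi W a x" for x
    using W.at_b(3)[of x] by (simp only: half_shift_twice)
  have eq: "u x = y (h - x)" if "x \<in> {0..h}" for x
    using that d_pos ca[of "h - x"] by (simp add: k ext_def k'_def y_def)
  have hh: "h - (h - x) = x" for x by simp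
  have "strictly_monotone_on {0..h} (\<lambda>x. y (h - x)) \<longleftrightarrow> strictly_monotone_on {0..h} y"
    using strictly_monotone_mirror[of h y] strictly_monotone_mirror[of h "\<lambda>x. y (h - x)"]
    unfolding hh by blast
  then have mono: "strictly_monotone_on {0..h} u \<longleftrightarrow> strictly_monotone_on {0..h} y"
    using strictly_monotone_cong[of "{0..h}" u, OF eq] by blast
  have "changes_monotonicity_once 0 h (\<lambda>x. y (h - x)) d0 \<longleftrightarrow> changes_monotonicity_once 0 h y (h - d0)" for d0
    using changes_monotonicity_mirror[of h y "h - d0"]
      changes_monotonicity_mirror[of h "\<lambda>x. y (h - x)" d0] unfolding hh by blast
  then have turn: "changes_monotonicity_once 0 h u d0 \<longleftrightarrow> changes_monotonicity_once 0 h y (h - d0)" for d0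
    using changes_monotonicity_cong[of 0 h u, OF eq] by blast
  show ?thesis using that[OF \<open>k' \<noteq> 0\<close>] mono turn unfolding y_def[abs_def] by blast
qed

lemma neumann_eigenfunction_alternative:
  assumes "neumann_eigenfunction d V 2 u"
  shows "strictly_monotone_on {0..h} u \<or> (\<exists>d0. changes_monotonicity_once 0 h u d0)"
proof -
  obtain k where k: "k \<noteq> 0"
    "strictly_monotone_on {0..h} u \<longleftrightarrow> strictly_monotone_on {0..h} (\<lambda>x. k * phi W a x)"
    "\<And>d0. changes_monotonicity_once 0 h u d0 \<longleftrightarrow> changes_monotonicity_once 0 h (\<lambda>x. k * phi W a x) (h - d0)"
    by (rule neumann_eigenfunction_shape[OF assms]) (rule that)
  have "h - (h - x) = x" for x by simp
  then show ?thesis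
    using W.scaled_s_b_alternative[OF k(1)] k(2) k(3)[of "h - _"] unfolding half_shift_twice by metis
qed

lemma count_monotone:
  assumes "neumann_eigenfunction d V 2 u" "strictly_monotone_on {0..h} u"
  shows "(\<forall>t \<in> {0<..<d} - {h}. num_dislocation_eigenvalues V t (gap d V 1) 1) \<and>
    num_dislocation_eigenvalues V h (gap d V 1) 0"
proof -
  obtain k where "strictly_monotone_on {0..h} (\<lambda>x. k * phi W a x)"
    using neumann_eigenfunction_shape[OF assms(1)] assms(2) by metis
  then have pos: "phi' W a x > 0" if "0 < x" "x < h" for x
    using W.monotone_imp_s'_pos[of k x] that unfolding half_shift_twice by blast
  have "num_dislocation_eigenvalues V t {b<..<a} 1" if "0 < t" "t < d" "t \<noteq> h" for t
  proof (cases "t < h")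
    case True
    then show ?thesis using num_left[of t] pos[of "h - t"] that by simp
  next
    case False
    then have "h < t" "0 < t - h" "t - h < h" using that by (auto simp: field_simps)
    then show ?thesis using num_right[of t] pos[of "t - h"] that by simp
  qed
  then show ?thesis unfolding gap_decreasing using num_half by simp
qed

lemma count_turning:
  assumes "neumann_eigenfunction d V 2 u" "changes_monotonicity_once 0 h u d0"
  shows "(\<forall>t \<in> {0<..<d0}. num_dislocation_eigenvalues V t (gap d V 1) 2) \<and>
    (\<forall>t \<in> {d0..<h}. num_dislocation_eigenvalues V t (gap d V 1) 1) \<and>
    num_dislocation_eigenvalues V h (gap d V 1) 0 \<and>
    (\<forall>t \<in> {h<..<d - d0}. num_dislocation_eigenvalues V t (gap d V 1) 1) \<and>
    (\<forall>t \<in> {d - d0..d}. num_dislocation_eigenvalues V t (gap d V 1) 0)"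
proof -
  obtain k where "changes_monotonicity_once 0 h (\<lambda>x. k * phi W a x) (h - d0)"
    using neumann_eigenfunction_shape[OF assms(1)] assms(2) by metis
  note sg = W.turning_imp_s'_sign[unfolded half_shift_twice, OF this]
  have d0: "0 < d0" "d0 < h" using sg(1,2) by simp_all
  have two: "num_dislocation_eigenvalues V t {b<..<a} 2" if "0 < t" "t < d0" for t
    using num_left[of t] sg(5)[of "h - t"] that d0 by simp
  have one: "num_dislocation_eigenvalues V t {b<..<a} 1" if "d0 \<le> t" "t < h" for t
  proof -
    have "\<not> phi' W a (h - t) < 0" using sg(4) sg(3)[of "h - t"] that by (cases "t = d0") auto
    then show ?thesis using num_left[of t] that d0 by simp
  qed
  have one': "num_dislocation_eigenvalues V t {b<..<a} 1" if "h < t" "t < d - d0" for t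
  proof -
    have "0 < t - h" "t - h < h - d0" using that by (auto simp: field_simps)
    then show ?thesis using num_right[of t] sg(3)[of "t - h"] that d0 by simp
  qed
  have zero: "num_dislocation_eigenvalues V t {b<..<a} 0" if "d - d0 \<le> t" "t \<le> d" for t
  proof (cases "t = d")
    case True
    show ?thesis unfolding True by (rule num_period)
  next
    case False
    have "h - d0 \<le> t - h" "t - h < h" "h < t" using that False d0 by (auto simp: field_simps)
    moreover from this have "\<not> phi' W a (t - h) > 0"
      using sg(4) sg(5)[of "t - h"] by (cases "t - h = h - d0") auto
    ultimately show ?thesis using num_right[of t] that False by simp
  qed
  show ?thesis unfolding gap_decreasing using two one num_half one' zero by simp
qed

end

theorem theorem3p12:
  fixes d :: real and V\<^sub>0 :: "real \<Rightarrow> real"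
  assumes "d > 0"
    and "V\<^sub>0 C1_differentiable_on UNIV"
    and "\<forall>x. V\<^sub>0 (- x) = V\<^sub>0 x"
    and "\<forall>x. V\<^sub>0 (x + d) = V\<^sub>0 x"
  defines "G\<^sub>1 \<equiv> gap d V\<^sub>0 1"
    and "\<mu> \<equiv> dirichlet_eigenvalue d V\<^sub>0"
    and "\<nu> \<equiv> neumann_eigenvalue d V\<^sub>0"
  shows
    "(strict_mono_on {0..d/2} V\<^sub>0 \<longrightarrow>
        \<nu> 2 < \<mu> 1 \<and> G\<^sub>1 = {\<nu> 2 <..< \<mu> 1} \<and>
        (\<forall>u. neumann_eigenfunction d V\<^sub>0 2 u \<longrightarrow> strictly_monotone_on {0..d} u) \<and>
        (\<forall>u. dirichlet_eigenfunction d V\<^sub>0 1 u \<longrightarrow>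
          (strictly_monotone_on {0..d/2} u \<or> (\<exists>d\<^sub>0. changes_monotonicity_once 0 (d/2) u d\<^sub>0)) \<and>
          (strictly_monotone_on {0..d/2} u \<longrightarrow>
            (\<forall>t \<in> {0<..<d} - {d/2}. num_dislocation_eigenvalues V\<^sub>0 t G\<^sub>1 1) \<and>
            num_dislocation_eigenvalues V\<^sub>0 (d/2) G\<^sub>1 0) \<and>
          (\<forall>d\<^sub>0. changes_monotonicity_once 0 (d/2) u d\<^sub>0 \<longrightarrow>
            (\<forall>t \<in> {0<..<d\<^sub>0}. num_dislocation_eigenvalues V\<^sub>0 t G\<^sub>1 1) \<and>
            (\<forall>t \<in> {d\<^sub>0..d/2}. num_dislocation_eigenvalues V\<^sub>0 t G\<^sub>1 0) \<and>
            (\<forall>t \<in> {d/2<..<d - d\<^sub>0}. num_dislocation_eigenvalues V\<^sub>0 t G\<^sub>1 2) \<and>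
            (\<forall>t \<in> {d - d\<^sub>0..<d}. num_dislocation_eigenvalues V\<^sub>0 t G\<^sub>1 1) \<and>
            num_dislocation_eigenvalues V\<^sub>0 d G\<^sub>1 0)))
     \<and>
     (strict_antimono_on {0..d/2} V\<^sub>0 \<longrightarrow>
        \<mu> 1 < \<nu> 2 \<and> G\<^sub>1 = {\<mu> 1 <..< \<nu> 2} \<and>
        (\<forall>u. dirichlet_eigenfunction d V\<^sub>0 1 u \<longrightarrow> strictly_monotone_on {0..d/2} u) \<and>
        (\<forall>u. neumann_eigenfunction d V\<^sub>0 2 u \<longrightarrow>
          (strictly_monotone_on {0..d/2} u \<or> (\<exists>d\<^sub>0. changes_monotonicity_once 0 (d/2) u d\<^sub>0)) \<and>
          (strictly_monotone_on {0..d/2} u \<longrightarrow>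
            (\<forall>t \<in> {0<..<d} - {d/2}. num_dislocation_eigenvalues V\<^sub>0 t G\<^sub>1 1) \<and>
            num_dislocation_eigenvalues V\<^sub>0 (d/2) G\<^sub>1 0) \<and>
          (\<forall>d\<^sub>0. changes_monotonicity_once 0 (d/2) u d\<^sub>0 \<longrightarrow>
            (\<forall>t \<in> {0<..<d\<^sub>0}. num_dislocation_eigenvalues V\<^sub>0 t G\<^sub>1 2) \<and>
            (\<forall>t \<in> {d\<^sub>0..<d/2}. num_dislocation_eigenvalues V\<^sub>0 t G\<^sub>1 1) \<and>
            num_dislocation_eigenvalues V\<^sub>0 (d/2) G\<^sub>1 0 \<and>
            (\<forall>t \<in> {d/2<..<d - d\<^sub>0}. num_dislocation_eigenvalues V\<^sub>0 t G\<^sub>1 1) \<and>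
            (\<forall>t \<in> {d - d\<^sub>0..d}. num_dislocation_eigenvalues V\<^sub>0 t G\<^sub>1 0))))"
proof -
  have D: "(V\<^sub>0 has_real_derivative deriv V\<^sub>0 x) (at x)" for x
    using assms(2) by (simp add: C1_on_UNIV)
  interpret even_periodic V\<^sub>0 d
  proof
    show "continuous_on UNIV V\<^sub>0"
      by (rule continuous_at_imp_continuous_on, rule ballI, rule DERIV_isCont, rule D)
  qed (use assms(1,3,4) in simp_all)
  show ?thesis
    unfolding G\<^sub>1_def \<mu>_def \<nu>_def
    apply (rule conjI; rule impI)
    subgoal premises increasing
    proof -
      interpret increasing_well V\<^sub>0 d by unfold_locales (use D increasing in blast)+
      have "strictly_monotone_on {0..h} u \<or> (\<exists>d0. changes_monotonicity_once 0 h u d0)"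
        if u: "dirichlet_eigenfunction d V\<^sub>0 1 u" for u
        using dirichlet_eigenfunction_shape[OF u] scaled_s_b_alternative by metis
      moreover have "neumann_eigenvalue d V\<^sub>0 2 < dirichlet_eigenvalue d V\<^sub>0 1"
        "gap d V\<^sub>0 1 = {neumann_eigenvalue d V\<^sub>0 2 <..< dirichlet_eigenvalue d V\<^sub>0 1}"
        unfolding neumann_2 dirichlet_1 by (rule a_less_b gap_increasing)+
      ultimately show ?thesis
        using neumann_eigenfunction_monotone count_monotone count_turning by blast
    qed
    subgoal premises decreasing
    proof -
      have mirrored: "increasing_well W d"
      proof (intro increasing_well.intro half_shift increasing_well_axioms.intro)
        show "\<exists>D. (W has_real_derivative D) (at x)" for x
          unfolding half_shift_def[abs_def] using D[of "x + d / 2"] by (auto simp: DERIV_shift)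
        have "strict_mono_on {d/2 - d/2..d/2 - 0} (\<lambda>x. V\<^sub>0 (d/2 - x))"
          by (rule monotone_mirror(2)[OF decreasing])
        moreover have "V\<^sub>0 (d/2 - x) = W x" for x
          using V_mirror[of "x + d/2"] by (simp add: half_shift_def)
        ultimately show "strict_mono_on {0..d/2} W" by simp
      qed
      interpret decreasing_well V\<^sub>0 d
        by (intro decreasing_well.intro even_periodic_axioms decreasing_well_axioms.intro mirrored)
      have "dirichlet_eigenvalue d V\<^sub>0 1 < neumann_eigenvalue d V\<^sub>0 2"
        "gap d V\<^sub>0 1 = {dirichlet_eigenvalue d V\<^sub>0 1 <..< neumann_eigenvalue d V\<^sub>0 2}"
        unfolding neumann_2 dirichlet_1 by (rule b_less_a gap_decreasing)+
      then show ?thesis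
        using dirichlet_eigenfunction_monotone neumann_eigenfunction_alternative
          count_monotone count_turning by blast
    qed
    done
qed

end
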